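(* There exists a 2-dimensional cubical complex with 30 vertices, 120 edges and 90 (square) faces which is homotopy equivalent to $Q_6$ and is $S_6$-equivariant, i.e. carries an action of the symmetric group $S_6$ by automorphisms of the cubical complex; this action of $S_6$ is transitive on the set of vertices, on the set of edges and on the set of faces.
   Context: Let $S^1$ be the circle with a fixed point $\infty\in S^1$. For $n\ge1$ let $T^{n-1}=\{(x_1,\ldots,x_{n-1})\mid x_i\in S^1\}$ be the $(n-1)$-dimensional torus and set $x_n=\infty$. For $1\leq i<j<k\leq n$ let $A_{ijk}\subset T^{n-1}$ be the subset of points satisfying $x_i=x_j=x_k$, and let $A_n=\bigcup_{1\leq i<j<k\leq n}A_{ijk}$. The space $Q_n$ is the complement $T^{n-1}\setminus A_n$; here $n=6$. A cubical complex is a CW-complex whose cells are cubes, with boundary faces of each cube attached to cells of smaller dimension. *)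

theory Defs
  imports
    "HOL-Analysis.Analysis"
    "HOL-Algebra.Group_Action"
    "HOL-Algebra.Sym_Groups"
begin

text \<open>The circle is the unit circle in the complex plane; the fixed point $\infty$ is the
  parameter \<open>p\<close>.\<close>

abbreviation circle :: "complex set" where
  "circle \<equiv> sphere 0 1"

text \<open>Points of $T^{n-1}$ are functions on the index set \<open>{1..n-1}\<close>, extensional outside it,
  so that the coordinate $x_n = \infty$ has to be supplied by \<open>x(n := p)\<close>.\<close>

definition torus :: "nat \<Rightarrow> (nat \<Rightarrow> complex) topology" where
  "torus n = product_topology (\<lambda>_. top_of_set circle) {1..n-1}"

definition triple_diagonal ::
  "complex \<Rightarrow> nat \<Rightarrow> nat \<Rightarrow> nat \<Rightarrow> nat \<Rightarrow> (nat \<Rightarrow> complex) set" where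
  "triple_diagonal p n i j k =
     {x \<in> topspace (torus n). (x(n := p)) i = (x(n := p)) j \<and> (x(n := p)) j = (x(n := p)) k}"

definition triple_arrangement :: "complex \<Rightarrow> nat \<Rightarrow> (nat \<Rightarrow> complex) set" where
  "triple_arrangement p n =
     \<Union> {triple_diagonal p n i j k | i j k. 1 \<le> i \<and> i < j \<and> j < k \<and> k \<le> n}"

definition Q_space :: "complex \<Rightarrow> nat \<Rightarrow> (nat \<Rightarrow> complex) topology" where
  "Q_space p n = subtopology (torus n) (topspace (torus n) - triple_arrangement p n)"

text \<open>The cube $[0,1]^n$ sits in the first \<open>n\<close> coordinates (indexed from 0) of
  \<open>nat \<Rightarrow> real\<close>, all other coordinates being 0.\<close>

definition unit_cube :: "nat \<Rightarrow> (nat \<Rightarrow> real) set" where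
  "unit_cube n = {x. (\<forall>i<n. 0 \<le> x i \<and> x i \<le> 1) \<and> (\<forall>i\<ge>n. x i = 0)}"

definition open_cube :: "nat \<Rightarrow> (nat \<Rightarrow> real) set" where
  "open_cube n = {x. (\<forall>i<n. 0 < x i \<and> x i < 1) \<and> (\<forall>i\<ge>n. x i = 0)}"

text \<open>\<open>face_inclusion i \<epsilon>\<close> inserts \<open>\<epsilon>\<close> as the \<open>i\<close>-th coordinate; for \<open>i \<le> n\<close> and
  \<open>\<epsilon> \<in> {0, 1}\<close> it maps \<open>unit_cube n\<close> onto a codimension-1 face of \<open>unit_cube (Suc n)\<close>.\<close>

definition face_inclusion :: "nat \<Rightarrow> real \<Rightarrow> (nat \<Rightarrow> real) \<Rightarrow> (nat \<Rightarrow> real)" where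
  "face_inclusion i \<epsilon> x = (\<lambda>j. if j < i then x j else if j = i then \<epsilon> else x (j - 1))"

text \<open>The symmetries of the cube are the signed permutations of the coordinates.\<close>

definition cube_symmetry :: "nat \<Rightarrow> ((nat \<Rightarrow> real) \<Rightarrow> (nat \<Rightarrow> real)) \<Rightarrow> bool" where
  "cube_symmetry n g \<longleftrightarrow>
     (\<exists>\<sigma> F. \<sigma> permutes {..<n} \<and> F \<subseteq> {..<n} \<and>
        (\<forall>x \<in> unit_cube n. g x = (\<lambda>i. if i \<in> F then 1 - x (\<sigma> i) else x (\<sigma> i))))"

text \<open>\<open>C\<close> is the set of open cells, \<open>d e\<close> the dimension of the cell \<open>e\<close> and
  \<open>\<Phi> e\<close> its characteristic map, defined on the cube \<open>unit_cube (d e)\<close>.\<close>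

locale cw_complex_of_cubes =
  fixes X :: "'a topology"
    and C :: "'a set set"
    and d :: "'a set \<Rightarrow> nat"
    and \<Phi> :: "'a set \<Rightarrow> (nat \<Rightarrow> real) \<Rightarrow> 'a"
  assumes hausdorff: "Hausdorff_space X"
    and cells_cover: "\<Union> C = topspace X"
    and cells_disjoint: "disjoint C"
    and characteristic_map: "\<And>e. e \<in> C \<Longrightarrow> continuous_map (top_of_set (unit_cube (d e))) X (\<Phi> e)"
    and open_cell:
      "\<And>e. e \<in> C \<Longrightarrow> homeomorphic_map (top_of_set (open_cube (d e))) (subtopology X e) (\<Phi> e)"
    and closure_finite:
      "\<And>e. e \<in> C \<Longrightarrow>
         \<exists>B. finite B \<and> B \<subseteq> {b \<in> C. d b < d e} \<and> \<Phi> e ` (unit_cube (d e) - open_cube (d e)) \<subseteq> \<Union> B"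
    and weak_topology:
      "\<And>A. A \<subseteq> topspace X \<Longrightarrow>
         (\<And>e. e \<in> C \<Longrightarrow> closedin (top_of_set (unit_cube (d e))) {x \<in> unit_cube (d e). \<Phi> e x \<in> A}) \<Longrightarrow>
         closedin X A"

text \<open>Every codimension-1 face of a cube is glued onto a cell of one dimension less, the two cubes
  being identified by a cube symmetry.  Lower-dimensional faces are covered by iteration.\<close>

locale cubical_complex = cw_complex_of_cubes +
  assumes faces_attached:
    "\<And>e i \<epsilon>. e \<in> C \<Longrightarrow> i < d e \<Longrightarrow> \<epsilon> \<in> {0, 1} \<Longrightarrow>
       \<exists>b g. b \<in> C \<and> Suc (d b) = d e \<and> cube_symmetry (d b) g \<and>
         (\<forall>x \<in> unit_cube (d b). \<Phi> e (face_inclusion i \<epsilon> x) = \<Phi> b (g x))"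

definition cells_of_dim :: "'a set set \<Rightarrow> ('a set \<Rightarrow> nat) \<Rightarrow> nat \<Rightarrow> 'a set set" where
  "cells_of_dim C d k = {e \<in> C. d e = k}"

text \<open>Cubical automorphisms are closed under inverses: \<open>h\<close> permutes \<open>C\<close> because the
  cells partition the space, and cube symmetries are invertible.\<close>

definition cubical_automorphism ::
  "'a topology \<Rightarrow> 'a set set \<Rightarrow> ('a set \<Rightarrow> nat) \<Rightarrow> ('a set \<Rightarrow> (nat \<Rightarrow> real) \<Rightarrow> 'a) \<Rightarrow> ('a \<Rightarrow> 'a) \<Rightarrow> bool"
where
  "cubical_automorphism X C d \<Phi> h \<longleftrightarrow>
     homeomorphic_map X X h \<and>
     (\<forall>e \<in> C. h ` e \<in> C \<and> d (h ` e) = d e \<and>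
        (\<exists>g. cube_symmetry (d e) g \<and> (\<forall>x \<in> unit_cube (d e). h (\<Phi> e x) = \<Phi> (h ` e) (g x))))"

definition cubical_action ::
  "('g, 'm) monoid_scheme \<Rightarrow> 'a topology \<Rightarrow> 'a set set \<Rightarrow> ('a set \<Rightarrow> nat) \<Rightarrow>
     ('a set \<Rightarrow> (nat \<Rightarrow> real) \<Rightarrow> 'a) \<Rightarrow> ('g \<Rightarrow> 'a \<Rightarrow> 'a) \<Rightarrow> bool"
where
  "cubical_action G X C d \<Phi> act \<longleftrightarrow>
     group_action G (topspace X) act \<and>
     (\<forall>g \<in> carrier G. cubical_automorphism X C d \<Phi> (act g))"

text \<open>The induced action on a set \<open>K\<close> of cells; the restriction to \<open>K\<close> is required by
  \<^const>\<open>BijGroup\<close>, whose elements are extensional.\<close>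

definition cell_action :: "'a set set \<Rightarrow> ('g \<Rightarrow> 'a \<Rightarrow> 'a) \<Rightarrow> 'g \<Rightarrow> 'a set \<Rightarrow> 'a set" where
  "cell_action K act g = (\<lambda>e \<in> K. act g ` e)"

end

theory Submission
  imports Defs
begin

text \<open>A point of the space is a configuration of six labelled points on the circle, up to rotation,
  without triple coincidence. It is described by a permutation \<open>w\<close>, giving the labels in
  counterclockwise order, and by the six gaps \<open>g\<close> between consecutive points: \<open>g \<ge> 0\<close> has sum 1, and no
  two cyclically adjacent gaps vanish. These \<open>g\<close> form a convex set, and the space is obtained from 720
  copies of it by identifying \<open>(w, g)\<close> with its cyclic rotation and, when a gap is zero, with the pair in
  which the two coinciding labels are exchanged.

  Inside the set of gaps there is a book of three triangles with a common edge: the edge joins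
  \<open>(0,1/3,0,1/3,0,1/3)\<close> to \<open>(1/3,0,1/3,0,1/3,0)\<close>, and the third corners are \<open>(0,1/4,1/4,0,1/4,1/4)\<close> and its
  rotations. A piecewise linear retraction onto the book commutes with rotation and keeps vanishing
  gaps zero, so the straight-line homotopy descends to a deformation retraction of the whole space.
  After gluing, four triangles around a common third corner form a square, whose corners are
  configurations of three equidistant coincident pairs and whose edges correspond to the cyclic orders
  of six labels. The symmetric group acts by relabelling.\<close>

text \<open>The corners of the book are the barycentres of the minimal faces of the set of gaps:
  vanishing gaps are never cyclic neighbours, and the maximal sets of gaps that may vanish together
  are {1,3,5}, {2,4,6}, {1,4}, {2,5}, {3,6}. No quotient topology is formed. The space keeps its
  topology from the torus, and maps out of it are given on representatives \<open>(w, g)\<close>.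
  This costs two facts. Well-definedness: rotation and the exchange at a vanishing first gap
  generate all identifications, which a normal form shows (\<open>factors_through_place\<close>).
  Continuity: the set of gaps is not compact, but it lies in a compact simplex whose closed subsets
  have closed images in the torus (\<open>continuous_map_from_compact_pieces\<close>). The first
  fact also separates cells and bounds stabilizers from above, since every quantity read off from
  \<open>w\<close> that respects the identifications becomes a function of the configuration.
  Identifications multiply \<open>w\<close> from the right and relabelling from the left, so the
  cells of one dimension correspond to the cosets of a subgroup; these subgroups have order 24, 6
  and 8 inside a group of order 720.\<close>

declare One_nat_def [simp del]

subsection \<open>Configurations and their gaps\<close>

text \<open>The identity outside \<open>{1..6}\<close> is what \<open>permutes\<close> demands.
  Composition with \<open>rot\<close> on the right moves the starting position of a cyclic sequence
  forward by one.\<close>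

definition rot :: "nat \<Rightarrow> nat" where
  "rot k = (if k = 6 then 1 else if k \<in> {1..5} then k + 1 else k)"

lemma rot_simps [simp]:
  "rot 1 = 2" "rot 2 = 3" "rot 3 = 4" "rot 4 = 5" "rot 5 = 6" "rot 6 = 1"
  by (simp_all add: rot_def)

lemma positions_eq: "{1..6} = {1, 2, 3, 4, 5, 6::nat}"
  by auto

lemma rot_outside: "k \<notin> {1..6} \<Longrightarrow> rot k = k"
  by (auto simp: rot_def)

lemma rot_permutes: "rot permutes {1..6}"
proof (rule bij_imp_permutes)
  show "bij_betw rot {1..6} {1..6}"
    unfolding bij_betw_def positions_eq by (auto simp: inj_on_def)
qed (rule rot_outside)

lemma rot_in: "rot k \<in> {1..6} \<longleftrightarrow> k \<in> {1..6}"
  using permutes_in_image[OF rot_permutes] .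

lemma rot_pow6: "rot (rot (rot (rot (rot (rot k))))) = k"
proof (cases "k \<in> {1..6}")
  case True
  then show ?thesis unfolding positions_eq by auto
next
  case False
  then show ?thesis by (simp add: rot_outside)
qed

text \<open>Unlike \<open>gaps\<close>, this set is compact; continuity on \<open>gaps\<close> is
  deduced from it.\<close>

definition gap_simplex :: "(nat \<Rightarrow> real) set" where
  "gap_simplex = {g. (\<forall>k. k \<notin> {1..6} \<longrightarrow> g k = 0) \<and> (\<forall>k. 0 \<le> g k) \<and> sum g {1..6} = 1}"

definition gaps :: "(nat \<Rightarrow> real) set" where
  "gaps = {g \<in> gap_simplex. \<forall>k \<in> {1..6}. 0 < g k + g (rot k)}"

lemma sum_positions: "sum g {1..6::nat} = g 1 + g 2 + g 3 + g 4 + g 5 + (g 6 :: real)"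
  unfolding positions_eq by simp

lemma gapsD:
  assumes "g \<in> gaps"
  shows "0 \<le> g k" "g 1 + g 2 + g 3 + g 4 + g 5 + g 6 = 1" "k \<notin> {1..6} \<Longrightarrow> g k = 0"
    "0 < g 1 + g 2" "0 < g 2 + g 3" "0 < g 3 + g 4" "0 < g 4 + g 5" "0 < g 5 + g 6" "0 < g 6 + g 1"
  using assms unfolding gaps_def gap_simplex_def sum_positions unfolding positions_eq by auto

lemma gapsI:
  assumes "\<And>k. k \<notin> {1..6} \<Longrightarrow> g k = 0" "\<And>k. k \<in> {1..6} \<Longrightarrow> 0 \<le> g k"
    "g 1 + g 2 + g 3 + g 4 + g 5 + g 6 = 1"
    "0 < g 1 + g 2" "0 < g 2 + g 3" "0 < g 3 + g 4" "0 < g 4 + g 5" "0 < g 5 + g 6" "0 < g 6 + g 1"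
  shows "g \<in> gaps"
proof -
  have "0 \<le> g k" for k
    using assms(1,2)[of k] by (cases "k \<in> {1..6}") auto
  then show ?thesis
    using assms unfolding gaps_def gap_simplex_def sum_positions unfolding positions_eq by auto
qed

lemma gaps_rot: "g \<in> gaps \<Longrightarrow> g \<circ> rot \<in> gaps"
  by (rule gapsI) (use gapsD[of g] in \<open>simp_all add: rot_outside\<close>)

text \<open>Angles are measured in full turns, starting at position 1.\<close>

definition offset :: "(nat \<Rightarrow> real) \<Rightarrow> nat \<Rightarrow> real" where
  "offset g k = sum g {1..<k}"

lemma offset_simps [simp]:
  "offset g 1 = 0" "offset g 2 = g 1" "offset g 3 = g 1 + g 2"
  "offset g 4 = g 1 + g 2 + g 3" "offset g 5 = g 1 + g 2 + g 3 + g 4"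
  "offset g 6 = g 1 + g 2 + g 3 + g 4 + g 5"
  by (simp_all add: offset_def eval_nat_numeral One_nat_def)

text \<open>Subtracting \<open>\<theta> 6\<close> rotates the circle until label 6 lies on the base
  point; in this way a configuration up to rotation becomes a point of the torus.\<close>

definition config :: "complex \<Rightarrow> (nat \<Rightarrow> real) \<Rightarrow> nat \<Rightarrow> complex" where
  "config p \<theta> = restrict (\<lambda>i. p * cis (2 * pi * (\<theta> i - \<theta> 6))) {1..5}"

text \<open>\<open>w\<close> sends positions to labels, so its inverse finds the position of a given
  label.\<close>

definition place :: "complex \<Rightarrow> (nat \<Rightarrow> nat) \<Rightarrow> (nat \<Rightarrow> real) \<Rightarrow> nat \<Rightarrow> complex" where
  "place p w g = config p (\<lambda>i. offset g (inv' w i))"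

lemma cis_2pi_eq_iff: "cis (2 * pi * a) = cis (2 * pi * b) \<longleftrightarrow> a - b \<in> \<int>"
proof -
  have "cis (2 * pi * a) = cis (2 * pi * b) \<longleftrightarrow> (\<exists>n::int. 2 * pi * a = 2 * pi * b + 2 * pi * n)"
    by (auto simp: complex_eq_iff simp flip: sin_cos_eq_iff)
  also have "\<dots> \<longleftrightarrow> (\<exists>n::int. a - b = n)"
  proof -
    have "2 * pi * a = 2 * pi * b + 2 * pi * real_of_int n \<longleftrightarrow> a - b = n" for n
    proof -
      have "2 * pi * a = 2 * pi * b + 2 * pi * real_of_int n \<longleftrightarrow> 2 * pi * (a - b) = 2 * pi * n"
        by (simp add: algebra_simps)
      then show ?thesis by simp
    qed
    then show ?thesis by simp
  qed
  finally show ?thesis by (auto simp: Ints_def)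
qed

lemma config_upd:
  "i \<in> {1..6} \<Longrightarrow> ((config p \<theta>)(6 := p)) i = p * cis (2 * pi * (\<theta> i - \<theta> 6))"
  by (auto simp: config_def)

lemma torus_topspace: "topspace (torus n) = ({1..n-1} \<rightarrow>\<^sub>E circle)"
  by (simp add: torus_def)

context
  fixes p :: complex
  assumes p: "p \<in> circle"
begin

lemma p_nonzero: "p \<noteq> 0"
  using p by auto

lemma config_eq_iff:
  "config p \<theta> = config p \<theta>' \<longleftrightarrow> (\<forall>i \<in> {1..6}. (\<theta> i - \<theta> 6) - (\<theta>' i - \<theta>' 6) \<in> \<int>)"
proof -
  have "config p \<theta> = config p \<theta>' \<longleftrightarrow> (\<forall>i \<in> {1..5}. (\<theta> i - \<theta> 6) - (\<theta>' i - \<theta>' 6) \<in> \<int>)"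
    unfolding config_def fun_eq_iff restrict_def
    using p_nonzero by (auto simp: cis_2pi_eq_iff)
  also have "\<dots> \<longleftrightarrow> (\<forall>i \<in> {1..6}. (\<theta> i - \<theta> 6) - (\<theta>' i - \<theta>' 6) \<in> \<int>)"
  proof -
    have "{1..6} = insert 6 {1..5::nat}" by auto
    then show ?thesis by simp
  qed
  finally show ?thesis .
qed

lemma config_coincide:
  assumes "i \<in> {1..6}" "j \<in> {1..6}"
  shows "((config p \<theta>)(6 := p)) i = ((config p \<theta>)(6 := p)) j \<longleftrightarrow> \<theta> i - \<theta> j \<in> \<int>"
  unfolding config_upd[OF assms(1)] config_upd[OF assms(2)]
  using p_nonzero by (simp add: cis_2pi_eq_iff)

lemma config_in_torus: "config p \<theta> \<in> topspace (torus 6)"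
  using p by (auto simp: torus_topspace config_def norm_mult)

text \<open>A new starting position lowers every angle by \<open>g 1\<close> modulo full turns, and
  \<open>config\<close> removes a common rotation. The full turn occurs at position 1, which becomes
  the last.\<close>

lemma place_rot:
  assumes w: "w permutes {1..6}" and g: "g \<in> gaps"
  shows "place p (w \<circ> rot) (g \<circ> rot) = place p w g"
  unfolding place_def config_eq_iff
proof
  have step: "offset (g \<circ> rot) (inv' rot k) - offset g k + g 1 \<in> \<int>" if "k \<in> {1..6}" for k
  proof -
    have inv: "inv' rot 2 = 1" "inv' rot 3 = 2" "inv' rot 4 = 3" "inv' rot 5 = 4" "inv' rot 6 = 5"
      "inv' rot 1 = 6"
      by (rule inv_f_eq[OF permutes_inj[OF rot_permutes]], simp)+
    have "g 2 + g 3 + g 4 + g 5 + g 6 + g 1 = 1"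
      using gapsD(2)[OF g] by simp
    then show ?thesis
      using that unfolding positions_eq by (auto simp: inv)
  qed
  fix i :: nat assume i: "i \<in> {1..6}"
  have c: "inv' (w \<circ> rot) j = inv' rot (inv' w j)" for j
    by (simp add: o_inv_distrib[OF permutes_bij[OF w] permutes_bij[OF rot_permutes]])
  have m: "inv' w j \<in> {1..6}" if "j \<in> {1..6}" for j
    using permutes_in_image[OF permutes_inv[OF w]] that by blast
  have "(offset (g \<circ> rot) (inv' rot (inv' w i)) - offset g (inv' w i) + g 1)
      - (offset (g \<circ> rot) (inv' rot (inv' w 6)) - offset g (inv' w 6) + g 1) \<in> \<int>"
    by (intro Ints_diff step m i) auto
  then show "offset (g \<circ> rot) (inv' (w \<circ> rot) i) - offset (g \<circ> rot) (inv' (w \<circ> rot) 6) -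
         (offset g (inv' w i) - offset g (inv' w 6)) \<in> \<int>"
    by (simp add: c algebra_simps)
qed

lemma place_swap:
  assumes w: "w permutes {1..6}" and g: "g 1 = 0"
  shows "place p (w \<circ> Transposition.transpose 1 2) g = place p w g"
proof -
  have "inv' (w \<circ> Transposition.transpose 1 2) = Transposition.transpose 1 2 \<circ> inv' w"
    by (simp add: o_inv_distrib[OF permutes_bij[OF w]])
  moreover have "offset g (Transposition.transpose 1 2 k) = offset g k" for k
    using g by (auto simp: Transposition.transpose_def)
  ultimately show ?thesis by (simp add: place_def)
qed

end

section \<open>Identifications between pairs \<open>(w, g)\<close> and functions that respect
  them\<close>

lemma permutes_rot_pow:
  assumes "w permutes {1..6}"
  shows "w \<circ> rot ^^ j permutes {1..6}"
proof -
  have "rot ^^ j permutes {1..6}"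
    by (induction j) (simp_all add: permutes_id[unfolded id_def] permutes_compose[OF _ rot_permutes] id_def del: o_apply)
  then show ?thesis using assms by (rule permutes_compose)
qed

lemma rot_pow_Suc: "rot ^^ Suc j = rot ^^ j \<circ> rot"
  by (rule funpow_Suc_right)

lemma gaps_rot_pow: "g \<in> gaps \<Longrightarrow> g \<circ> rot ^^ j \<in> gaps"
proof (induction j)
  case (Suc j)
  then show ?case
    using gaps_rot[of "g \<circ> rot ^^ j"] unfolding rot_pow_Suc comp_assoc[symmetric] by blast
qed simp

lemma rot_pow_one:
  assumes "k \<in> {1..6}"
  shows "(rot ^^ (k - 1)) 1 = k" "(rot ^^ (k - 1)) 2 = rot k"
  using assms unfolding positions_eq by (auto simp: numeral_eq_Suc rot_def)

lemma permutes_transpose_rot: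
  assumes "w permutes {1..6}"
  shows "w \<circ> Transposition.transpose k (rot k) permutes {1..6}"
proof (cases "k \<in> {1..6}")
  case True
  then have "Transposition.transpose k (rot k) permutes {1..6}"
    by (intro permutes_swap_id) (simp_all only: rot_in)
  then show ?thesis using assms by (rule permutes_compose)
next
  case False
  then show ?thesis using assms by (simp add: rot_outside)
qed

text \<open>The two equations generate every coincidence of values of \<open>place\<close>, as
  \<open>factors_through_place\<close> shows; so they are the whole test for a function of
  configurations.\<close>

locale arrangement_invariant =
  fixes F :: "(nat \<Rightarrow> nat) \<Rightarrow> (nat \<Rightarrow> real) \<Rightarrow> 'b"
  assumes rot_eq: "\<And>w g. w permutes {1..6} \<Longrightarrow> g \<in> gaps \<Longrightarrow> F (w \<circ> rot) (g \<circ> rot) = F w g"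
    and swap_first_eq: "\<And>w g. w permutes {1..6} \<Longrightarrow> g \<in> gaps \<Longrightarrow> g 1 = 0 \<Longrightarrow>
      F (w \<circ> Transposition.transpose 1 2) g = F w g"
begin

lemma rot_pow_eq:
  assumes "w permutes {1..6}" "g \<in> gaps"
  shows "F (w \<circ> rot ^^ j) (g \<circ> rot ^^ j) = F w g"
proof (induction j)
  case (Suc j)
  show ?case
    unfolding rot_pow_Suc comp_assoc[symmetric]
    using rot_eq[OF permutes_rot_pow[OF assms(1), of j] gaps_rot_pow[OF assms(2), of j]] Suc
    by (rule trans)
qed simp

text \<open>Rotating position \<open>k\<close> to the front conjugates this exchange into the one
  assumed at gap 1.\<close>

lemma swap_eq:
  assumes w: "w permutes {1..6}" and g: "g \<in> gaps" and k: "k \<in> {1..6}" "g k = 0"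
  shows "F (w \<circ> Transposition.transpose k (rot k)) g = F w g"
proof -
  let ?r = "rot ^^ (k - 1)"
  note r = rot_pow_one[OF k(1)]
  have "inj ?r"
    using permutes_inj[OF permutes_rot_pow[OF permutes_id, of "k - 1"]] by simp
  then have comm: "Transposition.transpose k (rot k) \<circ> ?r = ?r \<circ> Transposition.transpose 1 2"
    using r by (auto simp: fun_eq_iff Transposition.transpose_def) (metis injD)+
  have "F (w \<circ> Transposition.transpose k (rot k)) g
      = F (w \<circ> Transposition.transpose k (rot k) \<circ> ?r) (g \<circ> ?r)"
    by (rule rot_pow_eq[symmetric]) (use w g k in \<open>auto intro: permutes_transpose_rot\<close>)
  also have "\<dots> = F (w \<circ> ?r \<circ> Transposition.transpose 1 2) (g \<circ> ?r)"
    by (simp only: comp_assoc comm)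
  also have "\<dots> = F (w \<circ> ?r) (g \<circ> ?r)"
    by (rule swap_first_eq) (use w g k r in \<open>simp_all add: permutes_rot_pow gaps_rot_pow\<close>)
  also have "\<dots> = F w g"
    by (rule rot_pow_eq[OF w g])
  finally show ?thesis .
qed

end

text \<open>Every configuration has exactly one normalized representation; of two coinciding labels the
  smaller one comes first, where 6 counts as the smallest label.\<close>

definition normalized :: "(nat \<Rightarrow> nat) \<Rightarrow> (nat \<Rightarrow> real) \<Rightarrow> bool" where
  "normalized w g \<longleftrightarrow> w 1 = 6 \<and> 0 < g 6 \<and> (\<forall>k \<in> {2..5}. g k = 0 \<longrightarrow> w k < w (k + 1))"

text \<open>Adjacent gaps never vanish together, so coinciding pairs are disjoint; once label 6
  stands at position 1, each pair can be sorted without disturbing the others.\<close>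

lemma (in arrangement_invariant) normalized_form:
  assumes w: "w permutes {1..6}" and g: "g \<in> gaps"
  obtains w' g' where "w' permutes {1..6}" "g' \<in> gaps" "normalized w' g'" "F w' g' = F w g"
proof -
  have first: "\<exists>w' g'. w' permutes {1..6} \<and> g' \<in> gaps \<and> w' 1 = 6 \<and> F w' g' = F w g"
  proof -
    define k where "k = inv' w 6"
    have k: "k \<in> {1..6}"
      unfolding k_def by (simp only: permutes_in_image[OF permutes_inv[OF w]]) simp
    have "w k = 6"
      unfolding k_def by (rule permutes_inverses(1)[OF w])
    then show ?thesis
      using rot_pow_one[OF k] w g
      by (intro exI[of _ "w \<circ> rot ^^ (k - 1)"] exI[of _ "g \<circ> rot ^^ (k - 1)"])
        (simp add: permutes_rot_pow gaps_rot_pow rot_pow_eq)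
  qed
  then obtain w1 g1 where 1: "w1 permutes {1..6}" "g1 \<in> gaps" "w1 1 = 6" "F w1 g1 = F w g"
    by blast
  have "\<exists>w' g'. w' permutes {1..6} \<and> g' \<in> gaps \<and> w' 1 = 6 \<and> 0 < g' 6 \<and> F w' g' = F w g"
  proof (cases "g1 6 = 0")
    case True
    \<comment> \<open>Label 6 coincides with the label at position 6. The exchange moves it there
      and five rotations bring it back to position 1; the last gap is then \<open>g1 5\<close>,
      positive as a neighbour of the vanishing \<open>g1 6\<close>.\<close>
    define w2 where "w2 = w1 \<circ> Transposition.transpose 6 (rot 6)"
    have w2: "w2 permutes {1..6}" "w2 6 = 6" "F w2 g1 = F w g"
      unfolding w2_def using 1 True permutes_transpose_rot[OF 1(1), of 6] swap_eq[OF 1(1,2) _ True] by simp_all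
    have "(rot ^^ 5) 1 = 6" "(rot ^^ 5) 6 = 5"
      by (simp_all add: numeral_eq_Suc rot_def)
    moreover have "0 < g1 5"
      using gapsD(8)[OF 1(2)] True by simp
    ultimately show ?thesis
      using w2 1(2)
      by (intro exI[of _ "w2 \<circ> rot ^^ 5"] exI[of _ "g1 \<circ> rot ^^ 5"])
        (simp add: permutes_rot_pow gaps_rot_pow rot_pow_eq)
  next
    case False
    then show ?thesis
      using 1 gapsD(1)[OF 1(2), of 6] by (intro exI[of _ w1] exI[of _ g1]) simp
  qed
  then obtain w2 g2 where 2: "w2 permutes {1..6}" "g2 \<in> gaps" "w2 1 = 6" "0 < g2 6" "F w2 g2 = F w g"
    by blast
  \<comment> \<open>One sweep over the positions suffices; the gaps stay fixed and only the labels
    move.\<close>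
  have "n \<le> 5 \<Longrightarrow> \<exists>w'. w' permutes {1..6} \<and> w' 1 = 6 \<and> F w' g2 = F w g
      \<and> (\<forall>k \<in> {2..n}. g2 k = 0 \<longrightarrow> w' k < w' (k + 1))" for n
  proof (induction n)
    case 0
    then show ?case using 2 by (intro exI[of _ w2]) simp
  next
    case (Suc n)
    then obtain w' where w': "w' permutes {1..6}" "w' 1 = 6" "F w' g2 = F w g"
      "\<forall>k \<in> {2..n}. g2 k = 0 \<longrightarrow> w' k < w' (k + 1)"
      by auto
    let ?m = "Suc n"
    show ?case
    proof (cases "2 \<le> ?m \<and> g2 ?m = 0 \<and> \<not> w' ?m < w' (?m + 1)")
      case False
      then show ?thesis
        using w' by (intro exI[of _ w']) (auto simp: le_Suc_eq)
    next
      case True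
      let ?w = "w' \<circ> Transposition.transpose ?m (rot ?m)"
      have m: "?m \<in> {1..6}" "rot ?m = ?m + 1" "2 \<le> ?m"
        using True Suc.prems by (auto simp: rot_def)
      have "w' (?m + 1) \<noteq> w' ?m"
        using inj_eq[OF permutes_inj[OF w'(1)]] by simp
      then have lt: "w' (?m + 1) < w' ?m"
        using True by simp
      \<comment> \<open>The gap before the exchanged pair is positive, so the exchange at
        \<open>Suc n\<close> cannot spoil the condition at \<open>n\<close>.\<close>
      have "0 < g2 n" if "2 \<le> n"
      proof -
        have "n \<in> {1..6}" "rot n = ?m"
          using that Suc.prems by (auto simp: rot_def)
        then have "0 < g2 n + g2 ?m"
          using 2(2) unfolding gaps_def by force
        then show ?thesis using True by simp
      qed
      then have "\<forall>k \<in> {2..?m}. g2 k = 0 \<longrightarrow> ?w k < ?w (k + 1)"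
        using w'(4) lt m by (auto simp: le_Suc_eq Transposition.transpose_def)
      moreover have "?w 1 = 6"
        using w'(2) m by (auto simp: Transposition.transpose_def)
      moreover have "F ?w g2 = F w g"
        using swap_eq[OF w'(1) 2(2) m(1)] True w'(3) by simp
      ultimately show ?thesis
        using permutes_transpose_rot[OF w'(1)] by blast
    qed
  qed
  from this[of 5] obtain w' where "w' permutes {1..6}" "w' 1 = 6" "F w' g2 = F w g"
    "\<forall>k \<in> {2..5}. g2 k = 0 \<longrightarrow> w' k < w' (k + 1)"
    by auto
  then show ?thesis
    using that[of w' g2] 2 by (simp add: normalized_def)
qed

lemma offset_Suc: "1 \<le> k \<Longrightarrow> offset g (k + 1) = offset g k + g k"
  by (simp add: offset_def sum.atLeastLessThan_Suc flip: Suc_eq_plus1)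

text \<open>Reduction modulo 6 makes label 6 the smallest. Consecutive positions are compared by the
  normalization; positions further apart are separated by two adjacent gaps, whose sum is
  positive.\<close>

lemma normalized_lex:
  assumes w: "w permutes {1..6}" and g: "g \<in> gaps" and n: "normalized w g"
    and kl: "1 \<le> k" "k < l" "l \<le> 6"
  shows "offset g k < offset g l \<or> offset g k = offset g l \<and> w k mod 6 < w l mod 6"
proof -
  have inj: "w a = w b \<longleftrightarrow> a = b" for a b
    using inj_eq[OF permutes_inj[OF w]] .
  have in6: "w a \<in> {1..6}" if "a \<in> {1..6}" for a
    using permutes_in_image[OF w] that by blast
  have mod: "w a mod 6 = w a" "w a \<ge> 1" if "a \<in> {2..6}" for a
  proof -
    have "w a \<noteq> w 1" using that inj by auto
    then have "w a \<noteq> 6" using n by (simp add: normalized_def)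
    then show "w a mod 6 = w a" "w a \<ge> 1" using in6[of a] that by auto
  qed
  have consecutive: "offset g k = offset g (k + 1) \<longrightarrow> w k mod 6 < w (k + 1) mod 6"
    if "k \<in> {1..5}" for k
  proof
    assume "offset g k = offset g (k + 1)"
    then have gk: "g k = 0"
      using that offset_Suc[of k g] by simp
    show "w k mod 6 < w (k + 1) mod 6"
    proof (cases "k = 1")
      case True
      then show ?thesis using n mod[of 2] by (simp add: normalized_def numeral_2_eq_2)
    next
      case False
      then have "w k < w (k + 1)"
        using n gk that by (auto simp: normalized_def)
      then show ?thesis using mod[of k] mod[of "k + 1"] False that by auto
    qed
  qed
  show ?thesis
  proof (cases "l = k + 1")
    case True
    then show ?thesis
      using consecutive kl offset_Suc[of k g] gapsD(1)[OF g, of k] by auto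
  next
    case False
    have k: "k \<in> {1..6}" "rot k = k + 1"
      using kl False by (auto simp: rot_def)
    have "offset g k < offset g k + (g k + g (k + 1))"
      using g k unfolding gaps_def by force
    also have "\<dots> = offset g (k + 1 + 1)"
      using offset_Suc[of "k + 1" g] offset_Suc[of k g] kl by simp
    also have "\<dots> \<le> offset g l"
      unfolding offset_def by (rule sum_mono2) (use kl False gapsD(1)[OF g] in auto)
    finally show ?thesis by simp
  qed
qed

lemma strict_mono_permutation_eq:
  assumes "\<tau> permutes {1..6::nat}" "\<And>k l. 1 \<le> k \<Longrightarrow> k < l \<Longrightarrow> l \<le> 6 \<Longrightarrow> \<tau> k < \<tau> l"
  shows "\<tau> = id"
proof
  fix k
  have "\<tau> 1 \<in> {1..6}" "\<tau> 6 \<in> {1..6}"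
    using permutes_in_image[OF assms(1)] by simp_all
  moreover have "\<tau> 1 < \<tau> 2" "\<tau> 2 < \<tau> 3" "\<tau> 3 < \<tau> 4" "\<tau> 4 < \<tau> 5" "\<tau> 5 < \<tau> 6"
    by (auto intro: assms(2))
  ultimately have "\<tau> k = k" if "k \<in> {1, 2, 3, 4, 5, 6}"
    using that by (elim insertE emptyE) simp_all
  then show "\<tau> k = id k"
    using permutes_not_in[OF assms(1), of k] unfolding positions_eq by (cases "k \<in> {1, 2, 3, 4, 5, 6}") simp_all
qed

lemma offset_range:
  assumes "g \<in> gaps" "k \<in> {1..6}"
  shows "0 \<le> offset g k" "offset g k \<le> 1 - g 6"
proof -
  show "0 \<le> offset g k"
    using gapsD(1)[OF assms(1)] by (simp add: offset_def sum_nonneg)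
  have "offset g k \<le> offset g 6"
    unfolding offset_def by (rule sum_mono2) (use assms gapsD(1)[OF assms(1)] in auto)
  then show "offset g k \<le> 1 - g 6"
    using gapsD(2)[OF assms(1)] by simp
qed

lemma offset_inject:
  assumes "g \<in> gaps" "g' \<in> gaps" "\<And>k. k \<in> {1..6} \<Longrightarrow> offset g k = offset g' k"
  shows "g = g'"
proof
  fix k
  show "g k = g' k"
  proof (cases "k \<in> {1..6}")
    case True
    have "k \<in> {1, 2, 3, 4, 5, 6}"
      using True unfolding positions_eq .
    moreover have "g 1 = g' 1" "g 2 = g' 2" "g 3 = g' 3" "g 4 = g' 4" "g 5 = g' 5"
      using assms(3)[of 2] assms(3)[of 3] assms(3)[of 4] assms(3)[of 5] assms(3)[of 6] by simp_all
    moreover have "g 6 = g' 6"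
      using calculation gapsD(2)[OF assms(1)] gapsD(2)[OF assms(2)] by simp
    ultimately show ?thesis by (elim insertE emptyE) simp_all
  next
    case False
    then show ?thesis using gapsD(3)[OF assms(1)] gapsD(3)[OF assms(2)] by simp
  qed
qed

text \<open>Label 6 has angle 0 and the positive last gap keeps all angles below a full turn, so the
  configuration determines them exactly and not just modulo 1. The order of the labels is then the
  lexicographic one of \<open>normalized_lex\<close>.\<close>

lemma normalized_unique:
  assumes p: "p \<in> circle"
    and w: "w permutes {1..6}" "g \<in> gaps" "normalized w g"
    and w': "w' permutes {1..6}" "g' \<in> gaps" "normalized w' g'"
    and eq: "place p w g = place p w' g'"
  shows "w = w'" "g = g'"
proof -
  have six: "inv' w 6 = 1" "inv' w' 6 = 1"
    using w(3) w'(3) unfolding permutes_inv_eq[OF w(1)] permutes_inv_eq[OF w'(1)] normalized_def by blast+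
  have inv_in: "inv' w i \<in> {1..6}" "inv' w' i \<in> {1..6}" if "i \<in> {1..6}" for i
    using permutes_in_image[OF permutes_inv[OF w(1)]] permutes_in_image[OF permutes_inv[OF w'(1)]] that
    by blast+
  have lifts: "offset g (inv' w i) = offset g' (inv' w' i)" if i: "i \<in> {1..6}" for i
  proof -
    have "offset g (inv' w i) - offset g' (inv' w' i) \<in> \<int>"
      using bspec[OF eq[unfolded place_def config_eq_iff[OF p]] i] by (simp only: six offset_simps diff_zero)
    moreover have "\<bar>offset g (inv' w i) - offset g' (inv' w' i)\<bar> < 1"
      using offset_range[OF w(2) inv_in(1)[OF i]] offset_range[OF w'(2) inv_in(2)[OF i]] w(3) w'(3)
      by (auto simp: normalized_def)
    ultimately show ?thesis
      using Ints_nonzero_abs_less1[of "offset g (inv' w i) - offset g' (inv' w' i)"] by simp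
  qed
  \<comment> \<open>Both permutations list the labels in the same lexicographic order, so the
    permutation comparing them is increasing.\<close>
  have "inv' w' \<circ> w = id"
  proof (rule strict_mono_permutation_eq)
    show "inv' w' \<circ> w permutes {1..6}"
      by (intro permutes_compose permutes_inv w w')
    fix k l :: nat assume kl: "1 \<le> k" "k < l" "l \<le> 6"
    have wk: "w k \<in> {1..6}" "w l \<in> {1..6}"
      using permutes_in_image[OF w(1)] kl by auto
    have lex: "offset g k < offset g l \<or> offset g k = offset g l \<and> w k mod 6 < w l mod 6"
      by (rule normalized_lex[OF w kl])
    have off: "offset g k = offset g' (inv' w' (w k))" "offset g l = offset g' (inv' w' (w l))"
      using lifts[OF wk(1)] lifts[OF wk(2)] unfolding permutes_inverses(2)[OF w(1)] by blast+
    show "(inv' w' \<circ> w) k < (inv' w' \<circ> w) l"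
    proof (rule ccontr)
      assume "\<not> ?thesis"
      moreover have "(inv' w' \<circ> w) k \<noteq> (inv' w' \<circ> w) l"
        unfolding comp_apply inj_eq[OF permutes_inj[OF permutes_inv[OF w'(1)]]] inj_eq[OF permutes_inj[OF w(1)]]
        using kl by linarith
      ultimately have less: "inv' w' (w l) < inv' w' (w k)" unfolding comp_apply by linarith
      have "offset g' (inv' w' (w l)) < offset g' (inv' w' (w k)) \<or>
          offset g' (inv' w' (w l)) = offset g' (inv' w' (w k)) \<and> w l mod 6 < w k mod 6"
        using normalized_lex[OF w' _ less] inv_in(2)[OF wk(1)] inv_in(2)[OF wk(2)]
        unfolding permutes_inverses(1)[OF w'(1)] atLeastAtMost_iff by blast
      then show False using lex off by linarith
    qed
  qed
  then have "w' (inv' w' (w k)) = w' k" for k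
    by (metis comp_apply id_apply)
  then show ww: "w = w'"
    unfolding permutes_inverses(1)[OF w'(1)] by (rule ext)
  show "g = g'"
  proof (rule offset_inject[OF w(2) w'(2)])
    fix k :: nat assume "k \<in> {1..6}"
    then have "w k \<in> {1..6}" using permutes_in_image[OF w(1)] by blast
    from lifts[OF this] show "offset g k = offset g' k"
      unfolding ww[symmetric] permutes_inverses(2)[OF w(1)] .
  qed
qed


text \<open>Pairing \<open>F\<close> with \<open>place p\<close> gives one invariant function, so a
  single normalization preserves both values, and uniqueness of the normal form applies.\<close>

theorem (in arrangement_invariant) factors_through_place:
  assumes p: "p \<in> circle"
    and w: "w permutes {1..6}" "g \<in> gaps" and w': "w' permutes {1..6}" "g' \<in> gaps"
    and eq: "place p w g = place p w' g'"
  shows "F w g = F w' g'"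
proof -
  interpret pair: arrangement_invariant "\<lambda>w g. (F w g, place p w g)"
    by unfold_locales (simp_all add: rot_eq swap_first_eq place_rot[OF p] place_swap[OF p])
  obtain w1 g1 where 1: "w1 permutes {1..6}" "g1 \<in> gaps" "normalized w1 g1"
    "F w1 g1 = F w g" "place p w1 g1 = place p w g"
    by (rule pair.normalized_form[OF w]) (auto intro: that)
  obtain w2 g2 where 2: "w2 permutes {1..6}" "g2 \<in> gaps" "normalized w2 g2"
    "F w2 g2 = F w' g'" "place p w2 g2 = place p w' g'"
    by (rule pair.normalized_form[OF w']) (auto intro: that)
  have "w1 = w2" "g1 = g2"
    using normalized_unique[OF p 1(1-3) 2(1-3)] 1(5) 2(5) eq by simp_all
  then show ?thesis using 1(4) 2(4) by simp
qed

text \<open>Made for a set \<open>S\<close> that is not closed, so that its preimages in the pieces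
  are not compact. The preimage of a closed set in a piece is the trace of a closed
  \<open>D i\<close> in the compact \<open>K i\<close>; the image of \<open>D i\<close> is compact,
  hence closed in \<open>T\<close>, and intersecting with \<open>S\<close> afterwards loses
  nothing.\<close>

lemma continuous_map_from_compact_pieces:
  assumes I: "finite I"
    and K: "\<And>i. i \<in> I \<Longrightarrow> compact_space (K i)"
    and P: "\<And>i. i \<in> I \<Longrightarrow> continuous_map (K i) T (P i)"
    and T: "Hausdorff_space T" and S: "S \<subseteq> topspace T"
    and cover: "S \<subseteq> (\<Union>i \<in> I. P i ` topspace (K i))"
    and f: "\<And>i. i \<in> I \<Longrightarrow> continuous_map (subtopology (K i) {z \<in> topspace (K i). P i z \<in> S}) Y (f \<circ> P i)"
  shows "continuous_map (subtopology T S) Y f"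
  unfolding continuous_map_closedin
proof (intro conjI allI impI)
  show "f \<in> topspace (subtopology T S) \<rightarrow> topspace Y"
  proof
    fix x assume "x \<in> topspace (subtopology T S)"
    then have "x \<in> S" using S by auto
    then obtain i z where "i \<in> I" "z \<in> topspace (K i)" "x = P i z"
      using cover by auto
    with f[OF this(1)] \<open>x \<in> S\<close> show "f x \<in> topspace Y"
      by (auto simp: continuous_map_def Pi_iff)
  qed
next
  fix V assume V: "closedin Y V"
  have "\<forall>i \<in> I. \<exists>D. closedin (K i) D \<and> {z \<in> topspace (K i). P i z \<in> S \<and> f (P i z) \<in> V} = D \<inter> {z \<in> topspace (K i). P i z \<in> S}"
  proof
    fix i assume "i \<in> I"
    have "closedin (subtopology (K i) {z \<in> topspace (K i). P i z \<in> S})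
      {z \<in> topspace (subtopology (K i) {z \<in> topspace (K i). P i z \<in> S}). (f \<circ> P i) z \<in> V}"
      using f[OF \<open>i \<in> I\<close>] V by (rule closedin_continuous_map_preimage)
    then obtain D where "closedin (K i) D"
      "{z \<in> topspace (subtopology (K i) {z \<in> topspace (K i). P i z \<in> S}). (f \<circ> P i) z \<in> V}
        = D \<inter> {z \<in> topspace (K i). P i z \<in> S}"
      unfolding closedin_subtopology by blast
    moreover have "{z \<in> topspace (subtopology (K i) {z \<in> topspace (K i). P i z \<in> S}). (f \<circ> P i) z \<in> V}
        = {z \<in> topspace (K i). P i z \<in> S \<and> f (P i z) \<in> V}"
      by (simp only: topspace_subtopology comp_apply) blast
    ultimately show "\<exists>D. closedin (K i) D \<and>
        {z \<in> topspace (K i). P i z \<in> S \<and> f (P i z) \<in> V} = D \<inter> {z \<in> topspace (K i). P i z \<in> S}"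
      by (intro exI[of _ D]) (simp only: simp_thms)
  qed
  then obtain D where "\<forall>i \<in> I. closedin (K i) (D i) \<and>
      {z \<in> topspace (K i). P i z \<in> S \<and> f (P i z) \<in> V} = D i \<inter> {z \<in> topspace (K i). P i z \<in> S}"
    by (rule bchoice[THEN exE])
  then have D: "\<And>i. i \<in> I \<Longrightarrow> closedin (K i) (D i)"
    and DV: "\<And>i. i \<in> I \<Longrightarrow> {z \<in> topspace (K i). P i z \<in> S \<and> f (P i z) \<in> V} = D i \<inter> {z \<in> topspace (K i). P i z \<in> S}"
    by simp_all
  have "closedin T (P i ` D i)" if "i \<in> I" for i
    using compactin_imp_closedin[OF T image_compactin[OF closedin_compact_space[OF K D] P]] that by blast
  then have "closedin T (\<Union>i \<in> I. P i ` D i)"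
    using I by (intro closedin_Union) auto
  moreover have "{x \<in> topspace (subtopology T S). f x \<in> V} = (\<Union>i \<in> I. P i ` D i) \<inter> S"
  proof (intro equalityI subsetI)
    fix x assume x: "x \<in> {x \<in> topspace (subtopology T S). f x \<in> V}"
    then obtain i z where iz: "i \<in> I" "z \<in> topspace (K i)" "x = P i z"
      using cover by auto
    then have "z \<in> {z \<in> topspace (K i). P i z \<in> S \<and> f (P i z) \<in> V}" using x by auto
    then have "z \<in> D i" unfolding DV[OF iz(1)] by simp
    then show "x \<in> (\<Union>i \<in> I. P i ` D i) \<inter> S" using iz x by auto
  next
    fix x assume "x \<in> (\<Union>i \<in> I. P i ` D i) \<inter> S"
    then obtain i z where iz: "i \<in> I" "z \<in> D i" "x = P i z" "x \<in> S" by auto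
    have "z \<in> topspace (K i)" using closedin_subset[OF D[OF iz(1)]] iz(2) by auto
    then have "z \<in> D i \<inter> {z \<in> topspace (K i). P i z \<in> S}" using iz by auto
    then have "f x \<in> V" unfolding DV[OF iz(1), symmetric] using iz by simp
    then show "x \<in> {x \<in> topspace (subtopology T S). f x \<in> V}" using iz S by auto
  qed
  ultimately show "closedin (subtopology T S) {x \<in> topspace (subtopology T S). f x \<in> V}"
    unfolding closedin_subtopology by blast
qed

section \<open>Compactness of the simplex and its preimage of the complement\<close>

lemma continuous_on_coordinate: "continuous_on S (\<lambda>x :: nat \<Rightarrow> real. x i)"
  by (rule continuous_on_subset[OF continuous_on_product_coordinates]) simp

lemma compact_unit_box: "compact (PiE UNIV (\<lambda>_::nat. {0..1::real}))"
proof -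
  have "compactin (product_topology (\<lambda>_::nat. euclideanreal) UNIV) (PiE UNIV (\<lambda>_. {0..1}))"
    by (simp add: compactin_PiE)
  then show ?thesis
    by (simp add: euclidean_product_topology)
qed

lemma compact_gap_simplex: "compact gap_simplex"
proof -
  have "closed gap_simplex"
    unfolding gap_simplex_def
    by (intro closed_Collect_conj closed_Collect_all closed_Collect_imp closed_Collect_eq closed_Collect_le
        open_Collect_const continuous_intros continuous_on_product_coordinates)
  moreover have "gap_simplex \<subseteq> PiE UNIV (\<lambda>_. {0..1})"
  proof
    fix g assume g: "g \<in> gap_simplex"
    have "g k \<le> 1" for k
    proof (cases "k \<in> {1..6}")
      case True
      have "g k \<le> sum g {1..6}"
        using True g by (intro member_le_sum) (auto simp: gap_simplex_def)
      then show ?thesis using g by (simp add: gap_simplex_def)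
    qed (use g in \<open>simp add: gap_simplex_def\<close>)
    then show "g \<in> PiE UNIV (\<lambda>_. {0..1})" using g by (auto simp: gap_simplex_def)
  qed
  ultimately show ?thesis
    using compact_unit_box by (metis closed_Int_compact inf.absorb_iff1)
qed

lemma Hausdorff_torus: "Hausdorff_space (torus n)"
  unfolding torus_def Hausdorff_space_product_topology by (simp add: Hausdorff_space_subtopology)

text \<open>Trading increasing triples for distinct ones makes the condition symmetric, as required
  for use with arbitrary permutations.\<close>

lemma Q_space_topspace:
  "topspace (Q_space p 6) = {x \<in> topspace (torus 6).
    \<forall>i \<in> {1..6}. \<forall>j \<in> {1..6}. \<forall>k \<in> {1..6}. i \<noteq> j \<longrightarrow> j \<noteq> k \<longrightarrow> i \<noteq> k \<longrightarrow>
      \<not> ((x(6 := p)) i = (x(6 := p)) j \<and> (x(6 := p)) j = (x(6 := p)) k)}" (is "_ = ?Q")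
proof -
  have "x \<in> triple_arrangement p 6 \<longleftrightarrow> (\<exists>i \<in> {1..6}. \<exists>j \<in> {1..6}. \<exists>k \<in> {1..6}. i \<noteq> j \<and> j \<noteq> k \<and> i \<noteq> k \<and>
      (x(6 := p)) i = (x(6 := p)) j \<and> (x(6 := p)) j = (x(6 := p)) k)" (is "?L \<longleftrightarrow> ?R")
    if "x \<in> topspace (torus 6)" for x
  proof
    assume ?L
    then obtain i j k where "1 \<le> i" "i < j" "j < k" "k \<le> 6"
      "(x(6 := p)) i = (x(6 := p)) j" "(x(6 := p)) j = (x(6 := p)) k"
      unfolding triple_arrangement_def triple_diagonal_def by blast
    moreover from this have "i \<in> {1..6}" "j \<in> {1..6}" "k \<in> {1..6}" "i \<noteq> j" "j \<noteq> k" "i \<noteq> k"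
      by auto
    ultimately show ?R by blast
  next
    define y where "y = x(6 := p)"
    assume ?R
    then obtain i j k where ijk: "i \<in> {1..6}" "j \<in> {1..6}" "k \<in> {1..6}" "i \<noteq> j" "j \<noteq> k" "i \<noteq> k"
      "y i = y j" "y j = y k"
      unfolding y_def by blast
    have "\<exists>i' j' k'. 1 \<le> i' \<and> i' < j' \<and> j' < k' \<and> k' \<le> 6 \<and> y i' = y j' \<and> y j' = y k'"
    proof -
      consider "i < j" "j < k" | "i < k" "k < j" | "j < i" "i < k" | "j < k" "k < i" | "k < i" "i < j" | "k < j" "j < i"
        using ijk(4-6) by linarith
      moreover have "1 \<le> i" "1 \<le> j" "1 \<le> k" "i \<le> 6" "j \<le> 6" "k \<le> 6"
        using ijk(1-3) by simp_all
      moreover have "y i = y k" "y j = y i" "y k = y j" "y k = y i"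
        using ijk(7,8) by simp_all
      ultimately show ?thesis
        using ijk(7,8) by cases blast+
    qed
    then obtain i' j' k' where "1 \<le> i'" "i' < j'" "j' < k'" "k' \<le> 6" "y i' = y j'" "y j' = y k'"
      by blast
    moreover then have "x \<in> triple_diagonal p 6 i' j' k'"
      using that unfolding triple_diagonal_def y_def by blast
    ultimately show ?L
      unfolding triple_arrangement_def by blast
  qed
  then show ?thesis
    unfolding Q_space_def topspace_subtopology by blast
qed

lemma offset_rot_Ints:
  assumes "g \<in> gap_simplex" "k \<in> {1..6}"
  shows "offset g (rot k) - (offset g k + g k) \<in> \<int>"
proof (cases "k = 6")
  case True
  have "offset g 6 + g 6 = 1"
    using assms(1) unfolding gap_simplex_def sum_positions by simp
  then show ?thesis using True by simp
next
  case False
  then have "rot k = k + 1" "1 \<le> k" using assms(2) by (auto simp: rot_def)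
  then show ?thesis using offset_Suc[of k g] by simp
qed

context
  fixes p :: complex
  assumes p: "p \<in> circle"
begin

lemma continuous_map_config:
  assumes "\<And>i. i \<in> {1..6} \<Longrightarrow> continuous_on S (\<lambda>x. \<theta> x i)"
  shows "continuous_map (top_of_set S) (torus 6) (\<lambda>x. config p (\<theta> x))"
  unfolding torus_def continuous_map_componentwise
proof (intro conjI ballI)
  show "(\<lambda>x. config p (\<theta> x)) ` topspace (top_of_set S) \<subseteq> extensional {1..6-1}"
    by (auto simp: config_def)
  fix k :: nat assume k: "k \<in> {1..6-1}"
  have "continuous_on S (\<lambda>x. p * cis (2 * pi * (\<theta> x k - \<theta> x 6)))"
    using k by (intro continuous_intros continuous_on_cis assms) auto
  then show "continuous_map (top_of_set S) (top_of_set circle) (\<lambda>x. config p (\<theta> x) k)"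
    using k p by (auto simp: config_def norm_mult)
qed

lemma place_coincide:
  assumes w: "w permutes {1..6}" and "a \<in> {1..6}" "b \<in> {1..6}"
  shows "((place p w g)(6 := p)) (w a) = ((place p w g)(6 := p)) (w b) \<longleftrightarrow> offset g a - offset g b \<in> \<int>"
proof -
  have "w a \<in> {1..6}" "w b \<in> {1..6}"
    using permutes_in_image[OF w] assms by blast+
  from config_coincide[OF p this, of "\<lambda>i. offset g (inv' w i)"] show ?thesis
    unfolding place_def permutes_inverses(2)[OF w] .
qed

lemma place_in_torus: "place p w g \<in> topspace (torus 6)"
  unfolding place_def by (rule config_in_torus[OF p])

lemma unit_interval_Ints: "x \<in> \<int> \<Longrightarrow> 0 \<le> x \<Longrightarrow> x \<le> 1 \<Longrightarrow> x = 0 \<or> x = (1::real)"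
  by (auto elim!: Ints_cases)

text \<open>A triple coincidence on the circle forces two cyclically adjacent gaps to vanish, and
  two such gaps make three consecutive positions coincide.\<close>

lemma place_mem_Q_iff:
  assumes w: "w permutes {1..6}" and g: "g \<in> gap_simplex"
  shows "place p w g \<in> topspace (Q_space p 6) \<longleftrightarrow> g \<in> gaps"
proof
  assume Q: "place p w g \<in> topspace (Q_space p 6)"
  show "g \<in> gaps"
  proof (rule ccontr)
    assume "g \<notin> gaps"
    then obtain k where k: "k \<in> {1..6}" "\<not> 0 < g k + g (rot k)"
      using g by (auto simp: gaps_def)
    have nonneg: "0 \<le> g a" for a using g by (simp add: gap_simplex_def)
    have zero: "g k = 0" "g (rot k) = 0"
      using k nonneg[of k] nonneg[of "rot k"] by linarith+
    let ?l = "rot k" and ?m = "rot (rot k)"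
    have in6: "?l \<in> {1..6}" "?m \<in> {1..6}" using k by (simp_all only: rot_in)
    have distinct: "k \<noteq> ?l" "?l \<noteq> ?m" "k \<noteq> ?m"
      using k(1) unfolding positions_eq by auto
    have "offset g ?l - offset g k \<in> \<int>" "offset g ?m - offset g ?l \<in> \<int>"
      using offset_rot_Ints[OF g k(1)] offset_rot_Ints[OF g in6(1)] zero by simp_all
    then have "((place p w g)(6 := p)) (w ?l) = ((place p w g)(6 := p)) (w k)"
      "((place p w g)(6 := p)) (w ?m) = ((place p w g)(6 := p)) (w ?l)"
      using place_coincide[OF w] k(1) in6 by blast+
    moreover have "w k \<in> {1..6}" "w ?l \<in> {1..6}" "w ?m \<in> {1..6}"
      using permutes_in_image[OF w] k in6 by blast+
    moreover have "w ?m \<noteq> w ?l" "w ?l \<noteq> w k" "w ?m \<noteq> w k"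
      using inj_eq[OF permutes_inj[OF w]] distinct by metis+
    ultimately show False
      using Q unfolding Q_space_topspace by blast
  qed
next
  assume gaps: "g \<in> gaps"
  let ?y = "(place p w g)(6 := p)"
  have no_triple: False
    if abc: "a \<in> {1..6}" "c \<in> {1..6}" "a < b" "b < c"
      and eq: "offset g a - offset g b \<in> \<int>" "offset g b - offset g c \<in> \<int>" for a b c
  proof -
    have b: "b \<in> {1..6}" using abc by auto
    let ?x = "offset g b - offset g a" and ?z = "offset g c - offset g b"
    have mono: "offset g k \<le> offset g l" if "k \<le> l" for k l
      unfolding offset_def by (rule sum_mono2) (use that gapsD(1)[OF gaps] in auto)
    have lower: "offset g (k + 1) = offset g k + g k" if "1 \<le> k" for k
      using that by (rule offset_Suc)
    have upper: "offset g 6 + g 6 = 1"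
      using gapsD(2)[OF gaps] by simp
    have pos: "0 < g k + g (k + 1)" if "1 \<le> k" "k \<le> 5" for k
      using gaps that by (force simp: gaps_def rot_def dest!: bspec[of _ _ k])
    have x: "?x = 0 \<or> ?x = 1"
    proof (rule unit_interval_Ints)
      show "?x \<in> \<int>" using Ints_minus[OF eq(1)] by simp
    qed (use mono[of a b] mono[of b 6] offset_range[OF gaps abc(1)] offset_range[OF gaps b]
        gapsD(1)[OF gaps, of 6] abc in auto)
    have z: "?z = 0 \<or> ?z = 1"
    proof (rule unit_interval_Ints)
      show "?z \<in> \<int>" using Ints_minus[OF eq(2)] by simp
    qed (use mono[of b c] offset_range[OF gaps abc(2)] offset_range[OF gaps b]
        gapsD(1)[OF gaps, of 6] abc in auto)
    have ga: "g a \<le> ?x"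
      using lower[of a] mono[of "a + 1" b] abc by auto
    have gb: "g b \<le> ?z"
      using lower[of b] mono[of "b + 1" c] abc by auto
    have gb': "g (b - 1) \<le> ?x"
      using lower[of "b - 1"] mono[of a "b - 1"] abc by auto
    have gc': "g (c - 1) \<le> ?z"
      using lower[of "c - 1"] mono[of b "c - 1"] abc by auto
    \<comment> \<open>Where the full turn falls decides which adjacent gaps vanish:
      \<open>b - 1\<close> and \<open>b\<close>, or 6 and 1, or 5 and 6. Two full turns do not
      fit.\<close>
    consider "?x = 0" "?z = 0" | "?x = 0" "?z = 1" | "?x = 1" "?z = 0" | "?x = 1" "?z = 1"
      using x z by blast
    then show False
    proof cases
      case 1
      have "1 \<le> b - 1" "b - 1 \<le> 5" "b - 1 + 1 = b" using abc by auto
      then have "0 < g (b - 1) + g b" using pos[of "b - 1"] by simp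
      then show ?thesis using gb gb' 1 by linarith
    next
      case 2
      then have "offset g a = 0" "g 6 = 0"
        using offset_range[OF gaps abc(1)] offset_range[OF gaps abc(2)] gapsD(1)[OF gaps, of 6] by linarith+
      moreover have "g a \<le> 0" using ga 2 by simp
      moreover have "g 1 \<le> offset g 2" by simp
      ultimately show ?thesis
        using gapsD(9)[OF gaps] mono[of 2 a] gapsD(1)[OF gaps, of 1] abc(1) 
        by (cases "a = 1") auto
    next
      case 3
      then have "offset g c = 1" "g 6 = 0"
        using offset_range[OF gaps abc(1)] offset_range[OF gaps abc(2)] gapsD(1)[OF gaps, of 6] by linarith+
      moreover have "g (c - 1) \<le> 0" using gc' 3 by simp
      moreover have "g 5 \<le> 1 - offset g 5"
        using upper lower[of 5] gapsD(1)[OF gaps, of 6] by simp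
      ultimately show ?thesis
        using gapsD(8)[OF gaps] mono[of c 5] gapsD(1)[OF gaps, of 5] abc(2)
        by (cases "c = 6") auto
    next
      case 4
      then show ?thesis
        using offset_range[OF gaps abc(1)] offset_range[OF gaps abc(2)] gapsD(1)[OF gaps, of 6] by linarith
    qed
  qed
  have no_three: "False" if ijk: "i \<in> {1..6}" "j \<in> {1..6}" "k \<in> {1..6}" "i \<noteq> j" "j \<noteq> k" "i \<noteq> k"
    "?y i = ?y j" "?y j = ?y k" for i j k
  proof -
    define a b c where "a = inv' w i" and "b = inv' w j" and "c = inv' w k"
    have abc: "a \<in> {1..6}" "b \<in> {1..6}" "c \<in> {1..6}"
      unfolding a_def b_def c_def using permutes_in_image[OF permutes_inv[OF w]] ijk by blast+
    have wabc: "w a = i" "w b = j" "w c = k"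
      unfolding a_def b_def c_def permutes_inverses(1)[OF w] by simp_all
    have ne: "a \<noteq> b" "b \<noteq> c" "a \<noteq> c" using wabc ijk by auto
    have I: "offset g x - offset g y \<in> \<int>" if "x \<in> {a, b, c}" "y \<in> {a, b, c}" for x y
    proof -
      have "x \<in> {1..6}" "y \<in> {1..6}" using that abc by auto
      moreover have "?y (w x) = ?y (w y)" using that ijk wabc by auto
      ultimately show ?thesis using place_coincide[OF w] by blast
    qed
    have "\<not> (x < y \<and> y < z)" if "x \<in> {a, b, c}" "y \<in> {a, b, c}" "z \<in> {a, b, c}" for x y z
      using no_triple[of x z y] I[OF that(1,2)] I[OF that(2,3)] that abc by blast
    note order = this
    consider "a < b" "b < c" | "a < c" "c < b" | "b < a" "a < c" | "b < c" "c < a" | "c < a" "a < b" | "c < b" "b < a"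
      using ne by linarith
    then show False
      by cases (use order in blast)+
  qed
  then show "place p w g \<in> topspace (Q_space p 6)"
    unfolding Q_space_topspace mem_Collect_eq using place_in_torus[of w g] by blast
qed

end

lemma sorting_permutation:
  fixes \<theta> :: "nat \<Rightarrow> real"
  obtains w where "w permutes {1..6}" "\<And>k l. 1 \<le> k \<Longrightarrow> k \<le> l \<Longrightarrow> l \<le> 6 \<Longrightarrow> \<theta> (w k) \<le> \<theta> (w l)"
proof -
  define xs where "xs = sort_key \<theta> [1..<7]"
  define w where "w k = (if k \<in> {1..6} then xs ! (k - 1) else k)" for k
  have len: "length xs = 6" and dist: "distinct xs" and set: "set xs = {1..6}"
    by (auto simp: xs_def)
  have sorted: "sorted (map \<theta> xs)"
    by (simp add: xs_def)
  have "w permutes {1..6}"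
  proof (rule bij_imp_permutes)
    have "bij_betw (\<lambda>k. xs ! (k - 1)) {1..6} {1..6}"
    proof (rule bij_betw_trans[where g = "nth xs" and B = "{..<6}", unfolded comp_def])
      show "bij_betw (\<lambda>k. k - 1) {1..6} {..<6::nat}"
        by (rule bij_betwI[where g = "\<lambda>k. k + 1"]) auto
      show "bij_betw ((!) xs) {..<6} {1..6}"
        by (rule bij_betw_nth) (use dist len set in auto)
    qed
    then show "bij_betw w {1..6} {1..6}"
      by (rule bij_betw_cong[THEN iffD1, rotated]) (simp add: w_def)
  qed (auto simp: w_def)
  moreover have "\<theta> (w k) \<le> \<theta> (w l)" if "1 \<le> k" "k \<le> l" "l \<le> 6" for k l
    using sorted_nth_mono[OF sorted, of "k - 1" "l - 1"] that len by (simp add: w_def)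
  ultimately show ?thesis using that by blast
qed

text \<open>Sorting the angles gives \<open>w\<close>, and their successive differences give
  \<open>g\<close>, the last one closing up to a full turn. That no two adjacent gaps vanish is then
  read off from \<open>place_mem_Q_iff\<close>.\<close>

lemma place_surj:
  assumes p: "p \<in> circle" and x: "x \<in> topspace (Q_space p 6)"
  obtains w g where "w permutes {1..6}" "g \<in> gaps" "place p w g = x"
proof -
  have xt: "x \<in> topspace (torus 6)"
    using x unfolding Q_space_topspace by blast
  define y where "y = x(6 := p)"
  define \<theta> where "\<theta> i = Arg2pi (y i / p) / (2 * pi)" for i
  have p0: "p \<noteq> 0" "norm p = 1" using p by auto
  have y: "y i = p * cis (2 * pi * \<theta> i)" if "i \<in> {1..6}" for i
  proof -
    have "norm (y i) = 1"
      using xt p that by (auto simp: y_def torus_topspace PiE_iff)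
    then have "y i / p = cis (Arg2pi (y i / p))"
      using Arg2pi_eq[of "y i / p"] p0 by (simp add: norm_divide cis_conv_exp)
    then show ?thesis using p0 by (simp add: \<theta>_def field_simps)
  qed
  have range: "0 \<le> \<theta> i" "\<theta> i < 1" for i
    using Arg2pi_ge_0[of "y i / p"] Arg2pi_lt_2pi[of "y i / p"] by (simp_all add: \<theta>_def)
  have six: "\<theta> 6 = 0"
    using p0 Arg2pi_unique[of 1 0 1] by (simp add: \<theta>_def y_def)
  have config: "config p \<theta> = x"
  proof
    fix i show "config p \<theta> i = x i"
      using y[of i] xt by (auto simp: config_def six y_def torus_topspace PiE_iff extensional_def)
  qed
  obtain w where w: "w permutes {1..6}" and mono: "\<And>k l. 1 \<le> k \<Longrightarrow> k \<le> l \<Longrightarrow> l \<le> 6 \<Longrightarrow> \<theta> (w k) \<le> \<theta> (w l)"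
    using sorting_permutation[of \<theta>] by blast
  define g where "g k = (if k \<in> {1..5} then \<theta> (w (k + 1)) - \<theta> (w k)
    else if k = 6 then 1 - \<theta> (w 6) + \<theta> (w 1) else 0)" for k
  have g_eq: "g 1 = \<theta> (w 2) - \<theta> (w 1)" "g 2 = \<theta> (w 3) - \<theta> (w 2)" "g 3 = \<theta> (w 4) - \<theta> (w 3)"
    "g 4 = \<theta> (w 5) - \<theta> (w 4)" "g 5 = \<theta> (w 6) - \<theta> (w 5)" "g 6 = 1 - \<theta> (w 6) + \<theta> (w 1)"
    by (simp_all add: g_def)
  have g: "g \<in> gap_simplex"
  proof -
    have "0 \<le> g k" for k
      using range[of "w 6"] range[of "w 1"] mono[of k "k + 1"] by (auto simp: g_def)
    moreover have "g k = 0" if "k \<notin> {1..6}" for k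
      using that by (auto simp: g_def)
    ultimately show ?thesis
      unfolding gap_simplex_def sum_positions mem_Collect_eq g_eq by auto
  qed
  have off: "offset g k = \<theta> (w k) - \<theta> (w 1)" if "k \<in> {1..6}" for k
    using that unfolding positions_eq by (elim insertE emptyE) (simp_all add: g_eq)
  have "place p w g = config p \<theta>"
    unfolding place_def config_eq_iff[OF p]
  proof
    fix i :: nat assume i: "i \<in> {1..6}"
    have "inv' w i \<in> {1..6}" "inv' w 6 \<in> {1..6}"
      using permutes_in_image[OF permutes_inv[OF w]] i by simp_all
    note off[OF this(1)] off[OF this(2)]
    then have "offset g (inv' w i) - offset g (inv' w 6) - (\<theta> i - \<theta> 6) = 0"
      unfolding permutes_inverses(1)[OF w] by linarith
    then show "offset g (inv' w i) - offset g (inv' w 6) - (\<theta> i - \<theta> 6) \<in> \<int>"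
      by (simp only: Ints_0)
  qed
  then have "place p w g = x" using config by simp
  moreover have "g \<in> gaps"
    using place_mem_Q_iff[OF p w g] x calculation by simp
  ultimately show ?thesis using that w by blast
qed

subsection \<open>The deformation retraction onto the book\<close>

definition odd_gap :: "(nat \<Rightarrow> real) \<Rightarrow> real" where
  "odd_gap g = min (g 1) (min (g 3) (g 5))"

definition even_gap :: "(nat \<Rightarrow> real) \<Rightarrow> real" where
  "even_gap g = min (g 2) (min (g 4) (g 6))"

definition gap_min :: "(nat \<Rightarrow> real) \<Rightarrow> real" where
  "gap_min g = min (odd_gap g) (even_gap g)"

text \<open>Barycentric weights of the retraction: \<open>odd_gap\<close> and \<open>even_gap\<close> belong to the ends of the common
  edge, \<open>page g\<close> to the third corner whose gaps 1 and 4 vanish. At most one of the three page weights is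
  positive because the smallest gap enters two of the three minima. The factor 4/3 makes the map the
  identity on the book.\<close>

definition page :: "(nat \<Rightarrow> real) \<Rightarrow> real" where
  "page g = 4 / 3 * (min (min (g 2) (g 3)) (min (g 5) (g 6)) - gap_min g)"

definition total_weight :: "(nat \<Rightarrow> real) \<Rightarrow> real" where
  "total_weight g = odd_gap g + even_gap g + page g + page (g \<circ> rot) + page (g \<circ> rot \<circ> rot)"

text \<open>First coordinate of the weighted mean of the five corners: gap 1 is 1/3 at one end of
  the common edge, 1/4 at two of the third corners, and 0 at the remaining two corners.\<close>

definition collapse_first :: "(nat \<Rightarrow> real) \<Rightarrow> real" where
  "collapse_first g = (odd_gap g / 3 + (page (g \<circ> rot) + page (g \<circ> rot \<circ> rot)) / 4) / total_weight g"

text \<open>Deriving all coordinates from the first by rotation builds in equivariance; only the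
  wrap-around at position 6 needs \<open>rot_pow_6\<close>.\<close>

definition collapse :: "(nat \<Rightarrow> real) \<Rightarrow> nat \<Rightarrow> real" where
  "collapse g k = (if k \<in> {1..6} then collapse_first (g \<circ> rot ^^ (k - 1)) else 0)"

lemma odd_gap_rot [simp]: "odd_gap (g \<circ> rot) = even_gap g"
  by (simp add: odd_gap_def even_gap_def)

lemma even_gap_rot [simp]: "even_gap (g \<circ> rot) = odd_gap g"
  by (simp add: odd_gap_def even_gap_def min.commute[of "g 1"] min.assoc)

lemma gap_min_rot [simp]: "gap_min (g \<circ> rot) = gap_min g"
  by (simp add: gap_min_def min.commute)

lemma page_rot3 [simp]: "page (g \<circ> rot \<circ> rot \<circ> rot) = page g"
  unfolding page_def gap_min_rot by (simp add: min.commute[of "min (g 5) (g 6)"])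

lemma total_weight_rot [simp]: "total_weight (g \<circ> rot) = total_weight g"
  by (simp add: total_weight_def)

lemma rot_pow_6: "rot ^^ 6 = id"
  by (rule ext) (simp add: numeral_eq_Suc rot_pow6)

lemma collapse_rot: "collapse (g \<circ> rot) = collapse g \<circ> rot"
proof
  fix k
  show "collapse (g \<circ> rot) k = (collapse g \<circ> rot) k"
  proof (cases "k \<in> {1..6}")
    case True
    have "rot \<circ> rot ^^ (k - 1) = rot ^^ Suc (k - 1)"
      by (rule funpow.simps(2)[symmetric])
    also have "\<dots> = rot ^^ (rot k - 1)"
    proof (cases "k = 6")
      case True
      then have "Suc (k - 1) = 6" "rot k - 1 = 0" by simp_all
      then show ?thesis by (simp only: rot_pow_6 funpow.simps(1))
    next
      case False
      then have "Suc (k - 1) = rot k - 1" using True by (auto simp: rot_def)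
      then show ?thesis by (simp only:)
    qed
    finally have "rot \<circ> rot ^^ (k - 1) = rot ^^ (rot k - 1)" .
    then show ?thesis
      using True by (simp only: collapse_def comp_apply comp_assoc rot_in if_True)
  next
    case False
    then show ?thesis by (simp only: collapse_def comp_apply rot_outside[OF False] if_False)
  qed
qed

lemma collapse_values:
  "collapse g 1 = (odd_gap g / 3 + (page (g \<circ> rot) + page (g \<circ> rot \<circ> rot)) / 4) / total_weight g"
  "collapse g 2 = (even_gap g / 3 + (page (g \<circ> rot \<circ> rot) + page g) / 4) / total_weight g"
  "collapse g 3 = (odd_gap g / 3 + (page g + page (g \<circ> rot)) / 4) / total_weight g"
  "collapse g 4 = (even_gap g / 3 + (page (g \<circ> rot) + page (g \<circ> rot \<circ> rot)) / 4) / total_weight g"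
  "collapse g 5 = (odd_gap g / 3 + (page (g \<circ> rot \<circ> rot) + page g) / 4) / total_weight g"
  "collapse g 6 = (even_gap g / 3 + (page g + page (g \<circ> rot)) / 4) / total_weight g"
proof -
  have 1: "collapse h 1 = (odd_gap h / 3 + (page (h \<circ> rot) + page (h \<circ> rot \<circ> rot)) / 4) / total_weight h" for h
    by (simp add: collapse_def collapse_first_def)
  show "collapse g 1 = (odd_gap g / 3 + (page (g \<circ> rot) + page (g \<circ> rot \<circ> rot)) / 4) / total_weight g"
    by (rule 1)
  have "collapse h 2 = collapse (h \<circ> rot) 1" for h
    by (simp add: collapse_rot)
  note 2 = this[unfolded 1]
  show "collapse g 2 = (even_gap g / 3 + (page (g \<circ> rot \<circ> rot) + page g) / 4) / total_weight g"
    using 2[of g] by simp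
  have "collapse h 3 = collapse (h \<circ> rot) 2" for h
    by (simp add: collapse_rot)
  note 3 = this[unfolded 2]
  show "collapse g 3 = (odd_gap g / 3 + (page g + page (g \<circ> rot)) / 4) / total_weight g"
    using 3[of g] by simp
  have "collapse h 4 = collapse (h \<circ> rot) 3" for h
    by (simp add: collapse_rot)
  note 4 = this[unfolded 3]
  show "collapse g 4 = (even_gap g / 3 + (page (g \<circ> rot) + page (g \<circ> rot \<circ> rot)) / 4) / total_weight g"
    using 4[of g] by simp
  have "collapse h 5 = collapse (h \<circ> rot) 4" for h
    by (simp add: collapse_rot)
  note 5 = this[unfolded 4]
  show "collapse g 5 = (odd_gap g / 3 + (page (g \<circ> rot \<circ> rot) + page g) / 4) / total_weight g"
    using 5[of g] by simp
  have "collapse h 6 = collapse (h \<circ> rot) 5" for h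
    by (simp add: collapse_rot)
  note 6 = this[unfolded 5]
  show "collapse g 6 = (even_gap g / 3 + (page g + page (g \<circ> rot)) / 4) / total_weight g"
    using 6[of g] by simp
qed

lemma gap_min_le: "k \<in> {1..6} \<Longrightarrow> gap_min g \<le> g k"
  unfolding positions_eq gap_min_def odd_gap_def even_gap_def by (auto simp: min_le_iff_disj)

lemma page_nonneg: "0 \<le> page g"
  using gap_min_le[of _ g] by (simp add: page_def)

lemma page_eq_0:
  assumes "k \<in> {2, 3, 5, 6}" "g k = gap_min g"
  shows "page g = 0"
proof -
  have "min (min (g 2) (g 3)) (min (g 5) (g 6)) \<le> g k"
    using assms(1) by (auto simp: min_le_iff_disj)
  then have "page g \<le> 0" using assms(2) by (simp add: page_def)
  then show ?thesis using page_nonneg[of g] by simp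
qed

lemma odd_gap_cases: "odd_gap g = g 1 \<or> odd_gap g = g 3 \<or> odd_gap g = g 5"
  unfolding odd_gap_def by linarith

lemma even_gap_cases: "even_gap g = g 2 \<or> even_gap g = g 4 \<or> even_gap g = g 6"
  unfolding even_gap_def by linarith

lemma gap_min_attained:
  obtains k where "k \<in> {1..6}" "g k = gap_min g"
proof -
  have "gap_min g = odd_gap g \<or> gap_min g = even_gap g"
    by (simp add: gap_min_def min_def)
  then have "g 1 = gap_min g \<or> g 2 = gap_min g \<or> g 3 = gap_min g \<or> g 4 = gap_min g
      \<or> g 5 = gap_min g \<or> g 6 = gap_min g"
    using odd_gap_cases[of g] even_gap_cases[of g] by (elim disjE) simp_all
  then show ?thesis
    using that[of 1] that[of 2] that[of 3] that[of 4] that[of 5] that[of 6] by (elim disjE) simp_all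
qed

lemma single_page:
  "page (g \<circ> rot) = 0 \<and> page (g \<circ> rot \<circ> rot) = 0 \<or> page g = 0 \<and> page (g \<circ> rot \<circ> rot) = 0
    \<or> page g = 0 \<and> page (g \<circ> rot) = 0"
proof -
  obtain k where k: "k \<in> {1..6}" "g k = gap_min g" by (rule gap_min_attained)
  have "page g = 0" if "k \<in> {2, 3, 5, 6}"
    using page_eq_0 that k(2) by blast
  moreover have "page (g \<circ> rot) = 0" if "k \<in> {3, 4, 6, 1}"
  proof -
    have "\<exists>j \<in> {2, 3, 5, 6}. rot j = k" using that by auto
    then show ?thesis using page_eq_0[of _ "g \<circ> rot"] k(2) by force
  qed
  moreover have "page (g \<circ> rot \<circ> rot) = 0" if "k \<in> {4, 5, 1, 2}"
  proof -
    have "\<exists>j \<in> {2, 3, 5, 6}. rot (rot j) = k" using that by auto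
    then show ?thesis using page_eq_0[of _ "g \<circ> rot \<circ> rot"] k(2) by force
  qed
  ultimately show ?thesis
    using k(1) unfolding positions_eq by blast
qed

lemma odd_even_gap_nonneg:
  assumes "g \<in> gaps"
  shows "0 \<le> odd_gap g" "0 \<le> even_gap g"
  using gapsD(1)[OF assms] by (simp_all add: odd_gap_def even_gap_def)

text \<open>Gaps 2 and 6 are positive as neighbours of gap 1. A vanishing page weight then makes gap
  3 or gap 5 vanish, and gap 4 is adjacent to both.\<close>

lemma even_gap_pos:
  assumes g: "g \<in> gaps" and "g 1 = 0" "page g = 0"
  shows "0 < even_gap g"
proof -
  have pos: "0 < g 2" "0 < g 6" using gapsD(4,9)[OF g] assms(2) by simp_all
  have "odd_gap g \<le> 0" using assms(2) by (simp add: odd_gap_def)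
  then have "gap_min g = 0" 
    using odd_even_gap_nonneg[OF g] by (simp add: gap_min_def)
  then have "\<not> (0 < g 3 \<and> 0 < g 5)"
    using assms(3) pos by (auto simp: page_def)
  then have "g 3 = 0 \<or> g 5 = 0"
    using gapsD(1)[OF g, of 3] gapsD(1)[OF g, of 5] by linarith
  then have "0 < g 4" using gapsD(6,7)[OF g] by auto
  then show ?thesis using pos by (simp add: even_gap_def)
qed

text \<open>If all weights vanished, so would some odd gap; rotation by 0, 2 or 4 steps brings it to
  position 1, where \<open>even_gap_pos\<close> gives a contradiction.\<close>

lemma total_weight_pos:
  assumes g: "g \<in> gaps"
  shows "0 < total_weight g"
proof (rule ccontr)
  note g2 = gaps_rot[OF g] gaps_rot[OF gaps_rot[OF g]]
  note g4 = gaps_rot[OF g2(2)] gaps_rot[OF gaps_rot[OF g2(2)]]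
  assume "\<not> 0 < total_weight g"
  then have zero: "odd_gap g = 0" "even_gap g = 0" "page g = 0" "page (g \<circ> rot) = 0" "page (g \<circ> rot \<circ> rot) = 0"
    using odd_even_gap_nonneg[OF g] page_nonneg[of g] page_nonneg[of "g \<circ> rot"] page_nonneg[of "g \<circ> rot \<circ> rot"]
    by (simp_all add: total_weight_def)
  consider "g 1 = 0" | "(g \<circ> rot \<circ> rot) 1 = 0" | "(g \<circ> rot \<circ> rot \<circ> rot \<circ> rot) 1 = 0"
    using odd_gap_cases[of g] zero(1) by auto
  then show False
  proof cases
    case 1
    then show ?thesis using even_gap_pos[OF g 1] zero by simp
  next
    case 2
    then show ?thesis
      using even_gap_pos[OF g2(2) 2 zero(5)] zero(2) by (simp only: even_gap_rot odd_gap_rot)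
  next
    case 3
    then show ?thesis
      using even_gap_pos[OF g4(2) 3] zero(2,4)
      unfolding even_gap_rot odd_gap_rot page_rot3 by simp
  qed
qed

text \<open>Makes the homotopy and the cell labels respect the exchange of coinciding labels. A
  vanishing gap 1 is a smallest gap, and it enters the minima of the two rotated pages.\<close>

lemma collapse_first_zero:
  assumes g: "g \<in> gaps" and "g 1 = 0"
  shows "odd_gap g = 0" "page (g \<circ> rot) = 0" "page (g \<circ> rot \<circ> rot) = 0" "collapse g 1 = 0"
proof -
  have "odd_gap g \<le> 0" using assms(2) by (simp add: odd_gap_def)
  then show o: "odd_gap g = 0" using odd_even_gap_nonneg[OF g] by simp
  then have m: "gap_min g = 0" 
    using odd_even_gap_nonneg[OF g] by (simp add: gap_min_def)
  show "page (g \<circ> rot) = 0"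
    by (rule page_eq_0[of 6]) (use m assms(2) in simp_all)
  moreover show "page (g \<circ> rot \<circ> rot) = 0"
    by (rule page_eq_0[of 5]) (use m assms(2) in simp_all)
  ultimately show "collapse g 1 = 0" using o by (simp add: collapse_values)
qed

lemma collapse_gaps:
  assumes g: "g \<in> gaps"
  shows "collapse g \<in> gaps"
proof (rule gapsI)
  note t = total_weight_pos[OF g]
  note nonneg = odd_even_gap_nonneg[OF g] page_nonneg[of g] page_nonneg[of "g \<circ> rot"] page_nonneg[of "g \<circ> rot \<circ> rot"]
  show "collapse g k = 0" if "k \<notin> {1..6}" for k
    using that by (auto simp: collapse_def)
  show "0 \<le> collapse g k" if "k \<in> {1..6}" for k
    using that t nonneg unfolding positions_eq
    by (elim insertE emptyE) (simp_all add: collapse_values)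
  show "collapse g 1 + collapse g 2 + collapse g 3 + collapse g 4 + collapse g 5 + collapse g 6 = 1"
  proof -
    have "collapse g 1 + collapse g 2 + collapse g 3 + collapse g 4 + collapse g 5 + collapse g 6
        = total_weight g / total_weight g"
      unfolding collapse_values add_divide_distrib[symmetric]
      by (rule arg_cong[of _ _ "\<lambda>x. x / total_weight g"]) (simp add: total_weight_def field_simps)
    then show ?thesis using t by simp
  qed
  \<comment> \<open>Two cyclically adjacent coordinates together involve all five weights, one page
    weight twice; this is why the mean never leaves \<open>gaps\<close>.\<close>
  have pos: "0 < (a / 3 + (b + d) / 4) / total_weight g + (c / 3 + (e + f) / 4) / total_weight g"
    if "0 \<le> a" "0 \<le> b" "0 \<le> c" "0 \<le> d" "0 \<le> e" "0 \<le> f" "0 < a + b + c + d + e + f" for a b c d e f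
  proof -
    have "(a / 3 + (b + d) / 4) / total_weight g + (c / 3 + (e + f) / 4) / total_weight g
        = (4 * a + 3 * b + 3 * d + 4 * c + 3 * e + 3 * f) / (12 * total_weight g)"
      using t by (simp add: field_simps)
    then show ?thesis using t that by simp
  qed
  have "0 < odd_gap g + even_gap g + page g + page (g \<circ> rot) + page (g \<circ> rot \<circ> rot)"
    using t by (simp add: total_weight_def)
  note pos = pos[where a = "odd_gap g" and c = "even_gap g"] pos[where c = "odd_gap g" and a = "even_gap g"] this nonneg
  show "0 < collapse g 1 + collapse g 2" "0 < collapse g 2 + collapse g 3"
    "0 < collapse g 3 + collapse g 4" "0 < collapse g 4 + collapse g 5"
    "0 < collapse g 5 + collapse g 6" "0 < collapse g 6 + collapse g 1"
    unfolding collapse_values by (rule pos(1) pos(2); use pos(3-) in linarith)+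
qed

text \<open>The triangle whose third corner \<open>book 0 0\<close> has vanishing gaps 1 and 4; the ends of the common
  edge are \<open>book 1 0\<close> and \<open>book 0 1\<close>.\<close>

definition book :: "real \<Rightarrow> real \<Rightarrow> nat \<Rightarrow> real" where
  "book x y k = (if k = 1 then x / 3 else if k = 4 then y / 3
     else if k = 2 \<or> k = 6 then y / 3 + (1 - x - y) / 4
     else if k = 3 \<or> k = 5 then x / 3 + (1 - x - y) / 4 else 0)"

lemma book_gaps: "0 \<le> x \<Longrightarrow> 0 \<le> y \<Longrightarrow> x + y \<le> 1 \<Longrightarrow> book x y \<in> gaps"
  by (rule gapsI) (auto simp: book_def field_simps)

text \<open>Only three corners still carry weight, and the normalized weights are the barycentric
  coordinates in their triangle.\<close>

lemma collapse_eq_book: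
  assumes g: "g \<in> gaps" and "page (g \<circ> rot) = 0" "page (g \<circ> rot \<circ> rot) = 0"
  shows "collapse g = book (odd_gap g / total_weight g) (even_gap g / total_weight g)"
proof
  note t = total_weight_pos[OF g]
  have tot: "total_weight g = odd_gap g + even_gap g + page g"
    using assms by (simp add: total_weight_def)
  have m: "1 - odd_gap g / total_weight g - even_gap g / total_weight g = page g / total_weight g"
  proof -
    have "page g = total_weight g - odd_gap g - even_gap g" using tot by simp
    then show ?thesis using t by (simp add: diff_divide_distrib)
  qed
  fix k
  show "collapse g k = book (odd_gap g / total_weight g) (even_gap g / total_weight g) k"
  proof (cases "k \<in> {1..6}")
    case True
    then show ?thesis
      unfolding positions_eq book_def m
      by (elim insertE emptyE) (simp_all add: collapse_values assms add_divide_distrib)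
  next
    case False
    then show ?thesis by (auto simp: book_def collapse_def)
  qed
qed

text \<open>The weights reproduce the barycentric coordinates up to a common factor 1/3, which the
  division by \<open>total_weight\<close> cancels; hence \<open>collapse\<close> fixes the
  book.\<close>

lemma book_parameters:
  assumes "0 \<le> x" "0 \<le> y" "x + y \<le> 1"
  shows "odd_gap (book x y) = x / 3" "even_gap (book x y) = y / 3"
    "page (book x y) = (1 - x - y) / 3"
    "page (book x y \<circ> rot) = 0" "page (book x y \<circ> rot \<circ> rot) = 0" "total_weight (book x y) = 1 / 3"
proof -
  show o: "odd_gap (book x y) = x / 3" and e: "even_gap (book x y) = y / 3"
    using assms by (simp_all add: odd_gap_def even_gap_def book_def)
  have m: "gap_min (book x y) = min (x / 3) (y / 3)"
    unfolding gap_min_def o e ..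
  define c where "c = (1 - x - y) / 4"
  have c: "0 \<le> c" using assms by (simp add: c_def)
  have v: "book x y 1 = x / 3" "book x y 2 = y / 3 + c" "book x y 3 = x / 3 + c" "book x y 4 = y / 3"
    "book x y 5 = x / 3 + c" "book x y 6 = y / 3 + c"
    by (simp_all add: book_def c_def)
  have "min (min (b + c) (a + c)) (min (a + c) (b + c)) = min a b + c" for a b
    by (simp add: min_def)
  then have "page (book x y) = 4 / 3 * c"
    unfolding page_def m v by simp
  then show 1: "page (book x y) = (1 - x - y) / 3"
    by (simp add: c_def)
  have "min (min (a + c) b) (min (b + c) a) = min a b" for a b
    using c by (simp add: min_def)
  then show 2: "page (book x y \<circ> rot) = 0"
    unfolding page_def gap_min_rot m comp_apply rot_simps v by simp
  have "min (min b (a + c)) (min a (b + c)) = min a b" for a b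
    using c by (simp add: min_def)
  then show 3: "page (book x y \<circ> rot \<circ> rot) = 0"
    unfolding page_def gap_min_rot m comp_apply rot_simps v by simp
  show "total_weight (book x y) = 1 / 3"
    unfolding total_weight_def o e 1 2 3 by (simp add: diff_divide_distrib)
qed

lemma collapse_book:
  assumes "0 \<le> x" "0 \<le> y" "x + y \<le> 1"
  shows "collapse (book x y) = book x y"
  using collapse_eq_book[OF book_gaps[OF assms]] by (simp add: book_parameters[OF assms])

lemma rot_pow_small: "rot ^^ 0 = id" "rot ^^ 1 = rot" "rot ^^ 2 = rot \<circ> rot"
  by (simp_all add: numeral_2_eq_2 One_nat_def)

text \<open>Zero, one or two rotations turn the only page that may carry weight into the standard
  one.\<close>

lemma collapse_in_book:
  assumes g: "g \<in> gaps"
  obtains x y j where "0 \<le> x" "0 \<le> y" "x + y \<le> 1" "collapse g \<circ> rot ^^ j = book x y"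
proof -
  have *: "\<exists>x y. 0 \<le> x \<and> 0 \<le> y \<and> x + y \<le> 1 \<and> collapse h = book x y"
    if h: "h \<in> gaps" and "page (h \<circ> rot) = 0" "page (h \<circ> rot \<circ> rot) = 0" for h
  proof (intro exI conjI)
    note t = total_weight_pos[OF h]
    show "collapse h = book (odd_gap h / total_weight h) (even_gap h / total_weight h)"
      by (rule collapse_eq_book[OF that])
    show "0 \<le> odd_gap h / total_weight h" "0 \<le> even_gap h / total_weight h"
      using t odd_even_gap_nonneg[OF h] by simp_all
    show "odd_gap h / total_weight h + even_gap h / total_weight h \<le> 1"
      using t page_nonneg[of h] that by (simp add: add_divide_distrib[symmetric]) (simp add: total_weight_def)
  qed
  have "\<exists>j x y. 0 \<le> x \<and> 0 \<le> y \<and> x + y \<le> 1 \<and> collapse g \<circ> rot ^^ j = book x y"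
    using single_page[of g]
  proof (elim disjE conjE)
    assume "page (g \<circ> rot) = 0" "page (g \<circ> rot \<circ> rot) = 0"
    from *[OF g this] show ?thesis
      by (intro exI[of _ "0::nat"]) (simp only: rot_pow_small comp_id)
  next
    assume "page g = 0" "page (g \<circ> rot \<circ> rot) = 0"
    with *[OF gaps_rot[OF g]] show ?thesis
      by (intro exI[of _ "1::nat"]) (simp only: rot_pow_small collapse_rot page_rot3)
  next
    assume "page g = 0" "page (g \<circ> rot) = 0"
    with *[OF gaps_rot[OF gaps_rot[OF g]]] show ?thesis
      by (intro exI[of _ "2::nat"]) (simp only: rot_pow_small collapse_rot page_rot3 comp_assoc[symmetric])
  qed
  then show ?thesis using that by blast
qed

section \<open>The straight-line homotopy on gaps and on configurations\<close>

definition morph :: "real \<Rightarrow> (nat \<Rightarrow> real) \<Rightarrow> nat \<Rightarrow> real" where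
  "morph t g k = (1 - t) * g k + t * collapse g k"

lemma morph_0: "morph 0 g = g" and morph_1: "morph 1 g = collapse g"
  by (auto simp: morph_def)

lemma morph_rot: "morph t (g \<circ> rot) = morph t g \<circ> rot"
  by (auto simp: morph_def collapse_rot)

lemma gaps_convex:
  assumes g: "g \<in> gaps" and h: "h \<in> gaps" and t: "0 \<le> t" "t \<le> 1"
  shows "(\<lambda>k. (1 - t) * g k + t * h k) \<in> gaps"
proof (rule gapsI)
  have pos: "0 < (1 - t) * a + t * a' + ((1 - t) * b + t * b')" if "0 < a + b" "0 < a' + b'" for a a' b b'
  proof -
    have "0 < (1 - t) * (a + b) + t * (a' + b')"
    proof (cases "t = 1")
      case False
      then have "0 < (1 - t) * (a + b)" using that t by simp
      moreover have "0 \<le> t * (a' + b')" using that t by simp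
      ultimately show ?thesis by linarith
    qed (use that in simp)
    then show ?thesis by (simp add: algebra_simps)
  qed
  show "0 < (1 - t) * g 1 + t * h 1 + ((1 - t) * g 2 + t * h 2)"
    "0 < (1 - t) * g 2 + t * h 2 + ((1 - t) * g 3 + t * h 3)"
    "0 < (1 - t) * g 3 + t * h 3 + ((1 - t) * g 4 + t * h 4)"
    "0 < (1 - t) * g 4 + t * h 4 + ((1 - t) * g 5 + t * h 5)"
    "0 < (1 - t) * g 5 + t * h 5 + ((1 - t) * g 6 + t * h 6)"
    "0 < (1 - t) * g 6 + t * h 6 + ((1 - t) * g 1 + t * h 1)"
    using gapsD(4-9)[OF g] gapsD(4-9)[OF h] by (simp_all add: pos)
  have "(1 - t) * g 1 + t * h 1 + ((1 - t) * g 2 + t * h 2) + ((1 - t) * g 3 + t * h 3) +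
      ((1 - t) * g 4 + t * h 4) + ((1 - t) * g 5 + t * h 5) + ((1 - t) * g 6 + t * h 6)
      = (1 - t) * (g 1 + g 2 + g 3 + g 4 + g 5 + g 6) + t * (h 1 + h 2 + h 3 + h 4 + h 5 + h 6)"
    by (simp add: algebra_simps)
  then show "(1 - t) * g 1 + t * h 1 + ((1 - t) * g 2 + t * h 2) + ((1 - t) * g 3 + t * h 3) +
      ((1 - t) * g 4 + t * h 4) + ((1 - t) * g 5 + t * h 5) + ((1 - t) * g 6 + t * h 6) = 1"
    unfolding gapsD(2)[OF g] gapsD(2)[OF h] by simp
  show "0 \<le> (1 - t) * g k + t * h k" for k
    using gapsD(1)[OF g] gapsD(1)[OF h] t by simp
  show "(1 - t) * g k + t * h k = 0" if "k \<notin> {1..6}" for k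
    using gapsD(3)[OF g that] gapsD(3)[OF h that] by simp
qed

lemma morph_gaps: "g \<in> gaps \<Longrightarrow> 0 \<le> t \<Longrightarrow> t \<le> 1 \<Longrightarrow> morph t g \<in> gaps"
  unfolding morph_def[abs_def] by (rule gaps_convex[OF _ collapse_gaps])

lemma continuous_on_gap_functions:
  fixes f :: "'a::topological_space \<Rightarrow> nat \<Rightarrow> real"
  assumes f: "\<And>k. continuous_on S (\<lambda>z. f z k)"
  shows "continuous_on S (\<lambda>z. odd_gap (f z))" "continuous_on S (\<lambda>z. even_gap (f z))"
    "continuous_on S (\<lambda>z. page (f z))"
  unfolding odd_gap_def even_gap_def page_def gap_min_def
  by (intro continuous_intros continuous_on_min f)+

lemma continuous_on_collapse:
  fixes f :: "'a::topological_space \<Rightarrow> nat \<Rightarrow> real"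
  assumes f: "\<And>k. continuous_on S (\<lambda>z. f z k)" and S: "\<And>z. z \<in> S \<Longrightarrow> f z \<in> gaps"
  shows "continuous_on S (\<lambda>z. collapse (f z) k)"
proof (cases "k \<in> {1..6}")
  case True
  let ?h = "\<lambda>z. f z \<circ> rot ^^ (k - 1)"
  have h: "continuous_on S (\<lambda>z. (?h z) l)" for l
    using f by simp
  have h1: "continuous_on S (\<lambda>z. (?h z \<circ> rot) l)" for l
    using f by simp
  have h2: "continuous_on S (\<lambda>z. (?h z \<circ> rot \<circ> rot) l)" for l
    using f by simp
  have "total_weight (?h z) \<noteq> 0" if "z \<in> S" for z
    using total_weight_pos[OF gaps_rot_pow[OF S[OF that], of "k - 1"]] by linarith
  moreover have "continuous_on S (\<lambda>z. total_weight (?h z))"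
    unfolding total_weight_def
    by (intro continuous_on_add continuous_on_gap_functions[OF h] continuous_on_gap_functions[OF h1]
        continuous_on_gap_functions[OF h2])
  ultimately have "continuous_on S (\<lambda>z. collapse_first (?h z))"
    unfolding collapse_first_def
    by (intro continuous_on_divide continuous_on_add continuous_on_const
        continuous_on_gap_functions[OF h] continuous_on_gap_functions[OF h1]
        continuous_on_gap_functions[OF h2]) auto
  then show ?thesis
    using True by (simp only: collapse_def if_True)
next
  case False
  then show ?thesis by (simp only: collapse_def if_False) simp
qed

definition flow :: "complex \<Rightarrow> real \<Rightarrow> (nat \<Rightarrow> complex) \<Rightarrow> nat \<Rightarrow> complex" where
  "flow p t x = (let (w, g) = SOME (w, g). w permutes {1..6} \<and> g \<in> gaps \<and> place p w g = x
    in place p w (morph t g))"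

context
  fixes p :: complex
  assumes p: "p \<in> circle"
begin

text \<open>Removes the arbitrary choice in \<open>flow\<close>. Rotation is respected because
  \<open>collapse\<close> is equivariant, the exchange because a vanishing gap stays zero.\<close>

lemma flow_place:
  assumes w: "w permutes {1..6}" and g: "g \<in> gaps" and t: "0 \<le> t" "t \<le> 1"
  shows "flow p t (place p w g) = place p w (morph t g)"
proof -
  interpret arrangement_invariant "\<lambda>w g. place p w (morph t g)"
  proof
    fix w :: "nat \<Rightarrow> nat" and g assume w: "w permutes {1..6}" and g: "g \<in> gaps"
    show "place p (w \<circ> rot) (morph t (g \<circ> rot)) = place p w (morph t g)"
      unfolding morph_rot by (rule place_rot[OF p w morph_gaps[OF g t]])
    assume "g 1 = 0"
    then show "place p (w \<circ> Transposition.transpose 1 2) (morph t g) = place p w (morph t g)"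
      using collapse_first_zero(4)[OF g] by (intro place_swap[OF p w]) (simp add: morph_def)
  qed
  define P where "P = (\<lambda>(w', g'). w' permutes {1..6} \<and> g' \<in> gaps \<and> place p w' g' = place p w g)"
  obtain w' g' where wg': "Eps P = (w', g')" by fastforce
  have "P (w, g)" using w g by (simp add: P_def)
  then have "P (Eps P)" by (rule someI)
  then have "P (w', g')" unfolding wg' .
  then have "w' permutes {1..6}" "g' \<in> gaps" "place p w' g' = place p w g"
    by (simp_all add: P_def)
  then have "place p w' (morph t g') = place p w (morph t g)"
    using factors_through_place[OF p _ _ w g] by blast
  then show ?thesis
    using wg' by (simp add: flow_def P_def)
qed

lemma place_in_Q: "w permutes {1..6} \<Longrightarrow> g \<in> gaps \<Longrightarrow> place p w g \<in> topspace (Q_space p 6)"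
  using place_mem_Q_iff[OF p, of w g] by (simp add: gaps_def)

lemma Q_space_eq: "Q_space p 6 = subtopology (torus 6) (topspace (Q_space p 6))"
  by (simp add: Q_space_def subtopology_restrict)

text \<open>There is one compact piece, interval times \<open>gap_simplex\<close>, for each
  permutation. The part of it lying over the space has its gaps in \<open>gaps\<close>, where the
  denominator of \<open>collapse\<close> is positive.\<close>

lemma continuous_flow:
  "continuous_map (prod_topology (top_of_set {0..1::real}) (Q_space p 6)) (Q_space p 6) (\<lambda>(t, x). flow p t x)"
proof -
  let ?Q = "topspace (Q_space p 6)"
  let ?S = "{0..1::real} \<times> ?Q"
  let ?T = "prod_topology (top_of_set {0..1::real}) (torus 6)"
  let ?P = "\<lambda>w (t, g). (t, place p w g)"
  let ?K = "top_of_set ({0..1::real} \<times> gap_simplex)"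
  have Q: "?Q \<subseteq> topspace (torus 6)"
    unfolding Q_space_topspace by blast
  have "continuous_map (subtopology ?T ?S) (Q_space p 6) (\<lambda>(t, x). flow p t x)"
  proof (rule continuous_map_from_compact_pieces[where I = "{w. w permutes {1..6}}" and K = "\<lambda>_. ?K" and P = ?P])
    show "finite {w. w permutes {1..6::nat}}"
      by (simp add: finite_permutations)
    show "compact_space ?K"
      using compact_gap_simplex by (simp add: compact_space_subtopology compact_Times)
    have "Hausdorff_space (top_of_set {0..1::real})"
      by (rule Hausdorff_space_subtopology) simp
    then show "Hausdorff_space ?T"
      unfolding Hausdorff_space_prod_topology using Hausdorff_torus by blast
    show "?S \<subseteq> topspace ?T"
      using Q by auto
    show "?S \<subseteq> (\<Union>w \<in> {w. w permutes {1..6}}. ?P w ` topspace ?K)"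
    proof clarify
      fix t :: real and x assume t: "t \<in> {0..1}" and x: "x \<in> ?Q"
      obtain w g where wg: "w permutes {1..6}" "g \<in> gaps" "place p w g = x"
        using place_surj[OF p x] by blast
      then have "(t, x) = ?P w (t, g)" "(t, g) \<in> topspace ?K"
        using t by (auto simp: gaps_def)
      then show "(t, x) \<in> (\<Union>w \<in> {w. w permutes {1..6}}. ?P w ` topspace ?K)"
        using wg(1) by blast
    qed
    fix w :: "nat \<Rightarrow> nat" assume "w \<in> {w. w permutes {1..6}}"
    then have w: "w permutes {1..6}" by simp
    have coord: "continuous_on S (\<lambda>z. snd z k)" for S :: "(real \<times> (nat \<Rightarrow> real)) set" and k
      by (rule continuous_on_compose2[OF continuous_on_coordinate[of UNIV]]) (auto intro: continuous_on_snd)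
    have "continuous_map ?K (torus 6) (\<lambda>z. place p w (snd z))"
      unfolding place_def
      by (intro continuous_map_config[OF p]) (auto simp: offset_def intro!: continuous_on_sum coord)
    moreover have "continuous_map ?K (top_of_set {0..1}) fst"
      by (auto intro: continuous_on_fst continuous_on_id)
    ultimately show "continuous_map ?K ?T (?P w)"
      unfolding continuous_map_pairwise by (simp add: o_def case_prod_beta)
    have eq: "{z \<in> topspace ?K. ?P w z \<in> ?S} = {0..1} \<times> gaps"
      using place_mem_Q_iff[OF p w] by (auto simp: gaps_def)
    have sub: "({0..1} \<times> gap_simplex) \<inter> ({0..1::real} \<times> gaps) = {0..1} \<times> gaps"
      by (auto simp: gaps_def)
    have "continuous_on ({0..1} \<times> gaps) (\<lambda>z. morph (fst z) (snd z) k)" for k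
      unfolding morph_def
      by (intro continuous_intros continuous_on_collapse coord) auto
    then have "continuous_map (top_of_set ({0..1} \<times> gaps)) (torus 6) (\<lambda>z. place p w (morph (fst z) (snd z)))"
      unfolding place_def
      by (intro continuous_map_config[OF p]) (auto simp: offset_def intro!: continuous_on_sum)
    then have "continuous_map (top_of_set ({0..1} \<times> gaps)) (Q_space p 6) (\<lambda>z. place p w (morph (fst z) (snd z)))"
      by (subst Q_space_eq, auto simp: continuous_map_in_subtopology intro!: place_in_Q w morph_gaps)
    then have "continuous_map (top_of_set ({0..1} \<times> gaps)) (Q_space p 6) ((\<lambda>(t, x). flow p t x) \<circ> ?P w)"
      by (rule continuous_map_eq) (auto simp: flow_place[OF w])
    then show "continuous_map (subtopology ?K {z \<in> topspace ?K. ?P w z \<in> ?S}) (Q_space p 6)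
        ((\<lambda>(t, x). flow p t x) \<circ> ?P w)"
      unfolding eq by (simp add: subtopology_subtopology sub)
  qed
  moreover have "subtopology ?T ?S = prod_topology (top_of_set {0..1::real}) (Q_space p 6)"
    by (subst (2) Q_space_eq) (simp add: prod_topology_subtopology(2) subtopology_subtopology
        flip: subtopology_Times)
  ultimately show ?thesis by simp
qed

lemma flow_homotopic_id: "homotopic_with (\<lambda>_. True) (Q_space p 6) (Q_space p 6) (flow p 1) id"
proof -
  have "flow p 0 x = x" if x: "x \<in> topspace (Q_space p 6)" for x
  proof -
    obtain w g where "w permutes {1..6}" "g \<in> gaps" "place p w g = x"
      using place_surj[OF p x] by blast
    then show ?thesis using flow_place[of w g 0] by (auto simp: morph_0)
  qed
  then have "homotopic_with (\<lambda>_. True) (Q_space p 6) (Q_space p 6) id (flow p 1)"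
    by (subst homotopic_with) (auto intro!: exI[of _ "\<lambda>(t, x). flow p t x"] continuous_flow)
  then show ?thesis by (rule homotopic_with_symD)
qed

lemma flow_1_place:
  assumes "w permutes {1..6}" "g \<in> gaps"
  shows "flow p 1 (place p w g) = place p w (collapse g)"
  using flow_place[OF assms, of 1] by (simp add: morph_1)

end

subsection \<open>Characteristic maps\<close>

text \<open>Positions of the six points on the square with coordinates \<open>\<bar>s\<bar> + \<bar>t\<bar> \<le> 1\<close>: the points 1, 2 and
  4, 5 are centred at 0 and 1/2, and on each quadrant the configuration lies in the triangle
  \<open>book \<bar>s\<bar> \<bar>t\<bar>\<close> of the chamber whose order is read off from the signs of \<open>s\<close> and \<open>t\<close>.\<close>

definition face_offset :: "real \<Rightarrow> real \<Rightarrow> nat \<Rightarrow> real" where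
  "face_offset s t k = (if k = 1 then - s / 6 else if k = 2 then s / 6
     else if k = 3 then 1 / 4 + (\<bar>t\<bar> - \<bar>s\<bar>) / 12 else if k = 4 then 1 / 2 - t / 6
     else if k = 5 then 1 / 2 + t / 6 else 3 / 4 - (\<bar>t\<bar> - \<bar>s\<bar>) / 12)"

definition face_point :: "complex \<Rightarrow> (nat \<Rightarrow> nat) \<Rightarrow> real \<Rightarrow> real \<Rightarrow> nat \<Rightarrow> complex" where
  "face_point p w s t = config p (\<lambda>i. face_offset s t (inv' w i))"

lemma face_offset_swap: "face_offset s t (Transposition.transpose 1 2 k) = face_offset (- s) t k"
  by (auto simp: face_offset_def Transposition.transpose_def)

lemma inv_comp:
  assumes "w permutes {1..6}" "v permutes {1..6}"
  shows "inv' (w \<circ> v) i = inv' v (inv' w i)"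
  using o_inv_distrib[OF permutes_bij[OF assms(1)] permutes_bij[OF assms(2)]] by (simp only: comp_apply)

lemma swap12_permutes: "Transposition.transpose 1 2 permutes {1..6::nat}"
  by (rule permutes_swap_id) auto

lemma swap45_permutes: "Transposition.transpose 4 5 permutes {1..6::nat}"
  by (rule permutes_swap_id) auto

lemma swap12_compose: "w permutes {1..6::nat} \<Longrightarrow> w \<circ> Transposition.transpose 1 2 permutes {1..6}"
  by (rule permutes_compose[OF swap12_permutes])

lemma swap45_compose: "w permutes {1..6::nat} \<Longrightarrow> w \<circ> Transposition.transpose 4 5 permutes {1..6}"
  by (rule permutes_compose[OF swap45_permutes])

lemma rot_compose: "w permutes {1..6} \<Longrightarrow> w \<circ> rot permutes {1..6}"
  by (rule permutes_compose[OF rot_permutes])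

text \<open>Three rotations interchange the positions 1, 2 with 4, 5, so invariance under the
  exchange of 4 and 5 follows from the two equations assumed for squares.\<close>

lemma swap45_conjugate:
  "Transposition.transpose 4 5 \<circ> rot \<circ> rot \<circ> rot = rot \<circ> rot \<circ> rot \<circ> Transposition.transpose 1 2"
proof
  fix k :: nat
  show "(Transposition.transpose 4 5 \<circ> rot \<circ> rot \<circ> rot) k = (rot \<circ> rot \<circ> rot \<circ> Transposition.transpose 1 2) k"
  proof (cases "k \<in> {1..6}")
    case True
    then show ?thesis
      unfolding positions_eq by (elim insertE emptyE) (simp_all add: Transposition.transpose_def)
  next
    case False
    then have "k \<noteq> 1" "k \<noteq> 2" "k \<noteq> 4" "k \<noteq> 5" by auto
    then show ?thesis by (simp add: rot_outside[OF False] Transposition.transpose_def)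
  qed
qed

text \<open>The equations are generators of the symmetries of each kind of cell: a vertex is a
  cyclic sequence of three unordered pairs, an edge a cyclic order of six labels, a square a cyclic
  sequence pair, label, pair, label.\<close>

locale cell_label =
  fixes fV fE fF :: "(nat \<Rightarrow> nat) \<Rightarrow> 'b"
  assumes fV_rot: "\<And>w. w permutes {1..6} \<Longrightarrow> fV (w \<circ> rot \<circ> rot) = fV w"
    and fV_swap: "\<And>w. w permutes {1..6} \<Longrightarrow> fV (w \<circ> Transposition.transpose 1 2) = fV w"
    and fE_rot: "\<And>w. w permutes {1..6} \<Longrightarrow> fE (w \<circ> rot) = fE w"
    and fF_rot: "\<And>w. w permutes {1..6} \<Longrightarrow> fF (w \<circ> rot \<circ> rot \<circ> rot) = fF w"
    and fF_swap: "\<And>w. w permutes {1..6} \<Longrightarrow> fF (w \<circ> Transposition.transpose 1 2) = fF w"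
begin

text \<open>A function on cells, viewed as a function of the configurations in them; \<open>fV w\<close>, \<open>fE w\<close> and
  \<open>fF w\<close> are its values at the vertex, edge and square belonging to \<open>w\<close>. Well-definedness of such
  functions is what keeps cells apart.\<close>

definition label :: "(nat \<Rightarrow> nat) \<Rightarrow> (nat \<Rightarrow> real) \<Rightarrow> 'b" where
  "label w g = (if 0 < page g then fF w else if 0 < page (g \<circ> rot) then fF (w \<circ> rot)
     else if 0 < page (g \<circ> rot \<circ> rot) then fF (w \<circ> rot \<circ> rot)
     else if 0 < odd_gap g \<and> 0 < even_gap g then fE w
     else if 0 < even_gap g then fV w else fV (w \<circ> rot))"

sublocale arrangement_invariant label
proof
  fix w :: "nat \<Rightarrow> nat" and g assume w: "w permutes {1..6}" and g: "g \<in> gaps"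
  \<comment> \<open>Justifies the default branch of \<open>label\<close>: without page weights and
    without the even weight, the odd one is positive.\<close>
  have pos: "0 < odd_gap g \<or> 0 < even_gap g" if "\<not> 0 < page g" "\<not> 0 < page (g \<circ> rot)" "\<not> 0 < page (g \<circ> rot \<circ> rot)"
    using total_weight_pos[OF g] that odd_even_gap_nonneg[OF g] by (auto simp: total_weight_def)
  show "label (w \<circ> rot) (g \<circ> rot) = label w g"
    unfolding label_def page_rot3 odd_gap_rot even_gap_rot fF_rot[OF w] fE_rot[OF w] fV_rot[OF w]
    using single_page[of g] pos by auto
  assume g1: "g 1 = 0"
  show "label (w \<circ> Transposition.transpose 1 2) g = label w g"
    unfolding label_def fF_swap[OF w] fV_swap[OF w] collapse_first_zero(1-3)[OF g g1]
    using even_gap_pos[OF g g1] page_nonneg[of g] by force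
qed

lemma fF_swap45:
  assumes w: "w permutes {1..6}"
  shows "fF (w \<circ> Transposition.transpose 4 5) = fF w"
proof -
  have "fF (w \<circ> Transposition.transpose 4 5) = fF (w \<circ> Transposition.transpose 4 5 \<circ> rot \<circ> rot \<circ> rot)"
    by (rule fF_rot[OF swap45_compose[OF w], symmetric])
  also have "w \<circ> Transposition.transpose 4 5 \<circ> rot \<circ> rot \<circ> rot
      = w \<circ> (Transposition.transpose 4 5 \<circ> rot \<circ> rot \<circ> rot)"
    by (simp only: comp_assoc)
  also have "\<dots> = w \<circ> rot \<circ> rot \<circ> rot \<circ> Transposition.transpose 1 2"
    unfolding swap45_conjugate by (simp only: comp_assoc)
  also have "fF \<dots> = fF (w \<circ> rot \<circ> rot \<circ> rot)"
    by (rule fF_swap[OF rot_compose[OF rot_compose[OF rot_compose[OF w]]]])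
  also have "\<dots> = fF w" by (rule fF_rot[OF w])
  finally show ?thesis .
qed

lemma label_book:
  assumes "0 \<le> x" "0 \<le> y" "x + y \<le> 1"
  shows "label w (book x y) = (if x + y < 1 then fF w else if 0 < x \<and> 0 < y then fE w
     else if 0 < y then fV w else fV (w \<circ> rot))"
  unfolding label_def book_parameters[OF assms] using assms by auto

end

text \<open>For squares the affine substitution carries the unit square to the diamond |s| + |t|
  \<le> 1; the corners (0,0), (1,0), (0,1), (1,1) go to (0,1), (1,0), (-1,0), (0,-1).\<close>

definition chart :: "complex \<Rightarrow> nat \<Rightarrow> (nat \<Rightarrow> nat) \<Rightarrow> (nat \<Rightarrow> real) \<Rightarrow> nat \<Rightarrow> complex" where
  "chart p k w x = (if k = 0 then place p w (book 0 1)
     else if k = 1 then place p w (book (x 0) (1 - x 0))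
     else face_point p w (x 0 - x 1) (1 - x 0 - x 1))"

lemma chart_simps [simp]:
  "chart p 0 w x = place p w (book 0 1)"
  "chart p 1 w x = place p w (book (x 0) (1 - x 0))"
  "chart p 2 w x = face_point p w (x 0 - x 1) (1 - x 0 - x 1)"
  by (simp_all add: chart_def)

context
  fixes p :: complex
  assumes p: "p \<in> circle"
begin

lemma face_point_swap12:
  assumes w: "w permutes {1..6}"
  shows "face_point p (w \<circ> Transposition.transpose 1 2) s t = face_point p w (- s) t"
  unfolding face_point_def inv_comp[OF w swap12_permutes] inv_transpose_eq face_offset_swap ..

lemma face_point_swap45:
  assumes w: "w permutes {1..6}"
  shows "face_point p (w \<circ> Transposition.transpose 4 5) s t = face_point p w s (- t)"
proof -
  have "face_offset s t (Transposition.transpose 4 5 k) = face_offset s (- t) k" for k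
    by (auto simp: face_offset_def Transposition.transpose_def)
  then show ?thesis
    unfolding face_point_def inv_comp[OF w swap45_permutes] inv_transpose_eq by simp
qed

text \<open>Up to a half turn of the circle, three rotations interchange the pair centred at 0 with
  the pair centred at 1/2, and so the roles of \<open>s\<close> and \<open>t\<close>.\<close>

lemma face_point_rot3:
  assumes w: "w permutes {1..6}"
  shows "face_point p (w \<circ> rot \<circ> rot \<circ> rot) s t = face_point p w t s"
proof -
  have r3: "rot \<circ> rot \<circ> rot permutes {1..6}"
    by (intro rot_compose rot_permutes)
  have inv: "inv' (w \<circ> rot \<circ> rot \<circ> rot) i = inv' (rot \<circ> rot \<circ> rot) (inv' w i)" for i
    using inv_comp[OF w r3] by (simp only: comp_assoc)
  have "inv' (rot \<circ> rot \<circ> rot) k = rot (rot (rot k))" for k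
    by (rule inv_f_eq[OF permutes_inj[OF r3]]) (simp add: rot_pow6)
  note inv = inv[unfolded this]
  have step: "face_offset s t (rot (rot (rot k))) - face_offset t s k - 1 / 2 \<in> \<int>" if "k \<in> {1..6}" for k
  proof -
    have "face_offset s t (rot (rot (rot k))) - face_offset t s k - 1 / 2 \<in> {0, -1}"
      using that unfolding positions_eq
      by (elim insertE emptyE) (simp_all add: face_offset_def field_simps)
    moreover have "{0, -1} \<subseteq> (\<int> :: real set)" by simp
    ultimately show ?thesis by blast
  qed
  show ?thesis
    unfolding face_point_def config_eq_iff[OF p] inv
  proof
    fix i :: nat assume i: "i \<in> {1..6}"
    have in6: "inv' w i \<in> {1..6}" "inv' w 6 \<in> {1..6}"
      using permutes_in_image[OF permutes_inv[OF w]] i by simp_all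
    have "face_offset s t (rot (rot (rot (inv' w i)))) - face_offset t s (inv' w i) - 1 / 2
      - (face_offset s t (rot (rot (rot (inv' w 6)))) - face_offset t s (inv' w 6) - 1 / 2) \<in> \<int>"
      by (intro Ints_diff step in6)
    then show "face_offset s t (rot (rot (rot (inv' w i)))) - face_offset s t (rot (rot (rot (inv' w 6))))
      - (face_offset t s (inv' w i) - face_offset t s (inv' w 6)) \<in> \<int>"
      by (simp add: algebra_simps)
  qed
qed

text \<open>The two angle functions differ by the constant \<open>s / 6\<close>:
  \<open>offset\<close> starts at position 1, \<open>face_offset\<close> midway between positions 1
  and 2.\<close>

lemma face_point_eq_place:
  assumes w: "w permutes {1..6}" and st: "0 \<le> s" "0 \<le> t"
  shows "face_point p w s t = place p w (book s t)"
proof -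
  have step: "face_offset s t k - offset (book s t) k = - s / 6" if "k \<in> {1..6}" for k
    using that st unfolding positions_eq
    by (elim insertE emptyE) (simp_all add: face_offset_def book_def field_simps)
  show ?thesis
    unfolding face_point_def place_def config_eq_iff[OF p]
  proof
    fix i :: nat assume i: "i \<in> {1..6}"
    have in6: "inv' w i \<in> {1..6}" "inv' w 6 \<in> {1..6}"
      using permutes_in_image[OF permutes_inv[OF w]] i by simp_all
    have "face_offset s t (inv' w i) - face_offset s t (inv' w 6)
      - (offset (book s t) (inv' w i) - offset (book s t) (inv' w 6)) = 0"
      using step[OF in6(1)] step[OF in6(2)] by linarith
    then show "face_offset s t (inv' w i) - face_offset s t (inv' w 6)
      - (offset (book s t) (inv' w i) - offset (book s t) (inv' w 6)) \<in> \<int>"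
      by (simp only: Ints_0)
  qed
qed

text \<open>Negative coordinates become positive when the labels at positions 1, 2 or 4, 5 are
  exchanged; the four quadrants are the four triangles around the third corner.\<close>

lemma face_point_quadrant:
  assumes w: "w permutes {1..6}"
  obtains w' where "w' permutes {1..6}" "face_point p w s t = place p w' (book \<bar>s\<bar> \<bar>t\<bar>)"
    "w' \<in> {w, w \<circ> Transposition.transpose 1 2, w \<circ> Transposition.transpose 4 5,
      w \<circ> Transposition.transpose 1 2 \<circ> Transposition.transpose 4 5}"
proof -
  consider "0 \<le> s" "0 \<le> t" | "s \<le> 0" "0 \<le> t" | "0 \<le> s" "t \<le> 0" | "s \<le> 0" "t \<le> 0" by linarith
  then show ?thesis
  proof cases
    case 1
    then show ?thesis using that[of w] face_point_eq_place[OF w 1] w by simp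
  next
    case 2
    then show ?thesis
      using that[of "w \<circ> Transposition.transpose 1 2"] face_point_swap12[OF w, of "- s" t]
        face_point_eq_place[OF swap12_compose[OF w], of "- s" t] swap12_compose[OF w] by simp
  next
    case 3
    then show ?thesis
      using that[of "w \<circ> Transposition.transpose 4 5"] face_point_swap45[OF w, of s "- t"]
        face_point_eq_place[OF swap45_compose[OF w], of s "- t"] swap45_compose[OF w] by simp
  next
    case 4
    then show ?thesis
      using that[of "w \<circ> Transposition.transpose 1 2 \<circ> Transposition.transpose 4 5"]
        face_point_swap45[OF swap12_compose[OF w], of "- s" "- t"] face_point_swap12[OF w, of "- s" t]
        face_point_eq_place[OF swap45_compose[OF swap12_compose[OF w]], of "- s" "- t"]
        swap45_compose[OF swap12_compose[OF w]] by simp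
  qed
qed

end

text \<open>An interior point of a chart is a \<open>book\<close> configuration on which
  \<open>label\<close> takes the value prescribed for the cell, and \<open>label\<close> depends on
  the configuration alone.\<close>

lemma (in cell_label) chart_label:
  assumes p: "p \<in> circle" and w: "w permutes {1..6}" "w' permutes {1..6}"
    and k: "k \<le> 2" "k' \<le> 2" and x: "x \<in> open_cube k" "x' \<in> open_cube k'"
    and eq: "chart p k w x = chart p k' w' x'"
  shows "(if k = 0 then fV w else if k = 1 then fE w else fF w)
    = (if k' = 0 then fV w' else if k' = 1 then fE w' else fF w')"
proof -
  have *: "\<exists>v a b. v permutes {1..6} \<and> 0 \<le> a \<and> 0 \<le> b \<and> a + b \<le> 1 \<and> chart p k w x = place p v (book a b)
      \<and> label v (book a b) = (if k = 0 then fV w else if k = 1 then fE w else fF w)"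
    if w: "w permutes {1..6}" and k: "k \<le> 2" and x: "x \<in> open_cube k" for w k x
  proof -
    consider "k = 0" | "k = 1" | "k = 2" using k by linarith
    then show ?thesis
    proof cases
      case 1
      then show ?thesis
        using w by (intro exI[of _ w] exI[of _ 0] exI[of _ 1]) (simp add: label_book)
    next
      case 2
      then have "0 < x 0" "x 0 < 1" using x by (auto simp: open_cube_def)
      then show ?thesis
        using w 2 by (intro exI[of _ w] exI[of _ "x 0"] exI[of _ "1 - x 0"]) (simp add: label_book)
    next
      case 3
      define s t where "s = x 0 - x 1" and "t = 1 - x 0 - x 1"
      have "0 < x 0" "x 0 < 1" "0 < x 1" "x 1 < 1" using x 3 by (auto simp: open_cube_def)
      then have st: "\<bar>s\<bar> + \<bar>t\<bar> < 1" unfolding s_def t_def by linarith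
      obtain v where v: "v permutes {1..6}" "face_point p w s t = place p v (book \<bar>s\<bar> \<bar>t\<bar>)"
        "v \<in> {w, w \<circ> Transposition.transpose 1 2, w \<circ> Transposition.transpose 4 5,
          w \<circ> Transposition.transpose 1 2 \<circ> Transposition.transpose 4 5}"
        by (rule face_point_quadrant[OF p w])
      have "fF v = fF w"
        using v(3) fF_swap[OF w] fF_swap45[OF w] fF_swap45[OF swap12_compose[OF w]] by auto
      then show ?thesis
        using v(1,2) st 3 by (intro exI[of _ v] exI[of _ "\<bar>s\<bar>"] exI[of _ "\<bar>t\<bar>"])
          (simp add: label_book s_def t_def)
    qed
  qed
  obtain v a b where v: "v permutes {1..6}" "0 \<le> a" "0 \<le> b" "a + b \<le> 1" "chart p k w x = place p v (book a b)"
    "label v (book a b) = (if k = 0 then fV w else if k = 1 then fE w else fF w)"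
    using *[OF w(1) k(1) x(1)] by blast
  obtain v' a' b' where v': "v' permutes {1..6}" "0 \<le> a'" "0 \<le> b'" "a' + b' \<le> 1"
    "chart p k' w' x' = place p v' (book a' b')"
    "label v' (book a' b') = (if k' = 0 then fV w' else if k' = 1 then fE w' else fF w')"
    using *[OF w(2) k(2) x(2)] by blast
  have "label v (book a b) = label v' (book a' b')"
    by (rule factors_through_place[OF p v(1) book_gaps[OF v(2-4)] v'(1) book_gaps[OF v'(2-4)]])
      (use eq v(5) v'(5) in simp)
  then show ?thesis using v(6) v'(6) by simp
qed

section \<open>Cube symmetries and charts up to reparametrization\<close>

lemma cube_symmetry_id: "cube_symmetry n (\<lambda>x. x)"
  unfolding cube_symmetry_def by (intro exI[of _ id] exI[of _ "{}"]) (simp add: permutes_id)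

lemma cube_symmetry_mem:
  assumes h: "cube_symmetry n h" and x: "x \<in> unit_cube n"
  shows "h x \<in> unit_cube n" "x \<in> open_cube n \<Longrightarrow> h x \<in> open_cube n"
proof -
  obtain \<sigma> F where \<sigma>: "\<sigma> permutes {..<n}" and F: "F \<subseteq> {..<n}"
    and hx: "h x = (\<lambda>i. if i \<in> F then 1 - x (\<sigma> i) else x (\<sigma> i))"
    using h x unfolding cube_symmetry_def by blast
  have in': "\<sigma> i < n" if "i < n" for i
    using permutes_in_image[OF \<sigma>, of i] that by simp
  have out: "\<sigma> i = i" "i \<notin> F" if "\<not> i < n" for i
    using permutes_not_in[OF \<sigma>, of i] F that by auto
  show "h x \<in> unit_cube n"
    using x in' out unfolding hx unit_cube_def by (auto simp: not_less[symmetric])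
  show "h x \<in> open_cube n" if "x \<in> open_cube n"
    using that in' out unfolding hx open_cube_def by (auto simp: not_less[symmetric])
qed

text \<open>Two flips of the same coordinate cancel, so the flipped coordinates of the composite
  form a symmetric difference.\<close>

lemma cube_symmetry_comp:
  assumes h: "cube_symmetry n h" and h': "cube_symmetry n h'"
  shows "cube_symmetry n (\<lambda>x. h (h' x))"
proof -
  obtain \<sigma> F where \<sigma>: "\<sigma> permutes {..<n}" and F: "F \<subseteq> {..<n}"
    and hx: "\<And>x. x \<in> unit_cube n \<Longrightarrow> h x = (\<lambda>i. if i \<in> F then 1 - x (\<sigma> i) else x (\<sigma> i))"
    using h unfolding cube_symmetry_def by blast
  obtain \<tau> F' where \<tau>: "\<tau> permutes {..<n}" and F': "F' \<subseteq> {..<n}"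
    and hx': "\<And>x. x \<in> unit_cube n \<Longrightarrow> h' x = (\<lambda>i. if i \<in> F' then 1 - x (\<tau> i) else x (\<tau> i))"
    using h' unfolding cube_symmetry_def by blast
  let ?F = "{i \<in> {..<n}. (i \<in> F) \<noteq> (\<sigma> i \<in> F')}"
  have out: "i \<notin> F \<and> \<sigma> i \<notin> F'" if "\<not> i < n" for i
    using permutes_not_in[OF \<sigma>, of i] F F' that by auto
  have "h (h' x) = (\<lambda>i. if i \<in> ?F then 1 - x ((\<tau> \<circ> \<sigma>) i) else x ((\<tau> \<circ> \<sigma>) i))" if "x \<in> unit_cube n" for x
    using hx[OF cube_symmetry_mem(1)[OF h' that]] out unfolding hx'[OF that] by (auto simp: fun_eq_iff)
  then show ?thesis
    unfolding cube_symmetry_def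
    by (intro exI[of _ "\<tau> \<circ> \<sigma>"] exI[of _ ?F]) (auto simp: permutes_compose[OF \<sigma> \<tau>])
qed

lemma cube_symmetry_flip: "0 < n \<Longrightarrow> cube_symmetry n (\<lambda>x i. if i = 0 then 1 - x 0 else x i)"
  unfolding cube_symmetry_def
  by (intro exI[of _ id] exI[of _ "{0}"]) (auto simp: permutes_id fun_eq_iff)

lemma cube_symmetry_transpose: "cube_symmetry 2 (\<lambda>x i. x (Transposition.transpose 0 1 i))"
proof -
  have "Transposition.transpose 0 1 permutes {..<2::nat}"
    by (rule permutes_swap_id) auto
  then show ?thesis
    unfolding cube_symmetry_def
    by (intro exI[of _ "Transposition.transpose 0 1"] exI[of _ "{}"]) simp
qed

lemma open_cube_subset: "open_cube n \<subseteq> unit_cube n"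
  by (auto simp: open_cube_def unit_cube_def intro: less_imp_le)

lemma open_cube_nonempty: "(\<lambda>i. if i < n then 1 / 2 else 0) \<in> open_cube n"
  by (auto simp: open_cube_def)

text \<open>Serves as a cell label in its own right: equal orbits mean that two charts differ by a
  cube symmetry. The restriction turns agreement on the cube into equality of functions.\<close>

definition chart_orbit :: "complex \<Rightarrow> nat \<Rightarrow> (nat \<Rightarrow> nat) \<Rightarrow> ((nat \<Rightarrow> real) \<Rightarrow> nat \<Rightarrow> complex) set" where
  "chart_orbit p k w = {restrict (\<lambda>x. chart p k w (h x)) (unit_cube k) | h. cube_symmetry k h}"

lemma chart_orbit_subset:
  assumes q: "cube_symmetry k q" and eq: "\<And>x. x \<in> unit_cube k \<Longrightarrow> chart p k w' x = chart p k w (q x)"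
  shows "chart_orbit p k w' \<subseteq> chart_orbit p k w"
proof
  fix f assume "f \<in> chart_orbit p k w'"
  then obtain h where h: "cube_symmetry k h" and f: "f = restrict (\<lambda>x. chart p k w' (h x)) (unit_cube k)"
    unfolding chart_orbit_def by blast
  have "f = restrict (\<lambda>x. chart p k w (q (h x))) (unit_cube k)"
    unfolding f by (rule restrict_ext) (rule eq[OF cube_symmetry_mem(1)[OF h]])
  then show "f \<in> chart_orbit p k w"
    unfolding chart_orbit_def using cube_symmetry_comp[OF q h]
    by (intro CollectI exI[of _ "\<lambda>x. q (h x)"] conjI)
qed

lemma chart_orbit_eqD:
  assumes "chart_orbit p k w' = chart_orbit p k w"
  obtains h where "cube_symmetry k h" "\<And>x. x \<in> unit_cube k \<Longrightarrow> chart p k w' x = chart p k w (h x)"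
proof -
  have "restrict (\<lambda>x. chart p k w' x) (unit_cube k) \<in> chart_orbit p k w"
    unfolding assms[symmetric] unfolding chart_orbit_def
    by (intro CollectI exI[of _ "\<lambda>x. x"] conjI cube_symmetry_id refl)
  then obtain h where h: "cube_symmetry k h"
    "restrict (\<lambda>x. chart p k w' x) (unit_cube k) = restrict (\<lambda>x. chart p k w (h x)) (unit_cube k)"
    unfolding chart_orbit_def by blast
  have "chart p k w' x = chart p k w (h x)" if "x \<in> unit_cube k" for x
    using fun_cong[OF h(2), of x] that by simp
  then show ?thesis using that h(1) by blast
qed

lemma book_rot: "book x (1 - x) \<circ> rot = book (1 - x) x"
proof
  fix k :: nat
  show "(book x (1 - x) \<circ> rot) k = book (1 - x) x k"
  proof (cases "k \<in> {1..6}")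
    case True
    then show ?thesis
      unfolding positions_eq by (elim insertE emptyE) (simp_all add: book_def)
  next
    case False
    then have "k \<notin> {1, 2, 3, 4, 5, 6}" by auto
    then show ?thesis by (simp add: rot_outside[OF False] book_def)
  qed
qed

context
  fixes p :: complex
  assumes p: "p \<in> circle"
begin

lemma vertex_rot:
  assumes w: "w permutes {1..6}"
  shows "place p (w \<circ> rot) (book 1 0) = place p w (book 0 1)"
    "place p (w \<circ> rot) (book 0 1) = place p w (book 1 0)"
  using place_rot[OF p w book_gaps[of 0 1]] place_rot[OF p w book_gaps[of 1 0]] book_rot[of 0] book_rot[of 1]
  by simp_all

lemma edge_rot:
  assumes w: "w permutes {1..6}" and x: "0 \<le> x" "x \<le> 1"
  shows "place p (w \<circ> rot) (book x (1 - x)) = place p w (book (1 - x) x)"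
  using place_rot[OF p w book_gaps[of "1 - x" x]] book_rot[of "1 - x"] x by simp

text \<open>The leading numeral keeps dimensions apart. A rotation flips an edge; on a square, three
  rotations flip coordinate 0, and exchanging positions 1 and 2 transposes the coordinates.\<close>

lemma cell_label_chart_orbit:
  "cell_label (\<lambda>w. (0::nat, chart_orbit p 0 w)) (\<lambda>w. (1, chart_orbit p 1 w)) (\<lambda>w. (2, chart_orbit p 2 w))"
proof
  fix w :: "nat \<Rightarrow> nat" assume w: "w permutes {1..6}"
  note w1 = rot_compose[OF w]
  note w2 = rot_compose[OF w1]
  note w3 = rot_compose[OF w2]
  note ws = swap12_compose[OF w]
  have "chart_orbit p 0 (w \<circ> rot \<circ> rot) = chart_orbit p 0 w"
    unfolding chart_orbit_def chart_simps vertex_rot[OF w] vertex_rot[OF w1] ..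
  then show "(0::nat, chart_orbit p 0 (w \<circ> rot \<circ> rot)) = (0, chart_orbit p 0 w)" by simp
  have "place p (w \<circ> Transposition.transpose 1 2) (book 0 1) = place p w (book 0 1)"
    by (rule place_swap[OF p w]) (simp add: book_def)
  then show "(0::nat, chart_orbit p 0 (w \<circ> Transposition.transpose 1 2)) = (0, chart_orbit p 0 w)"
    by (simp add: chart_orbit_def)
  have "chart_orbit p 1 (w \<circ> rot) = chart_orbit p 1 w"
  proof (rule equalityI; rule chart_orbit_subset[OF cube_symmetry_flip])
    fix x assume "x \<in> unit_cube 1"
    then have "0 \<le> x 0" "x 0 \<le> 1" by (auto simp: unit_cube_def)
    then show "chart p 1 (w \<circ> rot) x = chart p 1 w (\<lambda>i. if i = 0 then 1 - x 0 else x i)"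
      "chart p 1 w x = chart p 1 (w \<circ> rot) (\<lambda>i. if i = 0 then 1 - x 0 else x i)"
      using edge_rot[OF w, of "x 0"] edge_rot[OF w, of "1 - x 0"] by simp_all
  qed simp_all
  then show "(1::nat, chart_orbit p 1 (w \<circ> rot)) = (1, chart_orbit p 1 w)" by simp
  have "chart_orbit p 2 (w \<circ> rot \<circ> rot \<circ> rot) = chart_orbit p 2 w"
  proof (rule equalityI; rule chart_orbit_subset[OF cube_symmetry_flip])
    fix x :: "nat \<Rightarrow> real"
    show "chart p 2 (w \<circ> rot \<circ> rot \<circ> rot) x = chart p 2 w (\<lambda>i. if i = 0 then 1 - x 0 else x i)"
      "chart p 2 w x = chart p 2 (w \<circ> rot \<circ> rot \<circ> rot) (\<lambda>i. if i = 0 then 1 - x 0 else x i)"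
      by (simp_all add: face_point_rot3[OF p w])
  qed simp_all
  then show "(2::nat, chart_orbit p 2 (w \<circ> rot \<circ> rot \<circ> rot)) = (2, chart_orbit p 2 w)" by simp
  have "chart_orbit p 2 (w \<circ> Transposition.transpose 1 2) = chart_orbit p 2 w"
  proof (rule equalityI; rule chart_orbit_subset[OF cube_symmetry_transpose])
    fix x :: "nat \<Rightarrow> real"
    show "chart p 2 (w \<circ> Transposition.transpose 1 2) x = chart p 2 w (\<lambda>i. x (Transposition.transpose 0 1 i))"
      "chart p 2 w x = chart p 2 (w \<circ> Transposition.transpose 1 2) (\<lambda>i. x (Transposition.transpose 0 1 i))"
      by (simp_all add: face_point_swap12[OF p w] algebra_simps)
  qed
  then show "(2::nat, chart_orbit p 2 (w \<circ> Transposition.transpose 1 2)) = (2, chart_orbit p 2 w)" by simp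
qed

text \<open>With orbits as labels, one use of \<open>chart_label\<close> yields both the
  disjointness of different open cells and the compatibility of all charts of the same cell.\<close>

lemma chart_meet:
  assumes "w permutes {1..6}" "w' permutes {1..6}" "k \<le> 2" "k' \<le> 2"
    and "x \<in> open_cube k" "x' \<in> open_cube k'" "chart p k w x = chart p k' w' x'"
  shows "k = k'" "chart_orbit p k w = chart_orbit p k' w'"
proof -
  have k: "k = 0 \<or> k = 1 \<or> k = 2" "k' = 0 \<or> k' = 1 \<or> k' = 2"
    using assms(3,4) by linarith+
  note label = cell_label.chart_label[OF cell_label_chart_orbit p assms]
  show kk: "k = k'"
    using label k by (elim disjE) simp_all
  show "chart_orbit p k w = chart_orbit p k' w'"
    using label k(1) unfolding kk[symmetric] by (elim disjE) simp_all
qed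

section \<open>Boundary, injectivity and continuity of charts\<close>

lemma edge_face:
  assumes w: "w permutes {1..6}" and \<epsilon>: "\<epsilon> \<in> {0, 1}"
  obtains w' where "w' permutes {1..6}"
    "\<And>x. x \<in> unit_cube 0 \<Longrightarrow> chart p 1 w (face_inclusion 0 \<epsilon> x) = chart p 0 w' x"
proof -
  have "\<exists>w'. w' permutes {1..6} \<and> place p w (book \<epsilon> (1 - \<epsilon>)) = place p w' (book 0 1)"
  proof (cases "\<epsilon> = 0")
    case True
    then show ?thesis using w by (intro exI[of _ w]) simp
  next
    case False
    then show ?thesis
      using \<epsilon> rot_compose[OF w] vertex_rot(2)[OF w] by (intro exI[of _ "w \<circ> rot"]) simp
  qed
  then show ?thesis using that by (auto simp: face_inclusion_def)
qed

text \<open>Each side of the diamond lies in one quadrant and is an edge for the permutation of that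
  quadrant. A flip occurs on the two sides with \<open>\<epsilon> = 1\<close>, where the parameter
  runs against \<open>book\<close>.\<close>

lemma square_face:
  assumes w: "w permutes {1..6}" and i: "i < 2" and \<epsilon>: "\<epsilon> \<in> {0, 1}"
  obtains w' h where "w' permutes {1..6}" "cube_symmetry 1 h"
    "\<And>x. x \<in> unit_cube 1 \<Longrightarrow> chart p 2 w (face_inclusion i \<epsilon> x) = chart p 1 w' (h x)"
proof -
  let ?id = "\<lambda>x :: nat \<Rightarrow> real. x" and ?flip = "\<lambda>x i. if i = 0 then 1 - x 0 else (x i :: real)"
  let ?s = "w \<circ> Transposition.transpose 1 2" and ?t = "w \<circ> Transposition.transpose 4 5"
  let ?st = "?s \<circ> Transposition.transpose 4 5"
  note s = swap12_compose[OF w] and t = swap45_compose[OF w] and st = swap45_compose[OF swap12_compose[OF w]]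
  have range: "0 \<le> x 0 \<and> x 0 \<le> 1" if "x \<in> unit_cube 1" for x
    using that by (auto simp: unit_cube_def)
  have flip: "cube_symmetry 1 ?flip" by (rule cube_symmetry_flip) simp
  consider "i = 0" "\<epsilon> = 0" | "i = 0" "\<epsilon> = 1" | "i = 1" "\<epsilon> = 0" | "i = 1" "\<epsilon> = 1"
    using i \<epsilon> by force
  then show ?thesis
  proof cases
    case 1
    have "chart p 2 w (face_inclusion i \<epsilon> x) = chart p 1 ?s (?id x)" if "x \<in> unit_cube 1" for x
      using 1 range[OF that] face_point_swap12[OF p w, of "x 0" "1 - x 0"] face_point_eq_place[OF p s, of "x 0" "1 - x 0"]
      by (simp add: face_inclusion_def)
    then show ?thesis using that s cube_symmetry_id by blast
  next
    case 2
    have "chart p 2 w (face_inclusion i \<epsilon> x) = chart p 1 ?t (?flip x)" if "x \<in> unit_cube 1" for x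
      using 2 range[OF that] face_point_swap45[OF p w, of "1 - x 0" "x 0"] face_point_eq_place[OF p t, of "1 - x 0" "x 0"]
      by (simp add: face_inclusion_def)
    then show ?thesis using that t flip by blast
  next
    case 3
    have "chart p 2 w (face_inclusion i \<epsilon> x) = chart p 1 w (?id x)" if "x \<in> unit_cube 1" for x
      using 3 range[OF that] face_point_eq_place[OF p w, of "x 0" "1 - x 0"]
      by (simp add: face_inclusion_def)
    then show ?thesis using that w cube_symmetry_id by blast
  next
    case 4
    have "chart p 2 w (face_inclusion i \<epsilon> x) = chart p 1 ?st (?flip x)" if "x \<in> unit_cube 1" for x
      using 4 range[OF that] face_point_swap45[OF p s, of "1 - x 0" "x 0"] face_point_swap12[OF p w, of "1 - x 0" "- x 0"]
        face_point_eq_place[OF p st, of "1 - x 0" "x 0"]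
      by (simp add: face_inclusion_def)
    then show ?thesis using that st flip by blast
  qed
qed

lemma edge_boundary:
  assumes w: "w permutes {1..6}" and x: "x \<in> unit_cube 1" "x \<notin> open_cube 1"
  obtains w' y where "w' permutes {1..6}" "y \<in> open_cube 0" "chart p 1 w x = chart p 0 w' y"
proof -
  have x0: "x 0 \<in> {0, 1}"
    using x by (auto simp: unit_cube_def open_cube_def)
  obtain w' where w': "w' permutes {1..6}"
    "\<And>y. y \<in> unit_cube 0 \<Longrightarrow> chart p 1 w (face_inclusion 0 (x 0) y) = chart p 0 w' y"
    by (rule edge_face[OF w x0]) blast
  have "(\<lambda>_. 0) \<in> open_cube 0" "(\<lambda>_. 0) \<in> unit_cube 0" by (auto simp: open_cube_def unit_cube_def)
  moreover have "chart p 1 w (face_inclusion 0 (x 0) (\<lambda>_. 0)) = chart p 1 w x"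
    by (simp add: face_inclusion_def)
  ultimately show ?thesis using that[of w' "\<lambda>_. 0"] w' by metis
qed

lemma chart_in_open_cell:
  assumes w: "w permutes {1..6}" and k: "k \<le> 2" and x: "x \<in> unit_cube k"
  obtains k' w' y where "k' \<le> k" "x \<notin> open_cube k \<Longrightarrow> k' < k" "w' permutes {1..6}" "y \<in> open_cube k'"
    "chart p k w x = chart p k' w' y"
proof (cases "x \<in> open_cube k")
  case True
  then show ?thesis using that[of k w x] w by simp
next
  case False
  have edge: "\<exists>k' w' y. k' \<le> 1 \<and> w' permutes {1..6} \<and> y \<in> open_cube k' \<and> chart p 1 w x = chart p k' w' y"
    if w: "w permutes {1..6}" and x: "x \<in> unit_cube 1" for w x
  proof (cases "x \<in> open_cube 1")
    case True
    then show ?thesis using w by blast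
  next
    case False
    obtain w' y where "w' permutes {1..6}" "y \<in> open_cube 0" "chart p 1 w x = chart p 0 w' y"
      by (rule edge_boundary[OF w x False])
    then show ?thesis by (intro exI[of _ 0]) auto
  qed
  consider "k = 0" | "k = 1" | "k = 2" using k by linarith
  then show ?thesis
  proof cases
    case 1
    then show ?thesis using x False by (simp add: unit_cube_def open_cube_def)
  next
    case 2
    then obtain w' y where "w' permutes {1..6}" "y \<in> open_cube 0" "chart p 1 w x = chart p 0 w' y"
      using edge_boundary[OF w] x False by metis
    then show ?thesis using that[of 0 w' y] 2 by simp
  next
    case 3
    obtain i where i: "i < 2" "x i \<in> {0, 1}"
      using x False 3 by (auto simp: unit_cube_def open_cube_def not_less le_less)
    \<comment> \<open>Coordinate \<open>i\<close> is 0 or 1; the other one, with index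
      \<open>1 - i\<close>, parametrizes the side.\<close>
    define y where "y = (\<lambda>j :: nat. if j = 0 then x (1 - i) else 0)"
    have y: "y \<in> unit_cube 1"
      using x 3 i by (auto simp: y_def unit_cube_def)
    have i01: "i = 0 \<or> i = 1" using i by linarith
    have "face_inclusion i (x i) y 0 = x 0" "face_inclusion i (x i) y 1 = x 1"
      using i01 by (auto simp: face_inclusion_def y_def)
    then have eq: "chart p 2 w (face_inclusion i (x i) y) = chart p 2 w x" by simp
    obtain w' h where w': "w' permutes {1..6}" "cube_symmetry 1 h"
      "\<And>x'. x' \<in> unit_cube 1 \<Longrightarrow> chart p 2 w (face_inclusion i (x i) x') = chart p 1 w' (h x')"
      by (rule square_face[OF w i]) blast
    from edge[OF w'(1) cube_symmetry_mem(1)[OF w'(2) y]]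
    obtain k' w'' y' where "k' \<le> 1" "w'' permutes {1..6}" "y' \<in> open_cube k'" "chart p 1 w' (h y) = chart p k' w'' y'"
      by blast
    then show ?thesis using that[of k' w'' y'] w'(3)[OF y] eq 3 by simp
  qed
qed

lemma Ints_third_eq:
  fixes a b :: real
  assumes "a / 3 - b / 3 \<in> \<int>" "\<bar>a - b\<bar> < 3"
  shows "a = b"
proof -
  have "\<bar>a / 3 - b / 3\<bar> < 1" using assms(2) by linarith
  then have "a / 3 - b / 3 = 0" using assms(1) Ints_nonzero_abs_less1 by blast
  then show ?thesis by simp
qed

lemma config_eqD:
  assumes "config p \<theta> = config p \<theta>'" "i \<in> {1..6}" "j \<in> {1..6}"
  shows "(\<theta> i - \<theta> j) - (\<theta>' i - \<theta>' j) \<in> \<int>"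
proof -
  have "((\<theta> i - \<theta> 6) - (\<theta>' i - \<theta>' 6)) - ((\<theta> j - \<theta> 6) - (\<theta>' j - \<theta>' 6)) \<in> \<int>"
    using assms unfolding config_eq_iff[OF p] by (intro Ints_diff[of "(\<theta> i - \<theta> 6) - (\<theta>' i - \<theta>' 6)"]) blast+
  then show ?thesis by (simp add: algebra_simps)
qed

text \<open>The angle from position 1 to 2 is \<open>s / 3\<close> and that from 4 to 5 is
  \<open>t / 3\<close>; on an edge the first one is \<open>x 0 / 3\<close>. Such angles are too
  small for a full turn to cause ambiguity.\<close>

lemma inj_on_chart:
  assumes w: "w permutes {1..6}" and k: "k \<le> 2"
  shows "inj_on (chart p k w) (unit_cube k)"
proof (rule inj_onI)
  fix x y assume x: "x \<in> unit_cube k" and y: "y \<in> unit_cube k" and eq: "chart p k w x = chart p k w y"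
  have in6: "w a \<in> {1..6}" if "a \<in> {1..6}" for a
    using permutes_in_image[OF w] that by blast
  consider "k = 0" | "k = 1" | "k = 2" using k by linarith
  then show "x = y"
  proof cases
    case 1
    then show ?thesis using x y by (auto simp: unit_cube_def)
  next
    case 2
    have "config p (\<lambda>i. offset (book (x 0) (1 - x 0)) (inv' w i)) = config p (\<lambda>i. offset (book (y 0) (1 - y 0)) (inv' w i))"
      using eq 2 by (simp add: place_def)
    from config_eqD[OF this in6[of 2] in6[of 1]] have "x 0 / 3 - y 0 / 3 \<in> \<int>"
      unfolding permutes_inverses(2)[OF w] by (simp add: book_def)
    then have "x 0 = y 0"
      using x y 2 by (intro Ints_third_eq) (auto simp: unit_cube_def abs_real_def)
    then show ?thesis
      using x y 2 by (auto simp: unit_cube_def fun_eq_iff) (metis less_one not_less)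
  next
    case 3
    have range: "0 \<le> x 0" "x 0 \<le> 1" "0 \<le> x 1" "x 1 \<le> 1" "0 \<le> y 0" "y 0 \<le> 1" "0 \<le> y 1" "y 1 \<le> 1"
      using x y 3 by (auto simp: unit_cube_def)
    let ?s = "x 0 - x 1" and ?t = "1 - x 0 - x 1" and ?s' = "y 0 - y 1" and ?t' = "1 - y 0 - y 1"
    have eq': "config p (\<lambda>i. face_offset ?s ?t (inv' w i)) = config p (\<lambda>i. face_offset ?s' ?t' (inv' w i))"
      using eq 3 by (simp add: face_point_def)
    have diff: "face_offset a b 2 - face_offset a b 1 - (face_offset a' b' 2 - face_offset a' b' 1) = a / 3 - a' / 3"
      "face_offset a b 5 - face_offset a b 4 - (face_offset a' b' 5 - face_offset a' b' 4) = b / 3 - b' / 3"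
      for a b a' b'
      by (simp_all add: face_offset_def)
    have "?s / 3 - ?s' / 3 \<in> \<int>"
      using config_eqD[OF eq' in6[of 2] in6[of 1]] unfolding permutes_inverses(2)[OF w] diff by simp
    then have s: "?s = ?s'"
      using range by (intro Ints_third_eq) (auto simp: abs_real_def)
    have "?t / 3 - ?t' / 3 \<in> \<int>"
      using config_eqD[OF eq' in6[of 5] in6[of 4]] unfolding permutes_inverses(2)[OF w] diff by simp
    then have t: "?t = ?t'"
      using range by (intro Ints_third_eq) (auto simp: abs_real_def)
    have "x 0 = y 0" "x 1 = y 1" using s t by linarith+
    moreover have "x i = y i" if "2 \<le> i" for i
      using x y 3 that by (auto simp: unit_cube_def)
    ultimately have "x i = y i" for i
      using less_2_cases[of i] by (cases "2 \<le> i") (auto simp: One_nat_def)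
    then show ?thesis by blast
  qed
qed

lemma continuous_map_chart: "continuous_map (top_of_set S) (torus 6) (chart p k w)"
proof -
  consider "k = 0" | "k = 1" | "k \<noteq> 0" "k \<noteq> 1" by blast
  then show ?thesis
  proof cases
    case 1
    then show ?thesis
      unfolding chart_def[abs_def] using place_in_torus[OF p] by simp
  next
    case 2
    have "continuous_on S (\<lambda>x. book (x 0) (1 - x 0) j)" for j
      unfolding book_def
      by (cases "j \<in> {1..6}") (auto simp: positions_eq intro!: continuous_intros continuous_on_coordinate)
    then have "continuous_map (top_of_set S) (torus 6) (\<lambda>x. place p w (book (x 0) (1 - x 0)))"
      unfolding place_def offset_def by (intro continuous_map_config[OF p] continuous_on_sum)
    then show ?thesis
      using 2 by (simp add: chart_def[abs_def])
  next
    case 3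
    have "continuous_on S (\<lambda>x. face_offset (x 0 - x 1) (1 - x 0 - x 1) j)" for j
      unfolding face_offset_def
      by (cases "j = 1"; cases "j = 2"; cases "j = 3"; cases "j = 4"; cases "j = 5")
        (auto intro!: continuous_intros continuous_on_coordinate)
    then have "continuous_map (top_of_set S) (torus 6) (\<lambda>x. face_point p w (x 0 - x 1) (1 - x 0 - x 1))"
      unfolding face_point_def by (intro continuous_map_config[OF p])
    then show ?thesis
      using 3 by (simp add: chart_def[abs_def])
  qed
qed

lemma chart_eq_book:
  assumes w: "w permutes {1..6}" and k: "k \<le> 2" and x: "x \<in> unit_cube k"
  obtains w' a b where "w' permutes {1..6}" "0 \<le> a" "0 \<le> b" "a + b \<le> 1" "chart p k w x = place p w' (book a b)"
proof -
  consider "k = 0" | "k = 1" | "k = 2" using k by linarith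
  then show ?thesis
  proof cases
    case 1
    then show ?thesis using that[of w 0 1] w by simp
  next
    case 2
    then show ?thesis using that[of w "x 0" "1 - x 0"] w x by (simp add: unit_cube_def)
  next
    case 3
    define s t where "s = x 0 - x 1" and "t = 1 - x 0 - x 1"
    have "0 \<le> x 0" "x 0 \<le> 1" "0 \<le> x 1" "x 1 \<le> 1" using x 3 by (auto simp: unit_cube_def)
    then have st: "\<bar>s\<bar> + \<bar>t\<bar> \<le> 1" unfolding s_def t_def by linarith
    obtain v where "v permutes {1..6}" "face_point p w s t = place p v (book \<bar>s\<bar> \<bar>t\<bar>)"
      by (rule face_point_quadrant[OF p w])
    then show ?thesis using that[of v "\<bar>s\<bar>" "\<bar>t\<bar>"] st 3 by (simp add: s_def t_def)
  qed
qed

lemma book_eq_chart: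
  assumes w: "w permutes {1..6}" and ab: "0 \<le> a" "0 \<le> b" "a + b \<le> 1"
  obtains x where "x \<in> unit_cube 2" "place p w (book a b) = chart p 2 w x"
proof -
  define x :: "nat \<Rightarrow> real" where
    "x i = (if i = 0 then (1 + a - b) / 2 else if i = 1 then (1 - a - b) / 2 else 0)" for i
  have "x \<in> unit_cube 2"
    using ab by (auto simp: unit_cube_def x_def)
  moreover have "x 0 - x 1 = a" "1 - x 0 - x 1 = b"
    by (simp_all add: x_def field_simps)
  ultimately show ?thesis
    using that[of x] face_point_eq_place[OF p w ab(1,2)] by simp
qed

end

subsection \<open>The cubical complex\<close>

text \<open>Interleaves real and imaginary parts, which moves the complex into
  \<open>nat \<Rightarrow> real\<close>, the point type of the final statement;
  \<open>of_coords\<close> undoes this on the torus.\<close>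

definition to_coords :: "(nat \<Rightarrow> complex) \<Rightarrow> nat \<Rightarrow> real" where
  "to_coords x n = (if n div 2 \<in> {1..5} then (if even n then Re (x (n div 2)) else Im (x (n div 2))) else 0)"

definition of_coords :: "(nat \<Rightarrow> real) \<Rightarrow> nat \<Rightarrow> complex" where
  "of_coords z = restrict (\<lambda>i. Complex (z (2 * i)) (z (2 * i + 1))) {1..5}"

lemma of_coords_to_coords: "x \<in> topspace (torus 6) \<Longrightarrow> of_coords (to_coords x) = x"
  by (auto simp: fun_eq_iff of_coords_def to_coords_def torus_topspace PiE_iff extensional_def complex_eq_iff)

lemma continuous_map_to_fun:
  "continuous_map X euclidean f \<longleftrightarrow> (\<forall>i. continuous_map X euclideanreal (\<lambda>x. f x (i::nat)))"
  using continuous_map_componentwise_UNIV[of X "\<lambda>_. euclideanreal" f] by (simp add: euclidean_product_topology)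

lemma continuous_map_torus_coordinate:
  assumes "i \<in> {1..5}"
  shows "continuous_map (torus 6) euclidean (\<lambda>x. x i)"
proof -
  have "continuous_map (torus 6) (top_of_set circle) (\<lambda>x. x i)"
    unfolding torus_def using assms by (intro continuous_map_product_projection) auto
  then show ?thesis by (simp add: continuous_map_in_subtopology)
qed

lemma continuous_map_to_coords: "continuous_map (torus 6) euclidean to_coords"
  unfolding continuous_map_to_fun
proof
  fix n :: nat
  consider "n div 2 \<in> {1..5}" "even n" | "n div 2 \<in> {1..5}" "odd n" | "n div 2 \<notin> {1..5}" by blast
  then show "continuous_map (torus 6) euclideanreal (\<lambda>x. to_coords x n)"
  proof cases
    case 1
    have "continuous_map (torus 6) euclideanreal (Re \<circ> (\<lambda>x. x (n div 2)))"
      by (rule continuous_map_compose[OF continuous_map_torus_coordinate[OF 1(1)]]) (auto intro: continuous_intros)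
    moreover have "(\<lambda>x. to_coords x n) = Re \<circ> (\<lambda>x. x (n div 2))"
      using 1 by (auto simp: to_coords_def)
    ultimately show ?thesis by simp
  next
    case 2
    have "continuous_map (torus 6) euclideanreal (Im \<circ> (\<lambda>x. x (n div 2)))"
      by (rule continuous_map_compose[OF continuous_map_torus_coordinate[OF 2(1)]]) (auto intro: continuous_intros)
    moreover have "(\<lambda>x. to_coords x n) = Im \<circ> (\<lambda>x. x (n div 2))"
      using 2 by (auto simp: to_coords_def)
    ultimately show ?thesis by simp
  next
    case 3
    then have "(\<lambda>x. to_coords x n) = (\<lambda>_. 0)" by (simp only: to_coords_def if_False)
    then show ?thesis by simp
  qed
qed

lemma continuous_map_of_coords:
  assumes "S \<subseteq> to_coords ` topspace (torus 6)"
  shows "continuous_map (top_of_set S) (torus 6) of_coords"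
  unfolding torus_def continuous_map_componentwise
proof (intro conjI ballI)
  show "of_coords ` topspace (top_of_set S) \<subseteq> extensional {1..6-1}"
    by (auto simp: of_coords_def)
  fix i :: nat assume i: "i \<in> {1..6-1}"
  then have eq: "(\<lambda>z. of_coords z i) = (\<lambda>z. Complex (z (2 * i)) (z (2 * i + 1)))"
    by (auto simp: of_coords_def)
  have "continuous_on S (\<lambda>z. of_coords z i)"
    unfolding eq Complex_eq by (intro continuous_intros continuous_on_coordinate)
  moreover have "of_coords z i \<in> circle" if z: "z \<in> S" for z
  proof -
    obtain x where x: "x \<in> topspace (torus 6)" "z = to_coords x" using assms z by blast
    then show ?thesis using i unfolding x(2) of_coords_to_coords[OF x(1)] by (auto simp: torus_topspace)
  qed
  ultimately show "continuous_map (top_of_set S) (top_of_set circle) (\<lambda>z. of_coords z i)"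
    by (simp add: continuous_map_in_subtopology image_subset_iff_funcset[symmetric] image_subset_iff)
qed

definition cell :: "complex \<Rightarrow> nat \<Rightarrow> (nat \<Rightarrow> nat) \<Rightarrow> (nat \<Rightarrow> real) set" where
  "cell p k w = (to_coords \<circ> chart p k w) ` open_cube k"

definition cells :: "complex \<Rightarrow> (nat \<Rightarrow> real) set set" where
  "cells p = {cell p k w | k w. k \<le> 2 \<and> w permutes {1..6}}"

text \<open>A cell is a bare set of points, so its dimension and chart must be chosen. By
  \<open>cell_dim_cell\<close> the dimension is forced, and by \<open>characteristic_cell\<close>
  the chart is unique up to a cube symmetry.\<close>

definition cell_index :: "complex \<Rightarrow> (nat \<Rightarrow> real) set \<Rightarrow> nat \<times> (nat \<Rightarrow> nat)" where
  "cell_index p e = (SOME (k, w). k \<le> 2 \<and> w permutes {1..6} \<and> e = cell p k w)"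

definition cell_dim :: "complex \<Rightarrow> (nat \<Rightarrow> real) set \<Rightarrow> nat" where
  "cell_dim p e = fst (cell_index p e)"

definition characteristic :: "complex \<Rightarrow> (nat \<Rightarrow> real) set \<Rightarrow> (nat \<Rightarrow> real) \<Rightarrow> nat \<Rightarrow> real" where
  "characteristic p e = to_coords \<circ> chart p (cell_dim p e) (snd (cell_index p e))"

definition square_complex :: "complex \<Rightarrow> (nat \<Rightarrow> real) set" where
  "square_complex p = \<Union> (cells p)"

lemma closed_unit_cube: "closed (unit_cube k)"
  unfolding unit_cube_def
  by (intro closed_Collect_conj closed_Collect_all closed_Collect_imp closed_Collect_eq closed_Collect_le
      open_Collect_const continuous_intros continuous_on_product_coordinates)

lemma compact_unit_cube: "compact (unit_cube k)"
proof -
  have "0 \<le> x i \<and> x i \<le> 1" if "x \<in> unit_cube k" for x i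
    using that by (cases "i < k") (auto simp: unit_cube_def)
  then have "unit_cube k \<subseteq> PiE UNIV (\<lambda>_. {0..1})" by auto
  then show ?thesis
    using closed_unit_cube[of k] compact_unit_box by (metis closed_Int_compact inf.absorb_iff1)
qed

context
  fixes p :: complex
  assumes p: "p \<in> circle"
begin

lemma chart_in_torus: "chart p k w x \<in> topspace (torus 6)"
  using continuous_map_chart[OF p, of UNIV k w] by (auto simp: continuous_map_def)

lemma to_coords_chart_eq_iff: "to_coords (chart p k w x) = to_coords (chart p k' w' x') \<longleftrightarrow> chart p k w x = chart p k' w' x'"
  using of_coords_to_coords[OF chart_in_torus] by metis

lemma continuous_on_to_coords_chart: "continuous_on S (to_coords \<circ> chart p k w)"
  using continuous_map_compose[OF continuous_map_chart[OF p, of S k w] continuous_map_to_coords] by simp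

lemma cells_eqI:
  assumes "w permutes {1..6}" "w' permutes {1..6}" "k \<le> 2" "k' \<le> 2" "z \<in> cell p k w" "z \<in> cell p k' w'"
  shows "k = k'" "chart_orbit p k w = chart_orbit p k' w'"
proof -
  obtain x where x: "x \<in> open_cube k" "z = to_coords (chart p k w x)"
    using assms(5) by (auto simp: cell_def)
  obtain x' where x': "x' \<in> open_cube k'" "z = to_coords (chart p k' w' x')"
    using assms(6) by (auto simp: cell_def)
  have "chart p k w x = chart p k' w' x'"
    using x(2) x'(2) to_coords_chart_eq_iff by metis
  from chart_meet[OF p assms(1-4) x(1) x'(1) this]
  show "k = k'" "chart_orbit p k w = chart_orbit p k' w'" .
qed

lemma cell_nonempty: "cell p k w \<noteq> {}"
  using open_cube_nonempty[of k] by (auto simp: cell_def)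

lemma cell_eq_if_orbit_eq:
  assumes "chart_orbit p k w = chart_orbit p k w'"
  shows "cell p k w = cell p k w'"
proof -
  have "cell p k w \<subseteq> cell p k w'" if eq: "chart_orbit p k w = chart_orbit p k w'" for w w'
  proof
    fix z assume "z \<in> cell p k w"
    then obtain x where x: "x \<in> open_cube k" "z = to_coords (chart p k w x)" by (auto simp: cell_def)
    obtain h where h: "cube_symmetry k h" "\<And>x. x \<in> unit_cube k \<Longrightarrow> chart p k w x = chart p k w' (h x)"
      by (rule chart_orbit_eqD[OF eq]) blast
    have "x \<in> unit_cube k" using x open_cube_subset by blast
    then have "z = to_coords (chart p k w' (h x))" "h x \<in> open_cube k"
      using h(2) x cube_symmetry_mem(2)[OF h(1)] by simp_all
    then show "z \<in> cell p k w'" by (auto simp: cell_def)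
  qed
  from this[OF assms] this[OF assms[symmetric]] show ?thesis by blast
qed

lemma cell_in_cells: "k \<le> 2 \<Longrightarrow> w permutes {1..6} \<Longrightarrow> cell p k w \<in> cells p"
  unfolding cells_def by blast

lemma cell_index_spec:
  assumes "e \<in> cells p"
  shows "cell_dim p e \<le> 2" "snd (cell_index p e) permutes {1..6}"
    "e = cell p (cell_dim p e) (snd (cell_index p e))"
proof -
  obtain k w where kw: "cell_index p e = (k, w)" by fastforce
  define P where "P = (\<lambda>(k, w). k \<le> (2::nat) \<and> w permutes {1..6::nat} \<and> e = cell p k w)"
  obtain k' w' where "k' \<le> 2" "w' permutes {1..6}" "e = cell p k' w'"
    using assms unfolding cells_def by blast
  then have "P (k', w')" by (simp add: P_def)
  then have "P (Eps P)" by (rule someI)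
  moreover have "Eps P = (k, w)"
    using kw unfolding cell_index_def P_def .
  ultimately have "P (k, w)" by simp
  then have "k \<le> 2" "w permutes {1..6}" "e = cell p k w" by (simp_all add: P_def)
  then show "cell_dim p e \<le> 2" "snd (cell_index p e) permutes {1..6}"
    "e = cell p (cell_dim p e) (snd (cell_index p e))"
    unfolding cell_dim_def kw fst_conv snd_conv .
qed

lemma cell_dim_cell:
  assumes k: "k \<le> 2" and w: "w permutes {1..6}"
  shows "cell_dim p (cell p k w) = k"
    "chart_orbit p k (snd (cell_index p (cell p k w))) = chart_orbit p k w"
proof -
  note spec = cell_index_spec[OF cell_in_cells[OF k w]]
  obtain z where z: "z \<in> cell p k w" using cell_nonempty by blast
  then have z': "z \<in> cell p (cell_dim p (cell p k w)) (snd (cell_index p (cell p k w)))"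
    using spec(3) by simp
  show d: "cell_dim p (cell p k w) = k"
    by (rule cells_eqI(1)[OF spec(2) w spec(1) k z' z])
  show "chart_orbit p k (snd (cell_index p (cell p k w))) = chart_orbit p k w"
    using cells_eqI(2)[OF spec(2) w spec(1) k z' z] unfolding d .
qed

lemma characteristic_cell:
  assumes k: "k \<le> 2" and w: "w permutes {1..6}"
  obtains h where "cube_symmetry k h"
    "\<And>x. x \<in> unit_cube k \<Longrightarrow> to_coords (chart p k w x) = characteristic p (cell p k w) (h x)"
proof -
  obtain h where "cube_symmetry k h"
    "\<And>x. x \<in> unit_cube k \<Longrightarrow> chart p k w x = chart p k (snd (cell_index p (cell p k w))) (h x)"
    by (rule chart_orbit_eqD[OF cell_dim_cell(2)[OF assms, symmetric]]) blast
  then show ?thesis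
    using that by (simp add: characteristic_def cell_dim_cell(1)[OF assms])
qed

lemma finite_cells: "finite (cells p)"
proof -
  have "cells p = (\<lambda>(k, w). cell p k w) ` ({..2} \<times> {w. w permutes {1..6}})"
    unfolding cells_def by auto
  then show ?thesis by (simp add: finite_permutations)
qed

lemma cells_disjnt: "disjoint (cells p)"
proof (rule disjointI)
  fix e e' assume e: "e \<in> cells p" and e': "e' \<in> cells p" and "e \<noteq> e'"
  show "e \<inter> e' = {}"
  proof (rule ccontr)
    assume "e \<inter> e' \<noteq> {}"
    then obtain z where z: "z \<in> e" "z \<in> e'" by blast
    note s = cell_index_spec[OF e] and s' = cell_index_spec[OF e']
    have z': "z \<in> cell p (cell_dim p e) (snd (cell_index p e))" "z \<in> cell p (cell_dim p e') (snd (cell_index p e'))"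
      using z s(3) s'(3) by simp_all
    note eq = cells_eqI[OF s(2) s'(2) s(1) s'(1) z']
    have "e = e'"
      using cell_eq_if_orbit_eq eq s(3) s'(3) by metis
    then show False using \<open>e \<noteq> e'\<close> by simp
  qed
qed

lemma to_coords_chart_in_lower_cell:
  assumes w: "w permutes {1..6}" and k: "k \<le> 2" and x: "x \<in> unit_cube k"
  obtains b where "b \<in> cells p" "x \<notin> open_cube k \<Longrightarrow> cell_dim p b < k" "to_coords (chart p k w x) \<in> b"
proof -
  obtain k' w' y where y: "k' \<le> k" "x \<notin> open_cube k \<Longrightarrow> k' < k" "w' permutes {1..6}" "y \<in> open_cube k'"
    "chart p k w x = chart p k' w' y"
    by (rule chart_in_open_cell[OF p w k x]) blast
  have k': "k' \<le> 2" using y(1) k by simp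
  have "to_coords (chart p k w x) \<in> cell p k' w'" using y(4,5) by (auto simp: cell_def)
  then show ?thesis
    using that[OF cell_in_cells[OF k' y(3)]] y(2) unfolding cell_dim_cell(1)[OF k' y(3)] by blast
qed

lemma square_complex_eq:
  "square_complex p = (\<Union>e \<in> cells p. characteristic p e ` unit_cube (cell_dim p e))"
proof
  show "square_complex p \<subseteq> (\<Union>e \<in> cells p. characteristic p e ` unit_cube (cell_dim p e))"
  proof
    fix z assume "z \<in> square_complex p"
    then obtain e where e: "e \<in> cells p" "z \<in> e" unfolding square_complex_def by blast
    then have "z \<in> characteristic p e ` open_cube (cell_dim p e)"
      using cell_index_spec(3)[OF e(1)] unfolding characteristic_def cell_def by simp
    then show "z \<in> (\<Union>e \<in> cells p. characteristic p e ` unit_cube (cell_dim p e))"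
      using e(1) open_cube_subset by blast
  qed
  show "(\<Union>e \<in> cells p. characteristic p e ` unit_cube (cell_dim p e)) \<subseteq> square_complex p"
  proof
    fix z assume "z \<in> (\<Union>e \<in> cells p. characteristic p e ` unit_cube (cell_dim p e))"
    then obtain e x where e: "e \<in> cells p" "x \<in> unit_cube (cell_dim p e)" "z = characteristic p e x" by blast
    obtain b where "b \<in> cells p" "to_coords (chart p (cell_dim p e) (snd (cell_index p e)) x) \<in> b"
      by (rule to_coords_chart_in_lower_cell[OF cell_index_spec(2,1)[OF e(1)] e(2)]) blast
    then show "z \<in> square_complex p"
      using e(3) by (auto simp: characteristic_def square_complex_def)
  qed
qed

lemma to_coords_chart_in_square_complex:
  "w permutes {1..6} \<Longrightarrow> k \<le> 2 \<Longrightarrow> x \<in> unit_cube k \<Longrightarrow> to_coords (chart p k w x) \<in> square_complex p"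
  unfolding square_complex_def by (rule to_coords_chart_in_lower_cell) blast+

lemma continuous_on_characteristic: "continuous_on S (characteristic p e)"
  unfolding characteristic_def by (rule continuous_on_to_coords_chart)

lemma inj_on_characteristic:
  assumes "e \<in> cells p"
  shows "inj_on (characteristic p e) (unit_cube (cell_dim p e))"
proof (rule inj_onI)
  fix x y assume x: "x \<in> unit_cube (cell_dim p e)" "y \<in> unit_cube (cell_dim p e)"
    and "characteristic p e x = characteristic p e y"
  then have "chart p (cell_dim p e) (snd (cell_index p e)) x = chart p (cell_dim p e) (snd (cell_index p e)) y"
    unfolding characteristic_def comp_apply to_coords_chart_eq_iff by blast
  then show "x = y"
    using inj_onD[OF inj_on_chart[OF p cell_index_spec(2,1)[OF assms]]] x by blast
qed

lemma characteristic_open_cube: "e \<in> cells p \<Longrightarrow> characteristic p e ` open_cube (cell_dim p e) = e"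
  using cell_index_spec(3)[of e] unfolding cell_def characteristic_def by simp

text \<open>The map is injective even on the closed cube, so compactness makes it a homeomorphism
  there, which is then restricted.\<close>

lemma homeomorphic_map_characteristic:
  assumes e: "e \<in> cells p"
  shows "homeomorphic_map (top_of_set (open_cube (cell_dim p e))) (top_of_set e) (characteristic p e)"
proof -
  obtain g where "homeomorphism (unit_cube (cell_dim p e)) (characteristic p e ` unit_cube (cell_dim p e)) (characteristic p e) g"
    using homeomorphism_compact[OF compact_unit_cube continuous_on_characteristic refl inj_on_characteristic[OF e]]
    by blast
  then have "homeomorphism (open_cube (cell_dim p e)) e (characteristic p e) g"
    by (rule homeomorphism_of_subsets[OF _ open_cube_subset _ characteristic_open_cube[OF e]])
      (use open_cube_subset characteristic_open_cube[OF e] in blast)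
  then have "homeomorphic_maps (top_of_set (open_cube (cell_dim p e))) (top_of_set e) (characteristic p e) g"
    unfolding homeomorphism_def homeomorphic_maps_def by (auto simp: continuous_map_in_subtopology)
  then show ?thesis by (rule homeomorphic_maps_map[THEN iffD1, THEN conjunct1])
qed

text \<open>\<open>A\<close> is the union, over finitely many cells, of the images of its preimages
  in the cubes, and these are compact.\<close>

lemma closed_square_complex_subset:
  assumes A: "A \<subseteq> square_complex p"
    and cl: "\<And>e. e \<in> cells p \<Longrightarrow>
      closedin (top_of_set (unit_cube (cell_dim p e))) {x \<in> unit_cube (cell_dim p e). characteristic p e x \<in> A}"
  shows "closedin (top_of_set (square_complex p)) A"
proof -
  let ?D = "\<lambda>e. {x \<in> unit_cube (cell_dim p e). characteristic p e x \<in> A}"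
  have "compact (?D e)" if "e \<in> cells p" for e
    using closedin_compact[OF compact_unit_cube cl[OF that]] .
  then have "compact (characteristic p e ` ?D e)" if "e \<in> cells p" for e
    using compact_continuous_image[OF continuous_on_characteristic] that by blast
  then have "closed (\<Union>e \<in> cells p. characteristic p e ` ?D e)"
    using finite_cells by (intro closed_UN compact_imp_closed) auto
  moreover have "(\<Union>e \<in> cells p. characteristic p e ` ?D e) = A"
  proof
    show "A \<subseteq> (\<Union>e \<in> cells p. characteristic p e ` ?D e)"
    proof
      fix z assume z: "z \<in> A"
      then obtain e x where "e \<in> cells p" "x \<in> unit_cube (cell_dim p e)" "z = characteristic p e x"
        using A unfolding square_complex_eq by blast
      then show "z \<in> (\<Union>e \<in> cells p. characteristic p e ` ?D e)" using z by blast
    qed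
  qed blast
  ultimately show ?thesis using A closed_subset by metis
qed

text \<open>The face is first expressed through some chart of the smaller cell; passing to the
  chosen chart costs one more cube symmetry, composed with the first.\<close>

lemma face_of_cell:
  assumes e: "e \<in> cells p" and i: "i < cell_dim p e" and \<epsilon>: "\<epsilon> \<in> {0, 1}"
  shows "\<exists>b g. b \<in> cells p \<and> Suc (cell_dim p b) = cell_dim p e \<and> cube_symmetry (cell_dim p b) g \<and>
    (\<forall>x \<in> unit_cube (cell_dim p b). characteristic p e (face_inclusion i \<epsilon> x) = characteristic p b (g x))"
proof -
  define k w where "k = cell_dim p e" and "w = snd (cell_index p e)"
  have w: "w permutes {1..6}" and k: "k \<le> 2" 
    using cell_index_spec[OF e] by (simp_all add: k_def w_def)
  have "\<exists>m w' h. Suc m = k \<and> w' permutes {1..6} \<and> cube_symmetry m h \<and>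
    (\<forall>x \<in> unit_cube m. chart p k w (face_inclusion i \<epsilon> x) = chart p m w' (h x))"
  proof -
    consider "k = 1" "i = 0" | "k = 2" "i < 2" using i k unfolding k_def by linarith
    then show ?thesis
    proof cases
      case 1
      obtain w' where "w' permutes {1..6}"
        "\<And>x. x \<in> unit_cube 0 \<Longrightarrow> chart p 1 w (face_inclusion 0 \<epsilon> x) = chart p 0 w' x"
        by (rule edge_face[OF p w \<epsilon>]) blast
      then show ?thesis
        using 1 cube_symmetry_id by (intro exI[of _ 0] exI[of _ w'] exI[of _ "\<lambda>x. x"]) (auto simp: One_nat_def)
    next
      case 2
      obtain w' h where "w' permutes {1..6}" "cube_symmetry 1 h"
        "\<And>x. x \<in> unit_cube 1 \<Longrightarrow> chart p 2 w (face_inclusion i \<epsilon> x) = chart p 1 w' (h x)"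
        by (rule square_face[OF p w 2(2) \<epsilon>]) blast
      then show ?thesis
        using 2 by (intro exI[of _ 1] exI[of _ w'] exI[of _ h]) auto
    qed
  qed
  then obtain m w' h where m: "Suc m = k" "w' permutes {1..6}" "cube_symmetry m h"
    "\<And>x. x \<in> unit_cube m \<Longrightarrow> chart p k w (face_inclusion i \<epsilon> x) = chart p m w' (h x)"
    by blast
  have m2: "m \<le> 2" using m(1) k by simp
  obtain q where q: "cube_symmetry m q"
    "\<And>x. x \<in> unit_cube m \<Longrightarrow> to_coords (chart p m w' x) = characteristic p (cell p m w') (q x)"
    by (rule characteristic_cell[OF m2 m(2)]) blast
  note d = cell_dim_cell(1)[OF m2 m(2)]
  have "characteristic p e (face_inclusion i \<epsilon> x) = characteristic p (cell p m w') (q (h x))"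
    if "x \<in> unit_cube m" for x
  proof -
    have "characteristic p e (face_inclusion i \<epsilon> x) = to_coords (chart p k w (face_inclusion i \<epsilon> x))"
      by (simp add: characteristic_def k_def w_def)
    also have "\<dots> = to_coords (chart p m w' (h x))" using m(4)[OF that] by simp
    also have "\<dots> = characteristic p (cell p m w') (q (h x))"
      by (rule q(2)[OF cube_symmetry_mem(1)[OF m(3) that]])
    finally show ?thesis .
  qed
  then show ?thesis
    using cell_in_cells[OF m2 m(2)] cube_symmetry_comp[OF q(1) m(3)] m(1)
    by (intro exI[of _ "cell p m w'"] exI[of _ "\<lambda>x. q (h x)"]) (simp add: d k_def)
qed

lemma cubical_square_complex:
  "cubical_complex (top_of_set (square_complex p)) (cells p) (cell_dim p) (characteristic p)"
proof
  show "Hausdorff_space (top_of_set (square_complex p))"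
    by (simp add: Hausdorff_space_subtopology)
  show "\<Union> (cells p) = topspace (top_of_set (square_complex p))"
    by (simp add: square_complex_def)
  show "disjoint (cells p)" by (rule cells_disjnt)
  fix e assume e: "e \<in> cells p"
  show "continuous_map (top_of_set (unit_cube (cell_dim p e))) (top_of_set (square_complex p)) (characteristic p e)"
    using e by (auto simp: continuous_map_in_subtopology continuous_on_characteristic square_complex_eq)
  have "subtopology (top_of_set (square_complex p)) e = top_of_set e"
    using e by (auto simp: subtopology_subtopology square_complex_def intro!: arg_cong[of _ _ top_of_set])
  then show "homeomorphic_map (top_of_set (open_cube (cell_dim p e))) (subtopology (top_of_set (square_complex p)) e)
      (characteristic p e)"
    using homeomorphic_map_characteristic[OF e] by simp
  show "\<exists>B. finite B \<and> B \<subseteq> {b \<in> cells p. cell_dim p b < cell_dim p e} \<and>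
      characteristic p e ` (unit_cube (cell_dim p e) - open_cube (cell_dim p e)) \<subseteq> \<Union> B"
  proof (intro exI conjI)
    show "finite {b \<in> cells p. cell_dim p b < cell_dim p e}" using finite_cells by simp
    show "characteristic p e ` (unit_cube (cell_dim p e) - open_cube (cell_dim p e))
      \<subseteq> \<Union> {b \<in> cells p. cell_dim p b < cell_dim p e}"
    proof clarify
      fix x assume x: "x \<in> unit_cube (cell_dim p e)" "x \<notin> open_cube (cell_dim p e)"
      obtain b where "b \<in> cells p" "x \<notin> open_cube (cell_dim p e) \<Longrightarrow> cell_dim p b < cell_dim p e"
        "to_coords (chart p (cell_dim p e) (snd (cell_index p e)) x) \<in> b"
        by (rule to_coords_chart_in_lower_cell[OF cell_index_spec(2,1)[OF e] x(1)]) blast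
      then show "characteristic p e x \<in> \<Union> {b \<in> cells p. cell_dim p b < cell_dim p e}"
        using x(2) by (auto simp: characteristic_def)
    qed
  qed simp
  fix i \<epsilon> assume "i < cell_dim p e" "\<epsilon> \<in> {0, 1::real}"
  then show "\<exists>b g. b \<in> cells p \<and> Suc (cell_dim p b) = cell_dim p e \<and> cube_symmetry (cell_dim p b) g \<and>
    (\<forall>x \<in> unit_cube (cell_dim p b). characteristic p e (face_inclusion i \<epsilon> x) = characteristic p b (g x))"
    by (rule face_of_cell[OF e])
qed (use closed_square_complex_subset in simp)

text \<open>\<open>to_coords \<circ> flow p 1\<close> is a retraction with section
  \<open>of_coords\<close>, and the other composite is \<open>flow p 1\<close>, which is homotopic
  to the identity.\<close>

lemma square_complex_homotopy_equivalent:
  "top_of_set (square_complex p) homotopy_equivalent_space Q_space p 6"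
proof -
  let ?r = "to_coords \<circ> flow p 1"
  have flow_in: "flow p 1 x \<in> topspace (Q_space p 6) \<and> to_coords (flow p 1 x) \<in> square_complex p"
    if "x \<in> topspace (Q_space p 6)" for x
  proof -
    obtain w g where w: "w permutes {1..6}" and g: "g \<in> gaps" and x: "place p w g = x"
      using place_surj[OF p \<open>x \<in> topspace (Q_space p 6)\<close>] by blast
    have f: "flow p 1 x = place p w (collapse g)"
      using flow_1_place[OF p w g] x by simp
    obtain a b j where ab: "0 \<le> a" "0 \<le> b" "a + b \<le> 1" and j: "collapse g \<circ> rot ^^ j = book a b"
      by (rule collapse_in_book[OF g]) blast
    interpret arrangement_invariant "place p"
      by unfold_locales (simp_all add: place_rot[OF p] place_swap[OF p])
    have wj: "w \<circ> rot ^^ j permutes {1..6}" by (rule permutes_rot_pow[OF w])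
    have "place p w (collapse g) = place p (w \<circ> rot ^^ j) (book a b)"
      using rot_pow_eq[OF w collapse_gaps[OF g], of j] j by simp
    moreover obtain y where "y \<in> unit_cube 2" "place p (w \<circ> rot ^^ j) (book a b) = chart p 2 (w \<circ> rot ^^ j) y"
      by (rule book_eq_chart[OF p wj ab]) blast
    ultimately have "to_coords (flow p 1 x) \<in> square_complex p"
      using f to_coords_chart_in_square_complex[OF wj, of 2 y] by simp
    moreover have "flow p 1 x \<in> topspace (Q_space p 6)"
      unfolding f by (rule place_in_Q[OF p w collapse_gaps[OF g]])
    ultimately show ?thesis by blast
  qed
  have cont_flow: "continuous_map (Q_space p 6) (Q_space p 6) (flow p 1)"
    using homotopic_with_imp_continuous_maps[OF flow_homotopic_id[OF p]] by blast
  have inc: "continuous_map (Q_space p 6) (torus 6) id"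
    unfolding Q_space_def by (rule continuous_map_from_subtopology) simp
  have "continuous_map (Q_space p 6) euclidean ?r"
    using continuous_map_compose[OF continuous_map_compose[OF cont_flow inc] continuous_map_to_coords] by simp
  then have r: "continuous_map (Q_space p 6) (top_of_set (square_complex p)) ?r"
    using flow_in by (auto simp: continuous_map_in_subtopology)
  \<comment> \<open>Every point of the complex comes from a \<open>book\<close> configuration, and
    these are fixed by the end of the flow.\<close>
  have pts: "\<exists>x \<in> topspace (Q_space p 6). z = to_coords x \<and> flow p 1 x = x" if z: "z \<in> square_complex p" for z
  proof -
    obtain e y where e: "e \<in> cells p" "y \<in> unit_cube (cell_dim p e)" "z = characteristic p e y"
      using z unfolding square_complex_eq by blast
    obtain w a b where w: "w permutes {1..6}" and ab: "0 \<le> a" "0 \<le> b" "a + b \<le> 1"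
      and eq: "chart p (cell_dim p e) (snd (cell_index p e)) y = place p w (book a b)"
      by (rule chart_eq_book[OF p cell_index_spec(2,1)[OF e(1)] e(2)]) blast
    have "z = to_coords (place p w (book a b))"
      using e(3) eq by (simp add: characteristic_def)
    moreover have "flow p 1 (place p w (book a b)) = place p w (book a b)"
      using flow_1_place[OF p w book_gaps[OF ab]] collapse_book[OF ab] by simp
    ultimately show ?thesis
      using place_in_Q[OF p w book_gaps[OF ab]] by blast
  qed
  have Qt: "topspace (Q_space p 6) \<subseteq> topspace (torus 6)"
    unfolding Q_space_topspace by blast
  have "square_complex p \<subseteq> to_coords ` topspace (torus 6)"
    using pts Qt by blast
  from continuous_map_of_coords[OF this]
  have s: "continuous_map (top_of_set (square_complex p)) (Q_space p 6) of_coords"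
  proof (subst Q_space_eq[OF p], unfold continuous_map_in_subtopology, intro conjI)
    show "of_coords \<in> topspace (top_of_set (square_complex p)) \<rightarrow> topspace (Q_space p 6)"
    proof
      fix z assume "z \<in> topspace (top_of_set (square_complex p))"
      then obtain x where x: "x \<in> topspace (Q_space p 6)" "z = to_coords x" using pts by auto
      then show "of_coords z \<in> topspace (Q_space p 6)"
        using of_coords_to_coords Qt by auto
    qed
  qed
  have "retraction_maps (Q_space p 6) (top_of_set (square_complex p)) ?r of_coords"
    unfolding retraction_maps_def
  proof (intro conjI ballI r s)
    fix z assume "z \<in> topspace (top_of_set (square_complex p))"
    then obtain x where x: "x \<in> topspace (Q_space p 6)" "z = to_coords x" "flow p 1 x = x" using pts by auto
    then have "of_coords z = x" using of_coords_to_coords Qt by auto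
    then show "?r (of_coords z) = z" using x by simp
  qed
  moreover have "homotopic_with (\<lambda>_. True) (Q_space p 6) (Q_space p 6) (of_coords \<circ> ?r) id"
  proof (rule homotopic_with_eq[OF flow_homotopic_id[OF p]])
    fix x assume "x \<in> topspace (Q_space p 6)"
    then have "flow p 1 x \<in> topspace (torus 6)" using flow_in Qt by blast
    then show "(of_coords \<circ> ?r) x = flow p 1 x" by (simp add: of_coords_to_coords)
  qed simp_all
  ultimately have "Q_space p 6 homotopy_equivalent_space top_of_set (square_complex p)"
    by (rule deformation_retraction_imp_homotopy_equivalent_space[rotated])
  then show ?thesis
    by (rule homotopy_equivalent_space_sym[THEN iffD1])
qed

end

lemma group_actionI:
  fixes G (structure)
  assumes G: "group G"
    and closed: "\<And>g x. g \<in> carrier G \<Longrightarrow> x \<in> E \<Longrightarrow> f g x \<in> E"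
    and ext: "\<And>g. g \<in> carrier G \<Longrightarrow> f g \<in> extensional E"
    and mult: "\<And>g h x. g \<in> carrier G \<Longrightarrow> h \<in> carrier G \<Longrightarrow> x \<in> E \<Longrightarrow> f (g \<otimes> h) x = f g (f h x)"
    and one: "\<And>x. x \<in> E \<Longrightarrow> f \<one> x = x"
  shows "group_action G E f"
proof -
  interpret group G by (rule G)
  have bij: "f g \<in> Bij E" if g: "g \<in> carrier G" for g
  proof -
    have "bij_betw (f g) E E"
    proof (rule bij_betwI[where g = "f (inv g)"])
      show "f g \<in> E \<rightarrow> E" "f (inv g) \<in> E \<rightarrow> E" using closed g by auto
      show "f (inv g) (f g x) = x" if "x \<in> E" for x
        using mult[of "inv g" g x] one g that by simp
      show "f g (f (inv g) x) = x" if "x \<in> E" for x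
        using mult[of g "inv g" x] one g that by simp
    qed
    then show ?thesis using ext[OF g] by (simp add: Bij_def)
  qed
  have "f \<in> hom G (BijGroup E)"
  proof (rule homI)
    fix g h assume g: "g \<in> carrier G" and h: "h \<in> carrier G"
    have "f (g \<otimes> h) = compose E (f g) (f h)"
    proof
      fix x show "f (g \<otimes> h) x = compose E (f g) (f h) x"
        using mult[OF g h] ext[of "g \<otimes> h"] g h by (cases "x \<in> E") (auto simp: compose_def extensional_def)
    qed
    then show "f (g \<otimes> h) = f g \<otimes>\<^bsub>BijGroup E\<^esub> f h"
      using bij[OF g] bij[OF h] by (simp add: BijGroup_def)
  qed (simp add: BijGroup_def bij)
  then show ?thesis
    by (intro group_action.intro group_hom.intro group_hom_axioms.intro G group_BijGroup)
qed

subsection \<open>The action of the symmetric group\<close>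

text \<open>After the permutation label 6 may have left the base point; dividing by its new
  coordinate rotates the circle back.\<close>

definition relabel :: "complex \<Rightarrow> (nat \<Rightarrow> nat) \<Rightarrow> (nat \<Rightarrow> complex) \<Rightarrow> nat \<Rightarrow> complex" where
  "relabel p \<sigma> x = restrict (\<lambda>i. p * ((x(6 := p)) (inv' \<sigma> i) / (x(6 := p)) (inv' \<sigma> 6))) {1..5}"

definition act :: "complex \<Rightarrow> (nat \<Rightarrow> nat) \<Rightarrow> (nat \<Rightarrow> real) \<Rightarrow> nat \<Rightarrow> real" where
  "act p \<sigma> = restrict (\<lambda>z. to_coords (relabel p \<sigma> (of_coords z))) (square_complex p)"

text \<open>Lists of numerals are compared by simplification, so the explicitly listed stabilizers
  can be counted directly.\<close>

definition label_list :: "(nat \<Rightarrow> nat) \<Rightarrow> nat list" where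
  "label_list w = [w 1, w 2, w 3, w 4, w 5, w 6]"

lemma inj_on_label_list: "inj_on label_list {w. w permutes {1..6}}"
proof (rule inj_onI)
  fix v w assume v: "v \<in> {w. w permutes {1..6}}" and w: "w \<in> {w. w permutes {1..6}}"
    and eq: "label_list v = label_list w"
  show "v = w"
  proof
    fix k show "v k = w k"
    proof (cases "k \<in> {1..6}")
      case True
      then show ?thesis
        using eq unfolding positions_eq label_list_def by (elim insertE emptyE) simp_all
    next
      case False
      then show ?thesis
        using v w permutes_not_in by (metis mem_Collect_eq)
    qed
  qed
qed

lemma label_list_comp:
  assumes "label_list w = [a, b, c, d, e, f]"
  shows "label_list (w \<circ> Transposition.transpose 1 2) = [b, a, c, d, e, f]"
    "label_list (w \<circ> rot) = [b, c, d, e, f, a]"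
    "label_list (w \<circ> (rot \<circ> rot)) = [c, d, e, f, a, b]"
    "label_list (w \<circ> (rot \<circ> rot \<circ> rot)) = [d, e, f, a, b, c]"
  using assms by (simp_all add: label_list_def Transposition.transpose_def)

context
  fixes p :: complex
  assumes p: "p \<in> circle"
begin

lemma relabel_config:
  assumes \<sigma>: "\<sigma> permutes {1..6}"
  shows "relabel p \<sigma> (config p \<theta>) = config p (\<lambda>i. \<theta> (inv' \<sigma> i))"
proof
  fix i
  show "relabel p \<sigma> (config p \<theta>) i = config p (\<lambda>i. \<theta> (inv' \<sigma> i)) i"
  proof (cases "i \<in> {1..5}")
    case True
    have in6: "inv' \<sigma> i \<in> {1..6}" "inv' \<sigma> 6 \<in> {1..6}"
      using permutes_in_image[OF permutes_inv[OF \<sigma>]] True by simp_all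
    have "relabel p \<sigma> (config p \<theta>) i
        = p * (((config p \<theta>)(6 := p)) (inv' \<sigma> i) / ((config p \<theta>)(6 := p)) (inv' \<sigma> 6))"
      using True by (simp only: relabel_def restrict_apply if_True)
    also have "\<dots> = p * (cis (2 * pi * (\<theta> (inv' \<sigma> i) - \<theta> 6)) / cis (2 * pi * (\<theta> (inv' \<sigma> 6) - \<theta> 6)))"
      unfolding config_upd[OF in6(1)] config_upd[OF in6(2)] using p_nonzero[OF p] by simp
    also have "\<dots> = p * cis (2 * pi * (\<theta> (inv' \<sigma> i) - \<theta> (inv' \<sigma> 6)))"
      by (simp add: cis_divide algebra_simps)
    finally show ?thesis using True by (simp add: config_def)
  qed (simp only: relabel_def config_def restrict_apply if_False)
qed

lemma relabel_place:
  assumes \<sigma>: "\<sigma> permutes {1..6}" and w: "w permutes {1..6}"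
  shows "relabel p \<sigma> (place p w g) = place p (\<sigma> \<circ> w) g"
  unfolding place_def relabel_config[OF \<sigma>] inv_comp[OF \<sigma> w] ..

lemma relabel_chart:
  assumes \<sigma>: "\<sigma> permutes {1..6}" and w: "w permutes {1..6}"
  shows "relabel p \<sigma> (chart p k w x) = chart p k (\<sigma> \<circ> w) x"
proof -
  have "relabel p \<sigma> (face_point p w s t) = face_point p (\<sigma> \<circ> w) s t" for s t
    unfolding face_point_def relabel_config[OF \<sigma>] inv_comp[OF \<sigma> w] ..
  then show ?thesis
    by (simp add: chart_def relabel_place[OF \<sigma> w])
qed

lemma square_complexE:
  assumes "z \<in> square_complex p"
  obtains k w x where "k \<le> 2" "w permutes {1..6}" "x \<in> unit_cube k" "z = to_coords (chart p k w x)"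
proof -
  obtain e x where e: "e \<in> cells p" "x \<in> unit_cube (cell_dim p e)" "z = characteristic p e x"
    using assms unfolding square_complex_eq[OF p] by blast
  show ?thesis
    using that[OF cell_index_spec(1,2)[OF p e(1)] e(2)] e(3) by (simp add: characteristic_def)
qed

text \<open>All properties of the action reduce to this formula: relabelling multiplies
  \<open>w\<close> from the left and leaves the cube coordinates alone.\<close>

lemma act_chart:
  assumes "\<sigma> permutes {1..6}" "w permutes {1..6}" "k \<le> 2" "x \<in> unit_cube k"
  shows "act p \<sigma> (to_coords (chart p k w x)) = to_coords (chart p k (\<sigma> \<circ> w) x)"
  using to_coords_chart_in_square_complex[OF p assms(2-4)]
  by (simp add: act_def of_coords_to_coords[OF chart_in_torus[OF p]] relabel_chart[OF assms(1,2)])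

lemma act_closed:
  assumes \<sigma>: "\<sigma> permutes {1..6}" and z: "z \<in> square_complex p"
  shows "act p \<sigma> z \<in> square_complex p"
proof -
  obtain k w x where x: "k \<le> 2" "w permutes {1..6}" "x \<in> unit_cube k" "z = to_coords (chart p k w x)"
    by (rule square_complexE[OF z])
  show ?thesis
    unfolding x(4) act_chart[OF \<sigma> x(2,1,3)]
    by (rule to_coords_chart_in_square_complex[OF p permutes_compose[OF x(2) \<sigma>] x(1,3)])
qed

lemma act_comp:
  assumes \<sigma>: "\<sigma> permutes {1..6}" and \<tau>: "\<tau> permutes {1..6}" and z: "z \<in> square_complex p"
  shows "act p (\<sigma> \<circ> \<tau>) z = act p \<sigma> (act p \<tau> z)"
proof -
  obtain k w x where x: "k \<le> 2" "w permutes {1..6}" "x \<in> unit_cube k" "z = to_coords (chart p k w x)"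
    by (rule square_complexE[OF z])
  show ?thesis
    unfolding x(4) act_chart[OF \<tau> x(2,1,3)] act_chart[OF permutes_compose[OF \<tau> \<sigma>] x(2,1,3)]
      act_chart[OF \<sigma> permutes_compose[OF x(2) \<tau>] x(1,3)] comp_assoc ..
qed

lemma act_id:
  assumes z: "z \<in> square_complex p"
  shows "act p id z = z"
proof -
  obtain k w x where x: "k \<le> 2" "w permutes {1..6}" "x \<in> unit_cube k" "z = to_coords (chart p k w x)"
    by (rule square_complexE[OF z])
  show ?thesis
    unfolding x(4) act_chart[OF permutes_id x(2,1,3)] id_comp ..
qed

lemma act_cell:
  assumes \<sigma>: "\<sigma> permutes {1..6}" and w: "w permutes {1..6}" and k: "k \<le> 2"
  shows "act p \<sigma> ` cell p k w = cell p k (\<sigma> \<circ> w)"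
proof -
  have "act p \<sigma> (to_coords (chart p k w x)) = to_coords (chart p k (\<sigma> \<circ> w) x)" if "x \<in> open_cube k" for x
    using act_chart[OF \<sigma> w k] open_cube_subset that by blast
  then show ?thesis
    unfolding cell_def image_image comp_apply by (rule image_cong[OF refl])
qed

text \<open>On a closed cell the action is the chart of \<open>\<sigma> \<circ> w\<close>, hence
  continuous; finitely many compact cells are then glued.\<close>

lemma continuous_map_act:
  assumes \<sigma>: "\<sigma> permutes {1..6}"
  shows "continuous_map (top_of_set (square_complex p)) (top_of_set (square_complex p)) (act p \<sigma>)"
proof -
  have "continuous_map (top_of_set (square_complex p)) euclidean (act p \<sigma>)"
  proof (rule continuous_map_from_compact_pieces[where I = "cells p" and P = "characteristic p"
        and K = "\<lambda>e. top_of_set (unit_cube (cell_dim p e))"])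
    show "finite (cells p)" by (rule finite_cells[OF p])
    show "square_complex p \<subseteq> (\<Union>e \<in> cells p. characteristic p e ` topspace (top_of_set (unit_cube (cell_dim p e))))"
      unfolding square_complex_eq[OF p] by simp
    fix e assume e: "e \<in> cells p"
    show "compact_space (top_of_set (unit_cube (cell_dim p e)))"
      using compact_unit_cube by (simp add: compact_space_subtopology)
    show "continuous_map (top_of_set (unit_cube (cell_dim p e))) euclidean (characteristic p e)"
      using continuous_on_characteristic[OF p] by simp
    let ?U = "unit_cube (cell_dim p e)"
    have sub: "{z \<in> topspace (top_of_set ?U). characteristic p e z \<in> square_complex p} = ?U"
      unfolding square_complex_eq[OF p] using e by auto
    note spec = cell_index_spec[OF p e]
    have "continuous_on ?U (act p \<sigma> \<circ> characteristic p e)"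
    proof (rule continuous_on_eq[OF continuous_on_to_coords_chart[OF p]])
      fix x assume "x \<in> ?U"
      then show "(to_coords \<circ> chart p (cell_dim p e) (\<sigma> \<circ> snd (cell_index p e))) x
          = (act p \<sigma> \<circ> characteristic p e) x"
        using act_chart[OF \<sigma> spec(2,1)] by (simp add: characteristic_def)
    qed
    then show "continuous_map (subtopology (top_of_set ?U)
        {z \<in> topspace (top_of_set ?U). characteristic p e z \<in> square_complex p}) euclidean (act p \<sigma> \<circ> characteristic p e)"
      unfolding sub by (simp add: subtopology_subtopology)
  qed simp_all
  then show ?thesis
    using act_closed[OF \<sigma>] by (auto simp: continuous_map_in_subtopology)
qed

lemma homeomorphic_map_act:
  assumes \<sigma>: "\<sigma> permutes {1..6}"
  shows "homeomorphic_map (top_of_set (square_complex p)) (top_of_set (square_complex p)) (act p \<sigma>)"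
proof -
  note \<sigma>' = permutes_inv[OF \<sigma>]
  have "homeomorphic_maps (top_of_set (square_complex p)) (top_of_set (square_complex p)) (act p \<sigma>) (act p (inv' \<sigma>))"
    unfolding homeomorphic_maps_def
    using continuous_map_act[OF \<sigma>] continuous_map_act[OF \<sigma>'] act_comp[OF \<sigma> \<sigma>'] act_comp[OF \<sigma>' \<sigma>] act_id
    unfolding permutes_inv_o[OF \<sigma>] by simp
  then show ?thesis by (rule homeomorphic_maps_map[THEN iffD1, THEN conjunct1])
qed

lemma cubical_automorphism_act:
  assumes \<sigma>: "\<sigma> permutes {1..6}"
  shows "cubical_automorphism (top_of_set (square_complex p)) (cells p) (cell_dim p) (characteristic p) (act p \<sigma>)"
  unfolding cubical_automorphism_def
proof (intro conjI ballI homeomorphic_map_act[OF \<sigma>])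
  fix e assume e: "e \<in> cells p"
  define k w where "k = cell_dim p e" and "w = snd (cell_index p e)"
  have k: "k \<le> 2" and w: "w permutes {1..6}" and ekw: "e = cell p k w"
    using cell_index_spec[OF p e] by (simp_all add: k_def w_def)
  have \<sigma>w: "\<sigma> \<circ> w permutes {1..6}" by (rule permutes_compose[OF w \<sigma>])
  have image: "act p \<sigma> ` e = cell p k (\<sigma> \<circ> w)"
    unfolding ekw by (rule act_cell[OF \<sigma> w k])
  show "act p \<sigma> ` e \<in> cells p"
    unfolding image by (rule cell_in_cells[OF p k \<sigma>w])
  have "cell_dim p (act p \<sigma> ` e) = k"
    unfolding image by (rule cell_dim_cell(1)[OF p k \<sigma>w])
  then show "cell_dim p (act p \<sigma> ` e) = cell_dim p e"
    by (simp only: k_def)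
  obtain h where h: "cube_symmetry k h"
    "\<And>x. x \<in> unit_cube k \<Longrightarrow> to_coords (chart p k (\<sigma> \<circ> w) x) = characteristic p (cell p k (\<sigma> \<circ> w)) (h x)"
    by (rule characteristic_cell[OF p k \<sigma>w]) blast
  have "act p \<sigma> (characteristic p e x) = characteristic p (act p \<sigma> ` e) (h x)" if "x \<in> unit_cube k" for x
    unfolding image using h(2)[OF that] act_chart[OF \<sigma> w k that] by (simp add: characteristic_def k_def w_def)
  then show "\<exists>g. cube_symmetry (cell_dim p e) g \<and>
      (\<forall>x \<in> unit_cube (cell_dim p e). act p \<sigma> (characteristic p e x) = characteristic p (act p \<sigma> ` e) (g x))"
    using h(1) unfolding k_def by blast
qed

lemma cubical_action_act:
  "cubical_action (sym_group 6) (top_of_set (square_complex p)) (cells p) (cell_dim p) (characteristic p) (act p)"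
  unfolding cubical_action_def sym_group_carrier
proof (intro conjI ballI cubical_automorphism_act)
  show "group_action (sym_group 6) (topspace (top_of_set (square_complex p))) (act p)"
    by (rule group_actionI[OF sym_group_is_group])
      (simp_all add: sym_group_carrier sym_group_mult sym_group_one act_closed act_comp act_id, simp add: act_def)
qed (simp add: sym_group_carrier)

section \<open>Transitivity and the number of cells\<close>

lemma cells_of_dim_eq:
  assumes k: "k \<le> 2"
  shows "cells_of_dim (cells p) (cell_dim p) k = {cell p k w | w. w permutes {1..6}}"
proof -
  have "\<exists>w. e = cell p k w \<and> w permutes {1..6}" if "e \<in> cells p" "cell_dim p e = k" for e
    using cell_index_spec[OF p that(1)] that(2) by blast
  then show ?thesis
    using cell_in_cells[OF p k] cell_dim_cell(1)[OF p k] unfolding cells_of_dim_def by blast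
qed

lemma transitive_action_cells:
  assumes k: "k \<le> 2"
  shows "transitive_action (sym_group 6) (cells_of_dim (cells p) (cell_dim p) k)
    (cell_action (cells_of_dim (cells p) (cell_dim p) k) (act p))" (is "transitive_action _ ?K ?f")
proof -
  have f: "?f \<sigma> (cell p k w) = cell p k (\<sigma> \<circ> w)" if "\<sigma> permutes {1..6}" "w permutes {1..6}" for \<sigma> w
    using that act_cell[OF that k] unfolding cell_action_def cells_of_dim_eq[OF k] by auto
  have "group_action (sym_group 6) ?K ?f"
  proof (rule group_actionI[OF sym_group_is_group], unfold sym_group_carrier sym_group_mult sym_group_one)
    show "?f g x \<in> ?K" if "g permutes {1..6}" "x \<in> ?K" for g x
      using that permutes_compose f unfolding cells_of_dim_eq[OF k] by blast
    show "?f g \<in> extensional ?K" for g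
      by (simp add: cell_action_def)
    show "?f (g \<circ> h) x = ?f g (?f h x)" if "g permutes {1..6}" "h permutes {1..6}" and x: "x \<in> ?K" for g h x
    proof -
      obtain w where w: "w permutes {1..6}" "x = cell p k w"
        using x unfolding cells_of_dim_eq[OF k] by blast
      show ?thesis
        unfolding w(2) f[OF that(2) w(1)] f[OF that(1) permutes_compose[OF w(1) that(2)]]
          f[OF permutes_compose[OF that(2,1)] w(1)] comp_assoc ..
    qed
    show "?f id x = x" if "x \<in> ?K" for x
      using that f[OF permutes_id] unfolding cells_of_dim_eq[OF k] by auto
  qed
  moreover have "\<exists>g \<in> carrier (sym_group 6). ?f g x = y" if xy: "x \<in> ?K" "y \<in> ?K" for x y
  proof -
    obtain v w where v: "v permutes {1..6}" "x = cell p k v" and w: "w permutes {1..6}" "y = cell p k w"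
      using xy unfolding cells_of_dim_eq[OF k] by blast
    have g: "w \<circ> inv' v permutes {1..6}" by (rule permutes_compose[OF permutes_inv[OF v(1)] w(1)])
    have "?f (w \<circ> inv' v) x = y"
      unfolding v(2) w(2) f[OF g v(1)] comp_assoc permutes_inv_o(2)[OF v(1)] comp_id ..
    then show ?thesis using g unfolding sym_group_carrier[symmetric] by blast
  qed
  ultimately show ?thesis
    by (intro transitive_action.intro transitive_action_axioms.intro)
qed

text \<open>Orbit-stabilizer theorem at the cell of the identity, whose orbit consists of all cells
  of its dimension; the stabilizer is transcribed into lists.\<close>

lemma card_cells_stabilizer:
  assumes k: "k \<le> 2"
  shows "card (cells_of_dim (cells p) (cell_dim p) k)
    * card (label_list ` {w. w permutes {1..6} \<and> cell p k w = cell p k id}) = 720"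
proof -
  let ?K = "cells_of_dim (cells p) (cell_dim p) k"
  let ?f = "cell_action ?K (act p)"
  interpret transitive_action "sym_group 6" ?K ?f by (rule transitive_action_cells[OF k])
  have x: "cell p k id \<in> ?K" unfolding cells_of_dim_eq[OF k] using permutes_id by blast
  have f: "?f \<sigma> (cell p k id) = cell p k \<sigma>" if "\<sigma> permutes {1..6}" for \<sigma>
    using x act_cell[OF that permutes_id k] by (simp add: cell_action_def)
  have "orbit (sym_group 6) ?f (cell p k id) = (\<lambda>\<sigma>. ?f \<sigma> (cell p k id)) ` {w. w permutes {1..6}}"
    unfolding orbit_def sym_group_carrier by blast
  also have "\<dots> = cell p k ` {w. w permutes {1..6}}"
    by (rule image_cong[OF refl]) (rule f, simp)
  also have "\<dots> = ?K"
    unfolding cells_of_dim_eq[OF k] by blast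
  finally have "orbit (sym_group 6) ?f (cell p k id) = ?K" .
  moreover have "stabilizer (sym_group 6) ?f (cell p k id) = {w. w permutes {1..6} \<and> cell p k w = cell p k id}"
    unfolding stabilizer_def sym_group_carrier using f by auto
  moreover have "inj_on label_list {w. w permutes {1..6} \<and> cell p k w = cell p k id}"
    by (rule inj_on_subset[OF inj_on_label_list]) blast
  moreover have "order (sym_group 6) = 720"
    using sym_group_card_carrier[of 6] by (simp add: order_def fact_numeral)
  ultimately show ?thesis
    using orbit_stabilizer_theorem[OF x] by (simp add: card_image)
qed

text \<open>Source of the upper bounds for stabilizers: a permutation fixing the cell of the
  identity must preserve every label.\<close>

lemma cell_label_eq:
  assumes "cell_label fV fE fF" and w: "w permutes {1..6}" "w' permutes {1..6}" and k: "k \<le> 2"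
    and eq: "cell p k w = cell p k w'"
  shows "(if k = 0 then fV w else if k = 1 then fE w else fF w)
    = (if k = 0 then fV w' else if k = 1 then fE w' else fF w')"
proof -
  obtain x where x: "x \<in> open_cube k" using open_cube_nonempty by blast
  then have "to_coords (chart p k w x) \<in> cell p k w'"
    unfolding eq[symmetric] by (auto simp: cell_def)
  then obtain y where y: "y \<in> open_cube k" "to_coords (chart p k w x) = to_coords (chart p k w' y)"
    by (auto simp: cell_def)
  show ?thesis
    by (rule cell_label.chart_label[OF assms(1) p w k k x y(1)])
      (use y(2) in \<open>simp only: to_coords_chart_eq_iff[OF p]\<close>)
qed

lemma cell_label_eqs:
  assumes "cell_label fV fE fF" and w: "w permutes {1..6}" "w' permutes {1..6}"
  shows "cell p 0 w = cell p 0 w' \<Longrightarrow> fV w = fV w'" "cell p 1 w = cell p 1 w' \<Longrightarrow> fE w = fE w'"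
    "cell p 2 w = cell p 2 w' \<Longrightarrow> fF w = fF w'"
  using cell_label_eq[OF assms, of 0] cell_label_eq[OF assms, of 1] cell_label_eq[OF assms, of 2] by simp_all

lemma cell_invariance:
  assumes w: "w permutes {1..6}"
  shows "cell p 0 (w \<circ> rot \<circ> rot) = cell p 0 w" "cell p 0 (w \<circ> Transposition.transpose 1 2) = cell p 0 w"
    "cell p 1 (w \<circ> rot) = cell p 1 w"
    "cell p 2 (w \<circ> rot \<circ> rot \<circ> rot) = cell p 2 w" "cell p 2 (w \<circ> Transposition.transpose 1 2) = cell p 2 w"
  using cell_label.fV_rot[OF cell_label_chart_orbit[OF p] w] cell_label.fV_swap[OF cell_label_chart_orbit[OF p] w]
    cell_label.fE_rot[OF cell_label_chart_orbit[OF p] w]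
    cell_label.fF_rot[OF cell_label_chart_orbit[OF p] w] cell_label.fF_swap[OF cell_label_chart_orbit[OF p] w]
  by - (rule cell_eq_if_orbit_eq[OF p], simp)+

text \<open>Right multiplication by a symmetry of the cells stays inside the stabilizer; read on
  lists, it rearranges the entries and produces the elements one by one.\<close>

lemma stabilizer_closed:
  assumes l: "l \<in> label_list ` {w. w permutes {1..6} \<and> cell p k w = cell p k id}"
    and h: "h permutes {1..6}" "\<And>w. w permutes {1..6} \<Longrightarrow> cell p k (w \<circ> h) = cell p k w"
    and l': "\<And>w. label_list w = l \<Longrightarrow> label_list (w \<circ> h) = l'"
  shows "l' \<in> label_list ` {w. w permutes {1..6} \<and> cell p k w = cell p k id}"
proof -
  obtain w where w: "w permutes {1..6}" "cell p k w = cell p k id" "l = label_list w"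
    using l by blast
  show ?thesis
  proof (rule image_eqI)
    show "l' = label_list (w \<circ> h)" using l'[of w] w(3) by simp
    show "w \<circ> h \<in> {w. w permutes {1..6} \<and> cell p k w = cell p k id}"
      using permutes_compose[OF h(1) w(1)] h(2)[OF w(1)] w(2) by blast
  qed
qed

text \<open>The 24 elements combine three rotations of the coinciding pairs with eight exchanges
  inside them.\<close>

lemma vertex_stabilizer:
  "label_list ` {w. w permutes {1..6} \<and> cell p 0 w = cell p 0 id} =
    {[1, 2, 3, 4, 5, 6], [1, 2, 3, 4, 6, 5], [1, 2, 4, 3, 5, 6], [1, 2, 4, 3, 6, 5],
     [2, 1, 3, 4, 5, 6], [2, 1, 3, 4, 6, 5], [2, 1, 4, 3, 5, 6], [2, 1, 4, 3, 6, 5],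
     [3, 4, 5, 6, 1, 2], [3, 4, 5, 6, 2, 1], [3, 4, 6, 5, 1, 2], [3, 4, 6, 5, 2, 1],
     [4, 3, 5, 6, 1, 2], [4, 3, 5, 6, 2, 1], [4, 3, 6, 5, 1, 2], [4, 3, 6, 5, 2, 1],
     [5, 6, 1, 2, 3, 4], [5, 6, 1, 2, 4, 3], [5, 6, 2, 1, 3, 4], [5, 6, 2, 1, 4, 3],
     [6, 5, 1, 2, 3, 4], [6, 5, 1, 2, 4, 3], [6, 5, 2, 1, 3, 4], [6, 5, 2, 1, 4, 3]}" (is "?L = ?R")
proof
  have swap: "[b, a, c, d, e, f] \<in> ?L" if "[a, b, c, d, e, f] \<in> ?L" for a b c d e f
    by (rule stabilizer_closed[OF that swap12_permutes cell_invariance(2) label_list_comp(1)])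
  have rot2: "[c, d, e, f, a, b] \<in> ?L" if "[a, b, c, d, e, f] \<in> ?L" for a b c d e f
    by (rule stabilizer_closed[OF that rot_compose[OF rot_permutes] cell_invariance(1)[unfolded comp_assoc]
          label_list_comp(3)])
  \<comment> \<open>The exchanges in the second and third pair are conjugates of the first one by
    double rotations.\<close>
  have swap2: "[a, b, d, c, e, f] \<in> ?L" if "[a, b, c, d, e, f] \<in> ?L" for a b c d e f
    using rot2[OF rot2[OF swap[OF rot2[OF that]]]] .
  have swap3: "[a, b, c, d, f, e] \<in> ?L" if "[a, b, c, d, e, f] \<in> ?L" for a b c d e f
    using rot2[OF swap[OF rot2[OF rot2[OF that]]]] .
  have base: "[1, 2, 3, 4, 5, 6] \<in> ?L"
    by (rule image_eqI[of _ _ id]) (simp_all add: label_list_def permutes_id)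
  have all: "{[a, b, c, d, e, f], [a, b, c, d, f, e], [a, b, d, c, e, f], [a, b, d, c, f, e],
      [b, a, c, d, e, f], [b, a, c, d, f, e], [b, a, d, c, e, f], [b, a, d, c, f, e]} \<subseteq> ?L"
    if "[a, b, c, d, e, f] \<in> ?L" for a b c d e f
    using that swap[OF that] swap2[OF that] swap3[OF that] swap2[OF swap[OF that]] swap3[OF swap[OF that]]
      swap3[OF swap2[OF that]] swap3[OF swap2[OF swap[OF that]]] by (simp only: insert_subset empty_subsetI simp_thms)
  show "?R \<subseteq> ?L"
    using all[OF base] all[OF rot2[OF base]] all[OF rot2[OF rot2[OF base]]]
    by (simp only: insert_subset empty_subsetI simp_thms)
  \<comment> \<open>The cyclic sequence of pairs as a successor relation. Only vertices matter here,
    so edges and squares get a constant label.\<close>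
  let ?fV = "\<lambda>w :: nat \<Rightarrow> nat. {({w 1, w 2}, {w 3, w 4}), ({w 3, w 4}, {w 5, w 6}), ({w 5, w 6}, {w 1, w 2})}"
  have "cell_label ?fV (\<lambda>_. {}) (\<lambda>_. {})"
    by unfold_locales (simp_all add: Transposition.transpose_def insert_commute)
  note label = cell_label_eqs(1)[OF this _ permutes_id]
  show "?L \<subseteq> ?R"
  proof (rule image_subsetI)
    fix w assume "w \<in> {w. w permutes {1..6} \<and> cell p 0 w = cell p 0 id}"
    then have w: "w permutes {1..6}" "cell p 0 w = cell p 0 id" by blast+
    have "({w 1, w 2}, {w 3, w 4}) \<in> ?fV w" "({w 3, w 4}, {w 5, w 6}) \<in> ?fV w" by blast+
    note mem = this[unfolded label[OF w] insert_iff empty_iff prod.inject id_apply]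
    have "{1, 2} \<noteq> {3, 4::nat}" "{1, 2} \<noteq> {5, 6::nat}" "{3, 4} \<noteq> {5, 6::nat}"
      by (simp_all add: doubleton_eq_iff)
    then consider "{w 1, w 2} = {1, 2}" "{w 3, w 4} = {3, 4}" "{w 5, w 6} = {5, 6}"
      | "{w 1, w 2} = {3, 4}" "{w 3, w 4} = {5, 6}" "{w 5, w 6} = {1, 2}"
      | "{w 1, w 2} = {5, 6}" "{w 3, w 4} = {1, 2}" "{w 5, w 6} = {3, 4}"
      using mem by metis
    then show "label_list w \<in> ?R"
      unfolding label_list_def doubleton_eq_iff by cases (elim disjE conjE; simp)+
  qed
qed

text \<open>A cyclic order of six labels is preserved by its rotations only; the successor relation
  serves as label.\<close>

lemma edge_stabilizer:
  "label_list ` {w. w permutes {1..6} \<and> cell p 1 w = cell p 1 id} =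
    {[1, 2, 3, 4, 5, 6], [2, 3, 4, 5, 6, 1], [3, 4, 5, 6, 1, 2], [4, 5, 6, 1, 2, 3],
     [5, 6, 1, 2, 3, 4], [6, 1, 2, 3, 4, 5]}" (is "?L = ?R")
proof
  have rot: "[b, c, d, e, f, a] \<in> ?L" if "[a, b, c, d, e, f] \<in> ?L" for a b c d e f
    by (rule stabilizer_closed[OF that rot_permutes cell_invariance(3) label_list_comp(2)])
  have base: "[1, 2, 3, 4, 5, 6] \<in> ?L"
    by (rule image_eqI[of _ _ id]) (simp_all add: label_list_def permutes_id)
  show "?R \<subseteq> ?L"
    using base rot[OF base] rot[OF rot[OF base]] rot[OF rot[OF rot[OF base]]]
      rot[OF rot[OF rot[OF rot[OF base]]]] rot[OF rot[OF rot[OF rot[OF rot[OF base]]]]]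
    by (simp only: insert_subset empty_subsetI simp_thms)
  let ?fE = "\<lambda>w :: nat \<Rightarrow> nat. {(w 1, w 2), (w 2, w 3), (w 3, w 4), (w 4, w 5), (w 5, w 6), (w 6, w 1)}"
  have "cell_label (\<lambda>_. {}) ?fE (\<lambda>_. {})"
    by unfold_locales (simp_all add: insert_commute)
  note label = cell_label_eqs(2)[OF this _ permutes_id]
  show "?L \<subseteq> ?R"
  proof (rule image_subsetI)
    fix w assume "w \<in> {w. w permutes {1..6} \<and> cell p 1 w = cell p 1 id}"
    then have w: "w permutes {1..6}" "cell p 1 w = cell p 1 id" by blast+
    have "(w 1, w 2) \<in> ?fE w" "(w 2, w 3) \<in> ?fE w" "(w 3, w 4) \<in> ?fE w" "(w 4, w 5) \<in> ?fE w" "(w 5, w 6) \<in> ?fE w"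
      by blast+
    note mem = this[unfolded label[OF w] id_apply]
    \<comment> \<open>The first two entries select one of the six rotations, and the successor
      relation fixes the others.\<close>
    from mem(1) show "label_list w \<in> ?R"
      unfolding label_list_def by (elim insertE emptyE) (use mem(2-) in simp_all)
  qed
qed

text \<open>The 8 elements arise from exchanges in the two pairs and from the half turn
  interchanging the pairs. The labels 3 and 6 stand between the pairs, and their order decides which
  half occurs.\<close>

lemma face_stabilizer:
  "label_list ` {w. w permutes {1..6} \<and> cell p 2 w = cell p 2 id} =
    {[1, 2, 3, 4, 5, 6], [1, 2, 3, 5, 4, 6], [2, 1, 3, 4, 5, 6], [2, 1, 3, 5, 4, 6],
     [4, 5, 6, 1, 2, 3], [4, 5, 6, 2, 1, 3], [5, 4, 6, 1, 2, 3], [5, 4, 6, 2, 1, 3]}" (is "?L = ?R")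
proof
  have swap: "[b, a, c, d, e, f] \<in> ?L" if "[a, b, c, d, e, f] \<in> ?L" for a b c d e f
    by (rule stabilizer_closed[OF that swap12_permutes cell_invariance(5) label_list_comp(1)])
  have rot3: "[d, e, f, a, b, c] \<in> ?L" if "[a, b, c, d, e, f] \<in> ?L" for a b c d e f
    by (rule stabilizer_closed[OF that rot_compose[OF rot_compose[OF rot_permutes]] _ label_list_comp(4)])
      (simp only: cell_invariance(4) comp_assoc[symmetric])
  have base: "[1, 2, 3, 4, 5, 6] \<in> ?L"
    by (rule image_eqI[of _ _ id]) (simp_all add: label_list_def permutes_id)
  have all: "{[a, b, c, d, e, f], [b, a, c, d, e, f], [a, b, c, e, d, f], [b, a, c, e, d, f]} \<subseteq> ?L"
    if "[a, b, c, d, e, f] \<in> ?L" for a b c d e f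
    using that swap[OF that] rot3[OF swap[OF rot3[OF that]]] rot3[OF swap[OF rot3[OF swap[OF that]]]]
    by (simp only: insert_subset empty_subsetI simp_thms)
  show "?R \<subseteq> ?L"
    using all[OF base] all[OF rot3[OF base]] by (simp only: insert_subset empty_subsetI simp_thms)
  let ?fF = "\<lambda>w :: nat \<Rightarrow> nat. {({w 1, w 2}, w 3, {w 4, w 5}), ({w 4, w 5}, w 6, {w 1, w 2})}"
  have "cell_label (\<lambda>_. {}) (\<lambda>_. {}) ?fF"
    by unfold_locales (simp_all add: Transposition.transpose_def insert_commute)
  note label = cell_label_eqs(3)[OF this _ permutes_id]
  show "?L \<subseteq> ?R"
  proof (rule image_subsetI)
    fix w assume "w \<in> {w. w permutes {1..6} \<and> cell p 2 w = cell p 2 id}"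
    then have w: "w permutes {1..6}" "cell p 2 w = cell p 2 id" by blast+
    have "({w 1, w 2}, w 3, {w 4, w 5}) \<in> ?fF w" "({w 4, w 5}, w 6, {w 1, w 2}) \<in> ?fF w" by blast+
    note mem = this[unfolded label[OF w] insert_iff empty_iff prod.inject id_apply]
    have "{1, 2} \<noteq> {4, 5::nat}"
      by (simp add: doubleton_eq_iff)
    then consider "{w 1, w 2} = {1, 2}" "w 3 = 3" "{w 4, w 5} = {4, 5}" "w 6 = 6"
      | "{w 1, w 2} = {4, 5}" "w 3 = 6" "{w 4, w 5} = {1, 2}" "w 6 = 3"
      using mem by metis
    then show "label_list w \<in> ?R"
      unfolding label_list_def doubleton_eq_iff by cases (elim disjE conjE; simp)+
  qed
qed

lemma card_cells:
  "card (cells_of_dim (cells p) (cell_dim p) 0) = 30"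
  "card (cells_of_dim (cells p) (cell_dim p) 1) = 120"
  "card (cells_of_dim (cells p) (cell_dim p) 2) = 90"
  using card_cells_stabilizer[of 0] card_cells_stabilizer[of 1] card_cells_stabilizer[of 2]
  unfolding vertex_stabilizer edge_stabilizer face_stabilizer by simp_all

end

theorem theorem13:
  fixes p :: complex
  assumes "p \<in> circle"
  shows "\<exists>(X :: (nat \<Rightarrow> real) topology) C d \<Phi> act.
    cubical_complex X C d \<Phi> \<and>
    (\<forall>e \<in> C. d e \<le> 2) \<and>
    card (cells_of_dim C d 0) = 30 \<and>
    card (cells_of_dim C d 1) = 120 \<and>
    card (cells_of_dim C d 2) = 90 \<and>
    X homotopy_equivalent_space (Q_space p 6) \<and>
    cubical_action (sym_group 6) X C d \<Phi> act \<and>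
    (\<forall>k \<in> {0, 1, 2}.
      transitive_action (sym_group 6) (cells_of_dim C d k) (cell_action (cells_of_dim C d k) act))"
proof (intro exI conjI)
  show "cubical_complex (top_of_set (square_complex p)) (cells p) (cell_dim p) (characteristic p)"
    by (rule cubical_square_complex[OF assms])
  show "\<forall>e \<in> cells p. cell_dim p e \<le> 2"
    using cell_index_spec(1)[OF assms] by blast
  show "card (cells_of_dim (cells p) (cell_dim p) 0) = 30"
    "card (cells_of_dim (cells p) (cell_dim p) 1) = 120"
    "card (cells_of_dim (cells p) (cell_dim p) 2) = 90"
    by (rule card_cells[OF assms])+
  show "top_of_set (square_complex p) homotopy_equivalent_space Q_space p 6"
    by (rule square_complex_homotopy_equivalent[OF assms])
  show "cubical_action (sym_group 6) (top_of_set (square_complex p)) (cells p) (cell_dim p) (characteristic p) (act p)"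
    by (rule cubical_action_act[OF assms])
  show "\<forall>k \<in> {0, 1, 2}. transitive_action (sym_group 6) (cells_of_dim (cells p) (cell_dim p) k)
      (cell_action (cells_of_dim (cells p) (cell_dim p) k) (act p))"
    using transitive_action_cells[OF assms] by auto
qed

end
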